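(* Let $(\Omega,\mu,T,\alpha)$ be a topologically mixing, measure-preserving Gibbs-Markov system. Let $\{f_n\}_{n\geq 1}\subset L$ be a sequence of real-valued functions such that for every $n$, $\int_\Omega f_n\,d\mu=0$ and $f_n$ is not of the form $\varphi\circ T-\varphi$ for any $\varphi\in L$, and let $(k_n)$ be a sequence of positive integers with $k_n\to\infty$. Let $$\sigma_n^2:=\lim_{N\to\infty}\frac1N\int_\Omega\Big(\sum_{m=0}^{N-1}f_n\circ T^m\Big)^2d\mu$$ be the asymptotic variance of $f_n$ (with $\sigma_n>0$ its square root). If $$\lim_{n\to\infty}\frac{\|f_n\|^3}{\sqrt{k_n}\,\sigma_n^3}=0,$$ then $$\frac{f_n+f_n\circ T+\cdots+f_n\circ T^{k_n-1}}{\sqrt{k_n\sigma_n^2}}$$ converges in distribution (under $\mu$) to the standard normal law $\mathcal N(0,1)$ as $n\to\infty$.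
   Context: Gibbs-Markov systems. Let $(\Omega,\mathcal B,\mu,T)$ be a nonsingular transformation of a standard probability space and $\alpha=\{a_i:i\in I\}$ a countable partition of $\Omega$ mod $\mu$. Write $\sigma(\cdot)$ for the generated $\sigma$-algebra and $T\alpha=\{Ta:a\in\alpha\}$. For $x,y\in\Omega$ let $s(x,y)=\min\{n+1: n\geq 0,\ T^n(x)\text{ and }T^n(y)\text{ belong to different elements of }\alpha\}$ ($=\infty$ if there is no such $n$), and for $r\in(0,1)$ let $r(x,y)=r^{s(x,y)}$. $(\Omega,\mu,T,\alpha)$ is a Gibbs-Markov system if, modulo $\mu$: (1) $\sigma(\{T^{-n}\alpha:n\geq0\})=\mathcal B$; (2) for every $a\in\alpha$, $Ta\in\sigma(\alpha)$ and $T|_a$ is invertible and two-sided nonsingular; (3) $\inf_{a\in\alpha}\mu(Ta)>0$; (4) for $n\geq1$ and $a\in\bigvee_{i=0}^{n-1}T^{-i}\alpha$, let $v_a:T^na\to a$ be the nonsingular inverse branch of $T^n$ and $v_a'$ its Radon-Nikodym derivative; there exist $r\in(0,1)$ and $M>0$ such that for all such $n,a$ and all $x,y\in T^na$, $\left|\frac{v_a'(x)}{v_a'(y)}-1\right|\leq M\,r(x,y)$. The number $r$ (hence the metric $r(\cdot,\cdot)$) is fixed as part of the system. Measure-preserving means $\mu\circ T^{-1}=\mu$. Topologically mixing means: for any $a,b\in\alpha$ there is $n_{a,b}\in\mathbb N$ such that $b\subset T^na$ for every $n>n_{a,b}$. Function space. For a partition $\rho$ of $\Omega$ and $f:\Omega\to\mathbb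 C$ let $D_\rho f=\sup_{b\in\rho}\sup_{x,y\in b,\,x\neq y}\frac{|f(x)-f(y)|}{r(x,y)}$ (suprema understood $\mu$-almost everywhere). Fix a partition $\beta$ with $\sigma(\beta)=\sigma(T\alpha)$. Put $\|f\|=\|f\|_\infty+D_\beta f$ and let $L$ be the Banach space of functions $f$ with $\|f\|<\infty$. For $f\in L$ real-valued with $\int f\,d\mu=0$, the limit defining the asymptotic variance exists, and it is nonzero if and only if $f$ is not of the form $\varphi\circ T-\varphi$ with $\varphi\in L$. *)

theory Defs
  imports "HOL-Probability.Probability"
begin

text \<open>
  Everything is understood modulo null sets, so the set-theoretic conditions below are stated up to
  \<^term>\<open>null_sets M\<close> throughout.
\<close>

text \<open>A Polish space with its Borel sets, or with any sigma-algebra between these and their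
  completion; both the Borel and the completed convention for standard probability spaces are
  thus covered.\<close>

definition standard_prob_space :: "'a measure \<Rightarrow> bool" where
  "standard_prob_space M \<longleftrightarrow> prob_space M \<and>
     (\<exists>X. completely_metrizable_space X \<and> separable_space X \<and> topspace X = space M \<and>
        (let Bor = sigma_sets (topspace X) {U. openin X U} in
           Bor \<subseteq> sets M \<and>
           (\<forall>A\<in>sets M. \<exists>B\<in>Bor. \<exists>C\<in>Bor. B \<subseteq> A \<and> A \<subseteq> C \<and> C - B \<in> null_sets M)))"

definition nonsingular :: "'a measure \<Rightarrow> ('a \<Rightarrow> 'a) \<Rightarrow> bool" where
  "nonsingular M T \<longleftrightarrow> T \<in> M \<rightarrow>\<^sub>M M \<and>
     (\<forall>E\<in>sets M. T -` E \<inter> space M \<in> null_sets M \<longleftrightarrow> E \<in> null_sets M)"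

definition measure_preserving_map :: "'a measure \<Rightarrow> ('a \<Rightarrow> 'a) \<Rightarrow> bool" where
  "measure_preserving_map M T \<longleftrightarrow> T \<in> M \<rightarrow>\<^sub>M M \<and> distr M M T = M"

text \<open>Null elements are not excluded: they are irrelevant in every notion below, and for the
  partition of a Gibbs-Markov system they are ruled out by the big image condition.\<close>

definition partition_mod :: "'a measure \<Rightarrow> 'a set set \<Rightarrow> bool" where
  "partition_mod M P \<longleftrightarrow> countable P \<and> P \<subseteq> sets M \<and>
     (\<forall>a\<in>P. \<forall>b\<in>P. a \<noteq> b \<longrightarrow> a \<inter> b \<in> null_sets M) \<and>
     space M - \<Union>P \<in> null_sets M"

definition sigma_mod :: "'a measure \<Rightarrow> 'a set set \<Rightarrow> 'a set set" where
  "sigma_mod M G = sigma_sets (space M) (G \<union> null_sets M)"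

text \<open>
  The map \<open>v\<close> is the nonsingular inverse branch \<open>S a \<rightarrow> a\<close> of \<open>S\<close>, and the set \<open>B\<close> is a version of
  \<open>S a\<close>. For \<open>S\<close> restricted to \<open>a\<close> this says: after removal of a null set from \<open>a\<close>, it is a
  bijection onto \<open>B\<close> with measurable inverse \<open>v\<close>, nonsingular in both directions. Two pairs \<open>(B, v)\<close>
  for the same \<open>S\<close> and \<open>a\<close> agree up to null sets. The plain image of \<open>a\<close> under \<open>S\<close> would not do,
  since a null subset of \<open>a\<close> may have an image that is not null.
\<close>

definition inverse_branch ::
    "'a measure \<Rightarrow> ('a \<Rightarrow> 'a) \<Rightarrow> 'a set \<Rightarrow> 'a set \<Rightarrow> ('a \<Rightarrow> 'a) \<Rightarrow> bool" where
  "inverse_branch M S a B v \<longleftrightarrow>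
     B \<in> sets M \<and> v \<in> restrict_space M B \<rightarrow>\<^sub>M M \<and>
     (\<forall>y\<in>B. v y \<in> a \<and> S (v y) = y) \<and> a - v ` B \<in> null_sets M \<and>
     (\<forall>E\<in>sets M. E \<subseteq> B \<longrightarrow>
        v ` E \<in> sets M \<and> (v ` E \<in> null_sets M \<longleftrightarrow> E \<in> null_sets M))"

text \<open>\<open>T\<alpha>\<close>, as the family of all versions of the sets \<open>T a\<close>.\<close>

definition images :: "'a measure \<Rightarrow> ('a \<Rightarrow> 'a) \<Rightarrow> 'a set set \<Rightarrow> 'a set set" where
  "images M T \<alpha> = {B. \<exists>a\<in>\<alpha>. \<exists>v. inverse_branch M T a B v}"

text \<open>The Radon-Nikodym derivative of the measure \<open>E \<mapsto> \<mu> (v (E \<inter> B))\<close> with respect to \<open>\<mu>\<close>.\<close>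

definition branch_deriv :: "'a measure \<Rightarrow> 'a set \<Rightarrow> ('a \<Rightarrow> 'a) \<Rightarrow> 'a \<Rightarrow> real" where
  "branch_deriv M B v y =
     enn2real (RN_deriv M (measure_of (space M) (sets M) (\<lambda>E. emeasure M (v ` (E \<inter> B)))) y)"

definition cylinders :: "'a measure \<Rightarrow> ('a \<Rightarrow> 'a) \<Rightarrow> 'a set set \<Rightarrow> nat \<Rightarrow> 'a set set" where
  "cylinders M T \<alpha> n =
     {space M \<inter> (\<Inter>i<n. (T ^^ i) -` w i) |w. \<forall>i<n. w i \<in> \<alpha>}"

definition sep_time :: "('a \<Rightarrow> 'a) \<Rightarrow> 'a set set \<Rightarrow> 'a \<Rightarrow> 'a \<Rightarrow> enat" where
  "sep_time T \<alpha> x y =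
     (INF n\<in>{n. \<exists>a\<in>\<alpha>. \<exists>b\<in>\<alpha>. a \<noteq> b \<and> (T ^^ n) x \<in> a \<and> (T ^^ n) y \<in> b}. enat (n + 1))"

definition sep_dist :: "('a \<Rightarrow> 'a) \<Rightarrow> 'a set set \<Rightarrow> real \<Rightarrow> 'a \<Rightarrow> 'a \<Rightarrow> real" where
  "sep_dist T \<alpha> r x y = (case sep_time T \<alpha> x y of enat k \<Rightarrow> r ^ k | \<infinity> \<Rightarrow> 0)"

definition gibbs_markov :: "'a measure \<Rightarrow> ('a \<Rightarrow> 'a) \<Rightarrow> 'a set set \<Rightarrow> real \<Rightarrow> bool" where
  "gibbs_markov M T \<alpha> r \<longleftrightarrow>
     standard_prob_space M \<and> nonsingular M T \<and> partition_mod M \<alpha> \<and>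
     sigma_mod M {(T ^^ n) -` a \<inter> space M |n a. a \<in> \<alpha>} = sets M \<and>
     (\<forall>a\<in>\<alpha>. \<exists>B v. inverse_branch M T a B v \<and> B \<in> sigma_mod M \<alpha>) \<and>
     (INF B\<in>images M T \<alpha>. emeasure M B) > 0 \<and>
     0 < r \<and> r < 1 \<and>
     (\<exists>C>0. \<forall>n\<ge>1. \<forall>a\<in>cylinders M T \<alpha> n. \<forall>B v. inverse_branch M (T ^^ n) a B v \<longrightarrow>
        (\<exists>N\<in>null_sets M. \<forall>x\<in>B - N. \<forall>y\<in>B - N.
           \<bar>branch_deriv M B v x / branch_deriv M B v y - 1\<bar> \<le> C * sep_dist T \<alpha> r x y))"

text \<open>\<open>b \<subseteq> S a\<close> modulo null sets. The inclusion has to persist when a null set is removed from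
  \<open>a\<close>, because the points of such a set may have an image that is not null.\<close>

definition subset_image_mod :: "'a measure \<Rightarrow> ('a \<Rightarrow> 'a) \<Rightarrow> 'a set \<Rightarrow> 'a set \<Rightarrow> bool" where
  "subset_image_mod M S b a \<longleftrightarrow>
     (\<forall>N\<in>null_sets M. \<exists>N'\<in>null_sets M. b - N' \<subseteq> S ` (a - N))"

definition topologically_mixing :: "'a measure \<Rightarrow> ('a \<Rightarrow> 'a) \<Rightarrow> 'a set set \<Rightarrow> bool" where
  "topologically_mixing M T \<alpha> \<longleftrightarrow>
     (\<forall>a\<in>\<alpha>. \<forall>b\<in>\<alpha>. \<exists>n0. \<forall>n>n0. subset_image_mod M (T ^^ n) b a)"

text \<open>The quotients are taken in \<^typ>\<open>ennreal\<close>, where \<open>c / 0 = \<infinity>\<close> for \<open>c > 0\<close> and \<open>0 / 0 = 0\<close>.\<close>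

definition lip_seminorm ::
    "'a measure \<Rightarrow> ('a \<Rightarrow> 'a) \<Rightarrow> 'a set set \<Rightarrow> real \<Rightarrow> 'a set set \<Rightarrow> ('a \<Rightarrow> complex) \<Rightarrow> ennreal" where
  "lip_seminorm M T \<alpha> r \<rho> f =
     (INF N\<in>null_sets M. SUP b\<in>\<rho>. SUP (x, y)\<in>{(x, y). x \<in> b - N \<and> y \<in> b - N \<and> x \<noteq> y}.
        ennreal (cmod (f x - f y)) / ennreal (sep_dist T \<alpha> r x y))"

definition lip_norm ::
    "'a measure \<Rightarrow> ('a \<Rightarrow> 'a) \<Rightarrow> 'a set set \<Rightarrow> real \<Rightarrow> 'a set set \<Rightarrow> ('a \<Rightarrow> complex) \<Rightarrow> ennreal" where
  "lip_norm M T \<alpha> r \<beta> f =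
     esssup M (\<lambda>x. ennreal (cmod (f x))) + lip_seminorm M T \<alpha> r \<beta> f"

definition lip_space ::
    "'a measure \<Rightarrow> ('a \<Rightarrow> 'a) \<Rightarrow> 'a set set \<Rightarrow> real \<Rightarrow> 'a set set \<Rightarrow> ('a \<Rightarrow> complex) set" where
  "lip_space M T \<alpha> r \<beta> = {f \<in> borel_measurable M. lip_norm M T \<alpha> r \<beta> f < \<infinity>}"

definition asymptotic_variance :: "'a measure \<Rightarrow> ('a \<Rightarrow> 'a) \<Rightarrow> ('a \<Rightarrow> real) \<Rightarrow> real" where
  "asymptotic_variance M T f =
     lim (\<lambda>N. 1 / real N * (\<integral>x. (\<Sum>m<N. f ((T ^^ m) x))\<^sup>2 \<partial>M))"

end

theory Submission
  imports Defs
begin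

text \<open>
  Instead of perturbing the spectrum of the transfer operator, the proof uses the martingale
  approximation of Gordin. The transfer operator \<open>P\<close> contracts densities with bounded Lipschitz
  constant: by the big image property and topological mixing, some iterate of \<open>P\<close> maps them all
  above a common multiple of the indicator of one element of \<open>\<alpha>\<close>, and removing this common part
  leaves a density of the same class (coupling). So \<open>g = H - P H\<close> is solvable with control of the
  norm when \<open>g\<close> has mean zero. This gives \<open>f = m - h + h \<circ> T\<close> with \<open>P m = 0\<close>, where the asymptotic
  variance is the integral of \<open>m\<^sup>2\<close> and vanishes only for coboundaries. A second use of the
  equation removes the fluctuation of \<open>P (m\<^sup>2)\<close>, so that the characteristic function of the
  normalized sum satisfies a one-step recursion whose total error over \<open>k\<close> steps is
  \<open>O (\<parallel>f\<parallel>\<^sup>3 / (\<sigma>\<^sup>3 \<surd>k))\<close>; Levy's continuity theorem concludes.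
\<close>

section \<open>Inverse branches\<close>

text \<open>The functions vary with n, so a limit theorem for one fixed function cannot be applied:
  every constant has to depend on the system alone, and the norm of f has to enter homogeneously.
  Therefore \<open>m\<close> and \<open>h\<close> are bounded by A, a constant multiple of the norm
  of f, and the second corrector \<open>H\<close> by \<open>A\<^sup>2\<close>. With \<theta> = t /
  (\<sigma> sqrt k), a direct expansion of exp (i \<theta> m) would leave in each step the
  second-order term \<theta>^2 (P (m^2) - v) / 2, where v is the integral of m^2; the crude bound
  for k such terms is of order (A / \<sigma>)^2, which need not tend to 0. Being of the form H - P
  H, the fluctuation P (m^2) - v can instead be absorbed into a weight, and the loss per step
  becomes of third order. What remains is of order (A / \<sigma>)^2 / k or (A / \<sigma>) / sqrt k,
  and \<sigma> \<le> A puts both below the cubic rate. The second obstacle is measure-theoretic: T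
  may map a null set to a set that is not null. Images are therefore only handled through inverse
  branches, which respect null sets in both directions, and inclusions between images and partition
  elements are read modulo null sets.\<close>

lemma inverse_branchD:
  assumes "inverse_branch M S a B v"
  shows "B \<in> sets M" "v \<in> restrict_space M B \<rightarrow>\<^sub>M M" "a - v ` B \<in> null_sets M"
    and "y \<in> B \<Longrightarrow> v y \<in> a" "y \<in> B \<Longrightarrow> S (v y) = y"
  using assms unfolding inverse_branch_def by simp_all

lemma inverse_branch_null_iff:
  assumes "inverse_branch M S a B v" "E \<in> sets M" "E \<subseteq> B"
  shows "v ` E \<in> null_sets M \<longleftrightarrow> E \<in> null_sets M"
  using assms by (auto simp: inverse_branch_def)

lemma inverse_branch_sets:
  assumes "inverse_branch M S a B v" "E \<in> sets M" "E \<subseteq> B"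
  shows "v ` E \<in> sets M"
  using assms by (auto simp: inverse_branch_def)

lemma inverse_branch_image_diff:
  assumes "inverse_branch M S a B v"
  shows "(a \<inter> S -` E) - v ` (E \<inter> B) \<subseteq> a - v ` B" "v ` (E \<inter> B) \<subseteq> a \<inter> S -` E"
  using assms unfolding inverse_branch_def by auto

text \<open>The two sets differ only by points of a that the branch misses, which form a null set.
  This expresses the measure transported by v through S alone.\<close>

lemma inverse_branch_emeasure:
  assumes ib: "inverse_branch M S a B v" and S: "S \<in> M \<rightarrow>\<^sub>M M" and a: "a \<in> sets M" and E: "E \<in> sets M"
  shows "emeasure M (v ` (E \<inter> B)) = emeasure M (a \<inter> S -` E)"
proof -
  have B: "B \<in> sets M" and img: "v ` (E \<inter> B) \<in> sets M"
    using ib E unfolding inverse_branch_def by auto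
  have "a \<inter> S -` E = a \<inter> (S -` E \<inter> space M)"
    using sets.sets_into_space[OF a] by auto
  then have aE: "a \<inter> S -` E \<in> sets M"
    using measurable_sets[OF S E] a by auto
  have "a - v ` B \<in> null_sets M"
    using ib unfolding inverse_branch_def by auto
  then have "(a \<inter> S -` E) - v ` (E \<inter> B) \<in> null_sets M"
    using inverse_branch_image_diff[OF ib] aE img by (meson null_sets_subset sets.Diff)
  then have "emeasure M (a \<inter> S -` E) = emeasure M ((a \<inter> S -` E) - ((a \<inter> S -` E) - v ` (E \<inter> B)))"
    using aE by (metis emeasure_Diff_null_set)
  also have "(a \<inter> S -` E) - ((a \<inter> S -` E) - v ` (E \<inter> B)) = v ` (E \<inter> B)"
    using inverse_branch_image_diff(2)[OF ib, of E] by auto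
  finally show ?thesis by simp
qed

text \<open>For y in B - B' the point v y lies in a but not in the range of v': from v y = v' y' an
  application of S would give y = y'. So v maps B - B' into a null set, and v reflects null
  sets.\<close>

lemma inverse_branch_unique:
  assumes ib: "inverse_branch M S a B v" and ib': "inverse_branch M S a B' v'"
  shows "B - B' \<in> null_sets M"
proof -
  have B: "B - B' \<in> sets M" using ib ib' unfolding inverse_branch_def by auto
  then have img: "v ` (B - B') \<in> sets M" using ib unfolding inverse_branch_def by auto
  have "v ` (B - B') \<subseteq> a - v' ` B'"
    using ib ib' unfolding inverse_branch_def by auto
  moreover have "a - v' ` B' \<in> null_sets M" using ib' unfolding inverse_branch_def by auto
  ultimately have "v ` (B - B') \<in> null_sets M" using img by (meson null_sets_subset)
  then show ?thesis using inverse_branch_null_iff[OF ib B] by auto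
qed

text \<open>A point of the domain missed by u \<circ> v is either missed by u or sent by T to a
  point missed by v; the second set is null because preimages of null sets under T are null. The
  domain of v has to be cut down to those y whose image v y can be fed into u.\<close>

lemma inverse_branch_comp:
  assumes ib: "inverse_branch M T a A u" and ib': "inverse_branch M S a' B v"
    and T: "T \<in> M \<rightarrow>\<^sub>M M" and nonsing: "\<And>N. N \<in> null_sets M \<Longrightarrow> T -` N \<inter> space M \<in> null_sets M"
    and a: "a \<in> sets M" and a': "a' \<in> sets M"
  shows "inverse_branch M (S \<circ> T) (a \<inter> T -` a') {y \<in> B. v y \<in> A} (u \<circ> v)"
proof -
  let ?B = "{y \<in> B. v y \<in> A}"
  have A: "A \<in> sets M" and B: "B \<in> sets M" and v: "v \<in> restrict_space M B \<rightarrow>\<^sub>M M"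
    and u: "u \<in> restrict_space M A \<rightarrow>\<^sub>M M"
    using ib ib' unfolding inverse_branch_def by auto
  have "v -` A \<inter> space (restrict_space M B) \<in> sets (restrict_space M B)"
    using v A by (rule measurable_sets)
  moreover have "v -` A \<inter> space (restrict_space M B) = ?B"
    using sets.sets_into_space[OF B] by (auto simp: space_restrict_space)
  ultimately have B': "?B \<in> sets M"
    using B by (metis sets.Int_space_eq2 sets_restrict_space_iff)
  have v': "v \<in> restrict_space M ?B \<rightarrow>\<^sub>M restrict_space M A"
  proof (rule measurable_restrict_space2)
    show "v \<in> restrict_space M ?B \<rightarrow>\<^sub>M M"
      using v by (rule measurable_restrict_mono) auto
  qed (auto simp: space_restrict_space)
  have uv: "u \<circ> v \<in> restrict_space M ?B \<rightarrow>\<^sub>M M"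
    using v' u by (rule measurable_comp)
  have sub: "\<forall>y\<in>?B. (u \<circ> v) y \<in> a \<inter> T -` a' \<and> (S \<circ> T) ((u \<circ> v) y) = y"
    using ib ib' unfolding inverse_branch_def by auto
  have sets_img: "(u \<circ> v) ` E \<in> sets M \<and> ((u \<circ> v) ` E \<in> null_sets M \<longleftrightarrow> E \<in> null_sets M)"
    if "E \<in> sets M" "E \<subseteq> ?B" for E
  proof -
    have "v ` E \<in> sets M" "v ` E \<subseteq> A" "v ` E \<in> null_sets M \<longleftrightarrow> E \<in> null_sets M"
      using ib' that unfolding inverse_branch_def by auto
    then show ?thesis using ib unfolding inverse_branch_def image_comp[symmetric] by auto
  qed
  have "a \<inter> T -` a' - (u \<circ> v) ` ?B \<subseteq> (a - u ` A) \<union> (T -` (a' - v ` B) \<inter> space M)"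
  proof
    fix z assume z: "z \<in> a \<inter> T -` a' - (u \<circ> v) ` ?B"
    have zs: "z \<in> space M" using z sets.sets_into_space[OF a] by auto
    show "z \<in> (a - u ` A) \<union> (T -` (a' - v ` B) \<inter> space M)"
    proof (rule ccontr)
      assume *: "\<not> ?thesis"
      then obtain y x where "x \<in> A" "z = u x" "y \<in> B" "T z = v y"
        using z zs by auto
      moreover from this have "T z = x" using ib unfolding inverse_branch_def by auto
      ultimately have "z = (u \<circ> v) y" "y \<in> ?B" by auto
      then show False using z by blast
    qed
  qed
  moreover have "(a - u ` A) \<union> (T -` (a' - v ` B) \<inter> space M) \<in> null_sets M"
    using ib ib' nonsing unfolding inverse_branch_def by auto
  moreover have "a \<inter> T -` a' - (u \<circ> v) ` ?B \<in> sets M"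
  proof -
    have "a \<inter> T -` a' = a \<inter> (T -` a' \<inter> space M)"
      using sets.sets_into_space[OF a] by auto
    then show ?thesis using measurable_sets[OF T a'] a sets_img[of ?B] B' by auto
  qed
  ultimately have null: "a \<inter> T -` a' - (u \<circ> v) ` ?B \<in> null_sets M"
    by (meson null_sets_subset)
  show ?thesis
    unfolding inverse_branch_def using B' uv sub null sets_img by blast
qed

section \<open>Radon-Nikodym derivatives of inverse branches\<close>

text \<open>The measure transported by v is the image under S of the measure restricted to a. In
  this form it is built by \<open>distr\<close> and \<open>density\<close>, and the choice of the
  branch disappears.\<close>

lemma branch_deriv_eq_RN_deriv:
  assumes ib: "inverse_branch M S a B v" and S: "S \<in> M \<rightarrow>\<^sub>M M" and a: "a \<in> sets M"
  shows "branch_deriv M B v y = enn2real (RN_deriv M (distr (density M (indicator a)) M S) y)"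
proof -
  let ?\<kappa> = "distr (density M (indicator a)) M S"
  have S': "S \<in> density M (indicator a) \<rightarrow>\<^sub>M M" using S by simp
  have \<kappa>: "emeasure ?\<kappa> E = emeasure M (v ` (E \<inter> B))" if E: "E \<in> sets M" for E
  proof -
    have "a \<inter> S -` E = a \<inter> (S -` E \<inter> space M)"
      using sets.sets_into_space[OF a] by auto
    moreover have "emeasure ?\<kappa> E = emeasure M (a \<inter> (S -` E \<inter> space M))"
      using measurable_sets[OF S E] a
      by (simp add: emeasure_distr[OF S' E] emeasure_density nn_integral_indicator
            flip: indicator_inter_arith)
    ultimately show ?thesis using inverse_branch_emeasure[OF ib S a E] by simp
  qed
  have "measure_of (space M) (sets M) (\<lambda>E. emeasure M (v ` (E \<inter> B)))
      = measure_of (space M) (sets M) (emeasure ?\<kappa>)"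
    by (rule measure_of_eq) (auto simp: \<kappa> sets.space_closed sets.sigma_sets_eq)
  also have "\<dots> = ?\<kappa>"
    using measure_of_of_measure[of ?\<kappa>] by simp
  finally show ?thesis unfolding branch_deriv_def by simp
qed

context prob_space
begin

text \<open>The image measure is finite, so its Radon-Nikodym derivative is finite almost everywhere
  and the passage to real values by \<open>enn2real\<close> loses nothing.\<close>

lemma branch_deriv_density:
  assumes ib: "inverse_branch M S a B v" and S: "S \<in> M \<rightarrow>\<^sub>M M" and a: "a \<in> sets M"
    and nonsing: "\<And>N. N \<in> null_sets M \<Longrightarrow> S -` N \<inter> space M \<in> null_sets M"
  shows "branch_deriv M B v \<in> borel_measurable M" (is ?meas)
    and "density M (branch_deriv M B v) = distr (density M (indicator a)) M S" (is ?dens)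
proof -
  let ?\<kappa> = "distr (density M (indicator a)) M S"
  have S': "S \<in> density M (indicator a) \<rightarrow>\<^sub>M M" using S by simp
  have eq: "branch_deriv M B v = (\<lambda>y. enn2real (RN_deriv M ?\<kappa> y))"
    using branch_deriv_eq_RN_deriv[OF ib S a] by auto
  show ?meas unfolding eq by measurable
  have ac: "absolutely_continuous M ?\<kappa>"
    unfolding absolutely_continuous_def
  proof
    fix N assume N: "N \<in> null_sets M"
    have "emeasure ?\<kappa> N = emeasure M (a \<inter> (S -` N \<inter> space M))"
      using measurable_sets[OF S, of N] a N
      by (simp add: emeasure_distr[OF S'] emeasure_density nn_integral_indicator null_setsD2
            flip: indicator_inter_arith)
    also have "\<dots> = 0" using null_set_Int1[OF nonsing[OF N] a] by (rule null_setsD1)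
    finally have "emeasure ?\<kappa> N = 0" .
    then show "N \<in> null_sets ?\<kappa>" using N by (intro null_setsI) auto
  qed
  have fin: "finite_measure ?\<kappa>"
  proof
    have "S -` space M \<inter> space M = space M" using measurable_space[OF S] by auto
    then have "emeasure ?\<kappa> (space ?\<kappa>) = emeasure M a"
      using a sets.sets_into_space[OF a]
      by (simp add: emeasure_distr[OF S'] emeasure_density nn_integral_indicator Int_absorb2
            flip: indicator_inter_arith)
    then show "emeasure ?\<kappa> (space ?\<kappa>) \<noteq> \<infinity>" by simp
  qed
  then interpret K: finite_measure ?\<kappa> .
  have "AE y in M. RN_deriv M ?\<kappa> y \<noteq> \<infinity>"
    by (rule RN_deriv_finite[OF K.sigma_finite_measure_axioms ac]) simp
  then have "AE y in M. ennreal (branch_deriv M B v y) = RN_deriv M ?\<kappa> y"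
    unfolding eq by eventually_elim (simp add: less_top)
  then have "density M (branch_deriv M B v) = density M (RN_deriv M ?\<kappa>)"
    by (intro density_cong) (auto simp: eq)
  also have "\<dots> = ?\<kappa>" by (rule density_RN_deriv[OF ac]) simp
  finally show ?dens .
qed

lemma branch_deriv_nonneg: "0 \<le> branch_deriv M B v y"
  unfolding branch_deriv_def by simp

lemma nn_integral_branch_deriv:
  assumes ib: "inverse_branch M S a B v" and S: "S \<in> M \<rightarrow>\<^sub>M M" and a: "a \<in> sets M"
    and nonsing: "\<And>N. N \<in> null_sets M \<Longrightarrow> S -` N \<inter> space M \<in> null_sets M"
    and g: "g \<in> borel_measurable M"
  shows "(\<integral>\<^sup>+y. ennreal (branch_deriv M B v y) * g y \<partial>M) = (\<integral>\<^sup>+x. indicator a x * g (S x) \<partial>M)"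
proof -
  note [measurable] = branch_deriv_density(1)[OF ib S a nonsing] g S a
  have "(\<integral>\<^sup>+y. ennreal (branch_deriv M B v y) * g y \<partial>M) = (\<integral>\<^sup>+y. g y \<partial>density M (branch_deriv M B v))"
    by (subst nn_integral_density) auto
  also have "\<dots> = (\<integral>\<^sup>+x. g (S x) \<partial>density M (indicator a))"
    by (simp add: branch_deriv_density(2)[OF ib S a nonsing] nn_integral_distr)
  also have "\<dots> = (\<integral>\<^sup>+x. indicator a x * g (S x) \<partial>M)"
    by (subst nn_integral_density) auto
  finally show ?thesis .
qed

text \<open>The part of B where the derivative vanishes is mapped by v to a set of measure 0, so it
  is itself null by two-sided nonsingularity. Positivity is what allows the quotient in the
  distortion condition to be multiplied out.\<close>

lemma branch_deriv_pos:
  assumes ib: "inverse_branch M S a B v" and S: "S \<in> M \<rightarrow>\<^sub>M M" and a: "a \<in> sets M"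
    and nonsing: "\<And>N. N \<in> null_sets M \<Longrightarrow> S -` N \<inter> space M \<in> null_sets M"
  shows "AE y in M. y \<in> B \<longrightarrow> 0 < branch_deriv M B v y"
    and "AE y in M. y \<notin> B \<longrightarrow> branch_deriv M B v y = 0"
proof -
  note [measurable] = branch_deriv_density(1)[OF ib S a nonsing]
  have B: "B \<in> sets M" using ib unfolding inverse_branch_def by auto
  let ?J = "branch_deriv M B v"
  have int: "(\<integral>\<^sup>+y. ennreal (?J y) * indicator E y \<partial>M) = emeasure M (v ` (E \<inter> B))"
    if E: "E \<in> sets M" for E
  proof -
    have *: "a \<inter> S -` E = a \<inter> (S -` E \<inter> space M)"
      using sets.sets_into_space[OF a] by auto
    have aE: "a \<inter> S -` E \<in> sets M" unfolding * using measurable_sets[OF S E] a by auto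
    have "(\<integral>\<^sup>+y. ennreal (?J y) * indicator E y \<partial>M) = (\<integral>\<^sup>+x. indicator a x * indicator E (S x) \<partial>M)"
      by (rule nn_integral_branch_deriv[OF ib S a nonsing]) (use E in auto)
    also have "\<dots> = (\<integral>\<^sup>+x. indicator (a \<inter> S -` E) x \<partial>M)"
      by (intro nn_integral_cong) (auto simp: indicator_def)
    also have "\<dots> = emeasure M (a \<inter> S -` E)" using aE by simp
    finally show ?thesis using inverse_branch_emeasure[OF ib S a E] by simp
  qed
  let ?Z = "{y \<in> space M. y \<in> B \<and> ?J y = 0}"
  have Z[measurable]: "?Z \<in> sets M" using B by measurable
  have "emeasure M (v ` ?Z) = (\<integral>\<^sup>+y. ennreal (?J y) * indicator ?Z y \<partial>M)"
    using int[OF Z] Int_absorb2[of ?Z B] by force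
  also have "\<dots> = (\<integral>\<^sup>+y. 0 \<partial>M)" by (intro nn_integral_cong) (auto simp: indicator_def)
  finally have "emeasure M (v ` ?Z) = 0" by simp
  moreover have "v ` ?Z \<in> sets M" by (rule inverse_branch_sets[OF ib Z]) auto
  ultimately have "v ` ?Z \<in> null_sets M" by (rule null_setsI)
  moreover have "?Z \<subseteq> B" by auto
  ultimately have "?Z \<in> null_sets M"
    using inverse_branch_null_iff[OF ib Z] by simp
  then have "AE y in M. y \<notin> ?Z" by (rule AE_not_in)
  then show "AE y in M. y \<in> B \<longrightarrow> 0 < ?J y"
    using AE_space by eventually_elim (use branch_deriv_nonneg in \<open>auto simp: less_le\<close>)
  have "(\<integral>\<^sup>+y. ennreal (?J y) * indicator (space M - B) y \<partial>M) = 0"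
    using int[of "space M - B"] B by (simp add: Diff_Int_distrib2)
  then have "AE y in M. ennreal (?J y) * indicator (space M - B) y = 0"
    using B by (subst (asm) nn_integral_0_iff_AE) auto
  then show "AE y in M. y \<notin> B \<longrightarrow> ?J y = 0"
    using AE_space
    by eventually_elim (use branch_deriv_nonneg in \<open>auto simp: indicator_def ennreal_eq_0_iff less_le intro: antisym\<close>)
qed

end

section \<open>Bounded measurable functions\<close>

text \<open>The bound is required at every point: it then survives composition with an arbitrary
  inverse branch, and sums over branches converge without an exceptional set depending on the
  function.\<close>

definition bdd_meas :: "'a measure \<Rightarrow> ('a \<Rightarrow> real) \<Rightarrow> bool" where
  "bdd_meas M f \<longleftrightarrow> f \<in> borel_measurable M \<and> (\<exists>K. \<forall>x. \<bar>f x\<bar> \<le> K)"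

lemma bdd_measD: "bdd_meas M f \<Longrightarrow> f \<in> borel_measurable M"
  unfolding bdd_meas_def by simp

lemma bdd_measI: "f \<in> borel_measurable M \<Longrightarrow> (\<And>x. \<bar>f x\<bar> \<le> K) \<Longrightarrow> bdd_meas M f"
  unfolding bdd_meas_def by auto

lemma bdd_meas_const: "bdd_meas M (\<lambda>x. c)"
  by (rule bdd_measI[of _ _ "\<bar>c\<bar>"]) auto

lemma bdd_meas_add:
  assumes "bdd_meas M f" "bdd_meas M g"
  shows "bdd_meas M (\<lambda>x. f x + g x)"
proof -
  obtain K L where "\<And>x. \<bar>f x\<bar> \<le> K" "\<And>x. \<bar>g x\<bar> \<le> L" using assms unfolding bdd_meas_def by auto
  then have "\<bar>f x + g x\<bar> \<le> K + L" for x using abs_triangle_ineq[of "f x" "g x"] add_mono by (meson order_trans)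
  then show ?thesis using assms[THEN bdd_measD] by (intro bdd_measI) simp_all
qed

lemma bdd_meas_mult:
  assumes "bdd_meas M f" "bdd_meas M g"
  shows "bdd_meas M (\<lambda>x. f x * g x)"
proof -
  obtain K L where *: "\<And>x. \<bar>f x\<bar> \<le> K" "\<And>x. \<bar>g x\<bar> \<le> L" using assms unfolding bdd_meas_def by auto
  have "\<bar>f x * g x\<bar> \<le> K * L" for x
    unfolding abs_mult using * order_trans[OF abs_ge_zero *(1)] by (intro mult_mono) simp_all
  then show ?thesis using assms[THEN bdd_measD] by (intro bdd_measI) simp_all
qed

lemma bdd_meas_cmult: "bdd_meas M f \<Longrightarrow> bdd_meas M (\<lambda>x. c * f x)"
  by (intro bdd_meas_mult bdd_meas_const)

lemma bdd_meas_diff: "bdd_meas M f \<Longrightarrow> bdd_meas M g \<Longrightarrow> bdd_meas M (\<lambda>x. f x - g x)"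
  using bdd_meas_add[of M f "\<lambda>x. -1 * g x"] bdd_meas_cmult[of M g "-1"] by simp

lemma bdd_meas_power2: "bdd_meas M f \<Longrightarrow> bdd_meas M (\<lambda>x. (f x)\<^sup>2)"
  unfolding power2_eq_square by (rule bdd_meas_mult)

lemma bdd_meas_indicator: "E \<in> sets M \<Longrightarrow> bdd_meas M (indicator E)"
  by (rule bdd_measI[of _ _ 1]) (auto simp: indicator_def)

lemma bdd_meas_comp: "bdd_meas M f \<Longrightarrow> S \<in> M \<rightarrow>\<^sub>M M \<Longrightarrow> bdd_meas M (\<lambda>x. f (S x))"
  unfolding bdd_meas_def by (auto intro: measurable_compose)

lemma bdd_meas_sum: "(\<And>i. i \<in> I \<Longrightarrow> bdd_meas M (f i)) \<Longrightarrow> bdd_meas M (\<lambda>x. \<Sum>i\<in>I. f i x)"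
proof (induction I rule: infinite_finite_induct)
  case (insert i I)
  then show ?case using bdd_meas_add[of M "f i" "\<lambda>x. \<Sum>i\<in>I. f i x"] by simp
qed (simp_all add: bdd_meas_const)

lemmas bdd_meas_intros = bdd_meas_const bdd_meas_add bdd_meas_mult bdd_meas_cmult bdd_meas_diff
  bdd_meas_power2 bdd_meas_indicator

lemma (in prob_space) integrable_bdd_meas: "bdd_meas M f \<Longrightarrow> integrable M f"
  unfolding bdd_meas_def using integrable_const_bound[of f] by auto

lemma (in prob_space) norm_integral_le_AE:
  fixes f :: "'a \<Rightarrow> 'b :: {banach, second_countable_topology}"
  assumes "integrable M f" "AE x in M. norm (f x) \<le> c"
  shows "norm (\<integral>x. f x \<partial>M) \<le> c"
  using assms by (intro order_trans[OF integral_norm_bound integral_le_const] integrable_norm)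

text \<open>It suffices to test on the set where g < f. Statements about the transfer operator that
  are obtained by duality become inequalities almost everywhere in this way.\<close>

lemma (in prob_space) AE_le_of_set_integral_le:
  fixes f g :: "'a \<Rightarrow> real"
  assumes f: "bdd_meas M f" and g: "bdd_meas M g"
    and le: "\<And>E. E \<in> sets M \<Longrightarrow> (\<integral>x. f x * indicator E x \<partial>M) \<le> (\<integral>x. g x * indicator E x \<partial>M)"
  shows "AE x in M. f x \<le> g x"
proof -
  note [measurable] = bdd_measD[OF f] bdd_measD[OF g]
  define E where "E = {x \<in> space M. g x < f x}"
  have E[measurable]: "E \<in> sets M" unfolding E_def by measurable
  let ?h = "\<lambda>x. f x * indicator E x - g x * indicator E x"
  have fi: "integrable M (\<lambda>x. f x * indicator E x)" and gi: "integrable M (\<lambda>x. g x * indicator E x)"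
    by (intro integrable_bdd_meas bdd_meas_intros f g E)+
  have "(\<integral>x. ?h x \<partial>M) = (\<integral>x. f x * indicator E x \<partial>M) - (\<integral>x. g x * indicator E x \<partial>M)"
    by (rule Bochner_Integration.integral_diff[OF fi gi])
  then have "(\<integral>x. ?h x \<partial>M) \<le> 0" using le[OF E] by simp
  moreover have pos: "AE x in M. 0 \<le> ?h x" by (auto simp: E_def indicator_def)
  ultimately have "(\<integral>x. ?h x \<partial>M) = 0" using integral_nonneg_AE[OF pos] by simp
  then have "AE x in M. ?h x = 0"
    using integral_nonneg_eq_0_iff_AE[OF Bochner_Integration.integrable_diff[OF fi gi] pos] by simp
  then show ?thesis
    using AE_space by eventually_elim (auto simp: E_def indicator_def split: if_splits)
qed

section \<open>Characteristic functions of Birkhoff sums\<close>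

locale mp_prob_space = prob_space M for M :: "'a measure" +
  fixes T :: "'a \<Rightarrow> 'a"
  assumes T_mp: "measure_preserving_map M T"
begin

lemma T_measurable [measurable]: "T \<in> M \<rightarrow>\<^sub>M M"
  using T_mp unfolding measure_preserving_map_def by auto

lemma Tn_measurable [measurable]: "T ^^ n \<in> M \<rightarrow>\<^sub>M M"
  by (induction n) (auto intro: measurable_comp simp: id_def)

lemma distr_Tn: "distr M M (T ^^ n) = M"
proof (induction n)
  case 0
  show ?case by (simp add: id_def distr_id)
next
  case (Suc n)
  have "distr M M (T ^^ Suc n) = distr (distr M M T) M (T ^^ n)"
    unfolding funpow_Suc_right by (rule distr_distr[symmetric]) auto
  then show ?case using Suc.IH T_mp unfolding measure_preserving_map_def by (simp only:)
qed

lemma bdd_meas_Tn: "bdd_meas M f \<Longrightarrow> bdd_meas M (\<lambda>x. f ((T ^^ n) x))"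
  by (rule bdd_meas_comp) simp_all

lemma bdd_meas_T: "bdd_meas M f \<Longrightarrow> bdd_meas M (\<lambda>x. f (T x))"
  by (rule bdd_meas_comp) simp_all

lemma integral_T:
  fixes f :: "'a \<Rightarrow> 'b :: {banach, second_countable_topology}"
  assumes "f \<in> borel_measurable M"
  shows "(\<integral>x. f (T x) \<partial>M) = (\<integral>x. f x \<partial>M)"
  using integral_distr[OF T_measurable assms] T_mp unfolding measure_preserving_map_def by simp

lemma AE_Tn:
  assumes "AE x in M. Q x"
  shows "AE x in M. Q ((T ^^ n) x)"
proof -
  have "AE x in distr M M (T ^^ n). Q x" using assms by (simp only: distr_Tn)
  then show ?thesis by (rule AE_distrD[OF Tn_measurable])
qed

section \<open>Birkhoff sums and complex test functions\<close>

definition birkhoff :: "('a \<Rightarrow> real) \<Rightarrow> nat \<Rightarrow> 'a \<Rightarrow> real" where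
  "birkhoff f n x = (\<Sum>j<n. f ((T ^^ j) x))"

lemma birkhoff_0 [simp]: "birkhoff f 0 x = 0"
  unfolding birkhoff_def by simp

lemma birkhoff_Suc: "birkhoff f (Suc n) x = f x + birkhoff f n (T x)"
  unfolding birkhoff_def by (simp add: sum.lessThan_Suc_shift funpow_swap1 del: sum.lessThan_Suc)

lemma bdd_meas_birkhoff: "bdd_meas M f \<Longrightarrow> bdd_meas M (birkhoff f n)"
  unfolding birkhoff_def by (intro bdd_meas_sum bdd_meas_Tn)

text \<open>By invariance the relation holds almost surely along the whole orbit, the times being
  countably many, and then the sum telescopes.\<close>

lemma birkhoff_cohomologous:
  assumes "AE x in M. f x = m x - h x + h (T x)"
  shows "AE x in M. \<forall>n. birkhoff f n x = birkhoff m n x - h x + h ((T ^^ n) x)"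
proof -
  have "AE x in M. \<forall>j. f ((T ^^ j) x) = m ((T ^^ j) x) - h ((T ^^ j) x) + h (T ((T ^^ j) x))"
    unfolding AE_all_countable using AE_Tn[OF assms] by blast
  then show ?thesis
  proof eventually_elim
    fix x assume *: "\<forall>j. f ((T ^^ j) x) = m ((T ^^ j) x) - h ((T ^^ j) x) + h (T ((T ^^ j) x))"
    have "birkhoff f n x = birkhoff m n x - h x + h ((T ^^ n) x)" for n
      by (induction n) (use * in \<open>auto simp: birkhoff_def\<close>)
    then show "\<forall>n. birkhoff f n x = birkhoff m n x - h x + h ((T ^^ n) x)" by blast
  qed
qed

lemma integrable_complex_bdd:
  fixes g :: "'a \<Rightarrow> complex"
  assumes "g \<in> borel_measurable M" "\<And>x. cmod (g x) \<le> B"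
  shows "integrable M g"
  using assms by (intro integrable_const_bound[of g B]) auto

lemma integrable_bdd_mult_complex:
  fixes g :: "'a \<Rightarrow> complex"
  assumes u: "bdd_meas M u" and g: "g \<in> borel_measurable M" "\<And>x. cmod (g x) \<le> 1"
  shows "integrable M (\<lambda>x. of_real (u x) * g x)"
proof -
  obtain K where K: "\<And>x. \<bar>u x\<bar> \<le> K" using u unfolding bdd_meas_def by auto
  note [measurable] = bdd_measD[OF u] g(1)
  show ?thesis
  proof (rule integrable_complex_bdd[where B = "K * 1"])
    show "cmod (of_real (u x) * g x) \<le> K * 1" for x
      unfolding norm_mult norm_of_real using K[of x] g(2)[of x] abs_ge_zero[of "u x"]
      by (intro mult_mono) auto
  qed measurable
qed

lemma duality_complex:
  fixes G :: "'a \<Rightarrow> complex"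
  assumes u: "bdd_meas M u" and v: "bdd_meas M v"
    and dual: "\<And>g. bdd_meas M g \<Longrightarrow> (\<integral>x. u x * g (T x) \<partial>M) = (\<integral>x. v x * g x \<partial>M)"
    and G: "G \<in> borel_measurable M" "\<And>x. cmod (G x) \<le> 1"
  shows "(\<integral>x. of_real (u x) * G (T x) \<partial>M) = (\<integral>x. of_real (v x) * G x \<partial>M)"
proof -
  note [measurable] = G(1)
  have iu: "integrable M (\<lambda>x. of_real (u x) * G (T x))" and iv: "integrable M (\<lambda>x. of_real (v x) * G x)"
    by (intro integrable_bdd_mult_complex u v G; measurable)+
  have "bdd_meas M (\<lambda>x. Re (G x))" "bdd_meas M (\<lambda>x. Im (G x))"
    using order_trans[OF abs_Re_le_cmod G(2)] order_trans[OF abs_Im_le_cmod G(2)]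
    by (auto intro!: bdd_measI)
  from dual[OF this(1)] dual[OF this(2)] show ?thesis
    by (intro complex_eqI) (simp_all add: integral_Re[OF iu, symmetric] integral_Im[OF iu, symmetric]
      integral_Re[OF iv, symmetric] integral_Im[OF iv, symmetric] del: integral_Re integral_Im)
qed

text \<open>The four terms belong to four errors: the Taylor remainder of the exponential, the
  fourth-order product of v and \<open>H\<close>, the removal of the weight at both ends, and the
  boundary term of the coboundary of h.\<close>

definition char_error :: "real \<Rightarrow> real" where
  "char_error t = \<bar>t\<bar> ^ 3 + t ^ 4 + t\<^sup>2 + 2 * \<bar>t\<bar>"

end

section \<open>Distribution and variance under a martingale approximation\<close>

text \<open>\<open>m0\<close> is the dual form of P m = 0, so that m generates reverse martingale
  differences; \<open>var_m\<close> is the dual form of H - P H = P (m^2) - v. Stated by duality,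
  the probabilistic argument is independent of how the transfer operator is built. The single bound
  A carries the homogeneity: degree one for m and h, degree two for H.\<close>

locale martingale_approx = mp_prob_space M T for M :: "'a measure" and T :: "'a \<Rightarrow> 'a" +
  fixes f m h H :: "'a \<Rightarrow> real" and A :: real
  assumes f: "f \<in> borel_measurable M" "AE x in M. f x = m x - h x + h (T x)"
    and m: "bdd_meas M m" "AE x in M. \<bar>m x\<bar> \<le> A"
    and h: "bdd_meas M h" "AE x in M. \<bar>h x\<bar> \<le> A"
    and H: "bdd_meas M H" "AE x in M. \<bar>H x\<bar> \<le> A\<^sup>2"
    and m0: "bdd_meas M g \<Longrightarrow> (\<integral>x. m x * g (T x) \<partial>M) = 0"
    and var_m: "bdd_meas M g \<Longrightarrow>
      (\<integral>x. ((m x)\<^sup>2 + H x) * g (T x) \<partial>M) = (\<integral>x. ((\<integral>y. (m y)\<^sup>2 \<partial>M) + H x) * g x \<partial>M)"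
begin

definition v :: real where "v = (\<integral>x. (m x)\<^sup>2 \<partial>M)"

lemmas m2 = var_m[folded v_def]

lemma v: "0 \<le> v" and A: "0 \<le> A" and v_le: "v \<le> A\<^sup>2"
proof -
  show "0 \<le> v" unfolding v_def by simp
  have "AE x in M. 0 \<le> A" using m(2) by eventually_elim linarith
  then show "0 \<le> A" by simp
  show "v \<le> A\<^sup>2" unfolding v_def
  proof (rule integral_le_const[OF integrable_bdd_meas[OF bdd_meas_power2[OF m(1)]]])
    show "AE x in M. (m x)\<^sup>2 \<le> A\<^sup>2" using m(2) by eventually_elim (rule abs_le_square_iff[THEN iffD1], simp)
  qed
qed

text \<open>The weight \<open>1 - \<theta>\<^sup>2/2 H\<close> absorbs the fluctuation of the conditional variance of the
  martingale differences \<open>m\<close>: to third order it is an approximate eigenfunction of the transfer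
  operator twisted by \<open>exp (i \<theta> m)\<close>.\<close>

lemma char_recursion:
  fixes \<theta> :: real
  defines "V \<equiv> \<lambda>j. \<integral>x. of_real (1 - \<theta>\<^sup>2 / 2 * H x) * iexp (\<theta> * birkhoff m j x) \<partial>M"
  shows "cmod (V (Suc j) - of_real (1 - \<theta>\<^sup>2 * v / 2) * V j) \<le> \<bar>\<theta>\<bar> ^ 3 * A ^ 3 + \<theta> ^ 4 * v * A\<^sup>2 / 4"
proof -
  note [measurable] = bdd_measD[OF m(1)] bdd_measD[OF H(1)] bdd_measD[OF bdd_meas_birkhoff[OF m(1)]]
  define G where "G x = iexp (\<theta> * birkhoff m j x)" for x
  have G[measurable]: "G \<in> borel_measurable M" unfolding G_def by measurable
  have nG: "cmod (G x) = 1" for x unfolding G_def by simp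
  have GT: "(\<lambda>x. G (T x)) \<in> borel_measurable M" by measurable
  let ?i = "\<lambda>u x. complex_of_real (u x) * G (T x)"
  note int = integrable_bdd_mult_complex[OF _ GT, simplified nG, OF _ order_refl]
  have VS: "V (Suc j) = (\<integral>x. of_real (1 - \<theta>\<^sup>2 / 2 * H x) * (iexp (\<theta> * m x) * G (T x)) \<partial>M)"
    unfolding V_def G_def birkhoff_Suc by (simp add: exp_add[symmetric] algebra_simps)
  have bW: "bdd_meas M (\<lambda>x. 1 - \<theta>\<^sup>2 / 2 * H x)" by (intro bdd_meas_intros H)
  have iVS: "integrable M (\<lambda>x. of_real (1 - \<theta>\<^sup>2 / 2 * H x) * (iexp (\<theta> * m x) * G (T x)))"
    by (rule integrable_bdd_mult_complex[OF bW]) (simp_all add: norm_mult nG)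
  note intG = integrable_bdd_mult_complex[OF _ G, simplified nG, OF _ order_refl]
  have j1: "integrable M (\<lambda>x. of_real 1 * G x)" by (rule intG[OF bdd_meas_const])
  have j2: "integrable M (\<lambda>x. of_real (\<theta>\<^sup>2 / 2) * (of_real (v + H x) * G x))"
    by (intro integrable_mult_right intG bdd_meas_intros H)
  have j3: "integrable M (\<lambda>x. of_real (1 - \<theta>\<^sup>2 * v / 2) * (of_real (1 - \<theta>\<^sup>2 / 2 * H x) * G x))"
    by (intro integrable_mult_right intG bW)
  have j4: "integrable M (\<lambda>x. of_real (\<theta> ^ 4 * v / 4) * (of_real (H x) * G x))"
    by (intro integrable_mult_right intG H)
  \<comment> \<open>\<open>?Q\<close> keeps the terms up to second order of the weighted
    exponential, including the one from the weight. Each has the form u * G (T x), so duality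
    evaluates its integral: m contributes 0 and m^2 + H turns into v + H.\<close>
  let ?Q = "\<lambda>x. ?i (\<lambda>x. 1) x + \<i> * of_real \<theta> * ?i m x - of_real (\<theta>\<^sup>2 / 2) * ?i (\<lambda>x. (m x)\<^sup>2 + H x) x"
  have i1: "integrable M (?i (\<lambda>x. 1))" by (rule int[OF bdd_meas_const])
  have i2: "integrable M (\<lambda>x. \<i> * of_real \<theta> * ?i m x)"
    using int[OF m(1)] by (intro integrable_mult_right)
  have i3: "integrable M (\<lambda>x. of_real (\<theta>\<^sup>2 / 2) * ?i (\<lambda>x. (m x)\<^sup>2 + H x) x)"
    by (intro integrable_mult_right int bdd_meas_intros m H)
  have iQ: "integrable M ?Q"
    by (intro Bochner_Integration.integrable_diff Bochner_Integration.integrable_add i1 i2 i3)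
  have "(\<integral>x. ?Q x \<partial>M) = (\<integral>x. ?i (\<lambda>x. 1) x \<partial>M) + \<i> * of_real \<theta> * (\<integral>x. ?i m x \<partial>M)
      - of_real (\<theta>\<^sup>2 / 2) * (\<integral>x. ?i (\<lambda>x. (m x)\<^sup>2 + H x) x \<partial>M)"
    by (subst Bochner_Integration.integral_diff[OF Bochner_Integration.integrable_add[OF i1 i2] i3],
        subst Bochner_Integration.integral_add[OF i1 i2]) simp
  also have "(\<integral>x. ?i (\<lambda>x. 1) x \<partial>M) = (\<integral>x. of_real 1 * G x \<partial>M)"
    by (rule duality_complex[OF bdd_meas_const bdd_meas_const])
      (use nG integral_T[OF bdd_measD] in auto)
  also have "(\<integral>x. ?i m x \<partial>M) = (\<integral>x. of_real 0 * G x \<partial>M)"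
    by (rule duality_complex[OF m(1) bdd_meas_const]) (use nG m0 in auto)
  also have "(\<integral>x. ?i (\<lambda>x. (m x)\<^sup>2 + H x) x \<partial>M) = (\<integral>x. of_real (v + H x) * G x \<partial>M)"
  proof (rule duality_complex[OF _ _ m2 G])
    show "bdd_meas M (\<lambda>x. (m x)\<^sup>2 + H x)" "bdd_meas M (\<lambda>x. v + H x)" by (intro bdd_meas_intros m H)+
  qed (simp_all add: nG)
  also have "(\<integral>x. of_real 1 * G x \<partial>M) + \<i> * of_real \<theta> * (\<integral>x. of_real 0 * G x \<partial>M)
      - of_real (\<theta>\<^sup>2 / 2) * (\<integral>x. of_real (v + H x) * G x \<partial>M)
    = (\<integral>x. of_real 1 * G x \<partial>M) - (\<integral>x. of_real (\<theta>\<^sup>2 / 2) * (of_real (v + H x) * G x) \<partial>M)"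
    by simp
  also have "\<dots> = (\<integral>x. of_real 1 * G x - of_real (\<theta>\<^sup>2 / 2) * (of_real (v + H x) * G x) \<partial>M)"
    by (rule Bochner_Integration.integral_diff[OF j1 j2, symmetric])
  \<comment> \<open>The factor 1 - \<theta>^2 (v + H) / 2 agrees with the product of 1 - \<theta>^2
    v / 2 and the weight up to \<theta>^4 v H / 4; hence the weighted integral reproduces itself
    with the wanted factor.\<close>
  also have "\<dots> = (\<integral>x. of_real (1 - \<theta>\<^sup>2 * v / 2) * (of_real (1 - \<theta>\<^sup>2 / 2 * H x) * G x)
      - of_real (\<theta> ^ 4 * v / 4) * (of_real (H x) * G x) \<partial>M)"
    by (intro Bochner_Integration.integral_cong refl) (simp add: field_simps power4_eq_xxxx power2_eq_square)
  also have "\<dots> = (\<integral>x. of_real (1 - \<theta>\<^sup>2 * v / 2) * (of_real (1 - \<theta>\<^sup>2 / 2 * H x) * G x) \<partial>M)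
      - (\<integral>x. of_real (\<theta> ^ 4 * v / 4) * (of_real (H x) * G x) \<partial>M)"
    by (rule Bochner_Integration.integral_diff[OF j3 j4])
  also have "\<dots> = of_real (1 - \<theta>\<^sup>2 * v / 2) * V j - of_real (\<theta> ^ 4 * v / 4) * (\<integral>x. of_real (H x) * G x \<partial>M)"
    unfolding V_def G_def by simp
  finally have Q: "(\<integral>x. ?Q x \<partial>M) = of_real (1 - \<theta>\<^sup>2 * v / 2) * V j - of_real (\<theta> ^ 4 * v / 4) * (\<integral>x. of_real (H x) * G x \<partial>M)" .
  have 1: "cmod (V (Suc j) - (\<integral>x. ?Q x \<partial>M)) \<le> \<bar>\<theta>\<bar> ^ 3 * A ^ 3"
    unfolding VS Bochner_Integration.integral_diff[OF iVS iQ, symmetric]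
  proof (rule norm_integral_le_AE[OF Bochner_Integration.integrable_diff[OF iVS iQ]])
    show "AE x in M. norm (of_real (1 - \<theta>\<^sup>2 / 2 * H x) * (iexp (\<theta> * m x) * G (T x)) - ?Q x) \<le> \<bar>\<theta>\<bar> ^ 3 * A ^ 3"
      using m(2) H(2)
    proof eventually_elim
      fix x assume mA: "\<bar>m x\<bar> \<le> A" and HA: "\<bar>H x\<bar> \<le> A\<^sup>2"
      let ?y = "\<theta> * m x"
      have y: "\<bar>?y\<bar> \<le> \<bar>\<theta>\<bar> * A" unfolding abs_mult using mA by (intro mult_left_mono) auto
      have R3: "cmod (iexp ?y - (1 + \<i> * of_real ?y - of_real (?y\<^sup>2) / 2)) \<le> \<bar>?y\<bar> ^ 3 / 6"
        using iexp_approx1[of ?y 2] by (simp add: eval_nat_numeral power2_eq_square algebra_simps)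
      have R1: "cmod (iexp ?y - 1) \<le> \<bar>?y\<bar>"
        using iexp_approx1[of ?y 0] by simp
      \<comment> \<open>The second-order part of the weight cancels against \<open>?Q\<close>, so H
        survives only multiplied by the first-order remainder of the exponential. Both contributions
        are cubic, with coefficients 1/6 and 1/2.\<close>
      have "of_real (1 - \<theta>\<^sup>2 / 2 * H x) * (iexp ?y * G (T x)) - ?Q x
        = ((iexp ?y - (1 + \<i> * of_real ?y - of_real (?y\<^sup>2) / 2)) - of_real (\<theta>\<^sup>2 / 2 * H x) * (iexp ?y - 1)) * G (T x)"
        by (simp add: field_simps power2_eq_square)
      also have "cmod \<dots> = cmod ((iexp ?y - (1 + \<i> * of_real ?y - of_real (?y\<^sup>2) / 2)) - of_real (\<theta>\<^sup>2 / 2 * H x) * (iexp ?y - 1))"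
        by (simp only: norm_mult[of _ "G (T x)"] nG mult_1_right)
      also have "\<dots> \<le> cmod (iexp ?y - (1 + \<i> * of_real ?y - of_real (?y\<^sup>2) / 2)) + \<bar>\<theta>\<^sup>2 / 2 * H x\<bar> * cmod (iexp ?y - 1)"
        by (rule order_trans[OF norm_triangle_ineq4])
          (simp only: norm_mult[of "of_real (\<theta>\<^sup>2 / 2 * H x)"] norm_of_real order_refl)
      also have "\<dots> \<le> (\<bar>\<theta>\<bar> * A) ^ 3 / 6 + (\<theta>\<^sup>2 / 2 * A\<^sup>2) * (\<bar>\<theta>\<bar> * A)"
      proof (intro add_mono mult_mono)
        show "cmod (iexp ?y - (1 + \<i> * of_real ?y - of_real (?y\<^sup>2) / 2)) \<le> (\<bar>\<theta>\<bar> * A) ^ 3 / 6"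
          using R3 power_mono[OF y, of 3] by simp
        show "\<bar>\<theta>\<^sup>2 / 2 * H x\<bar> \<le> \<theta>\<^sup>2 / 2 * A\<^sup>2"
          unfolding abs_mult using HA by (intro mult_mono) auto
        show "cmod (iexp ?y - 1) \<le> \<bar>\<theta>\<bar> * A" using R1 y by linarith
      qed auto
      also have "(\<theta>\<^sup>2 / 2 * A\<^sup>2) * (\<bar>\<theta>\<bar> * A) = (\<bar>\<theta>\<bar> * A) ^ 3 / 2"
        by (simp add: power3_eq_cube power2_eq_square abs_mult_self_eq mult_ac flip: power2_abs)
      also have "(\<bar>\<theta>\<bar> * A) ^ 3 / 6 + (\<bar>\<theta>\<bar> * A) ^ 3 / 2 \<le> (\<bar>\<theta>\<bar> * A) ^ 3"
        using A by (simp add: field_simps)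
      also have "\<dots> = \<bar>\<theta>\<bar> ^ 3 * A ^ 3" by (rule power_mult_distrib)
      finally show "norm (of_real (1 - \<theta>\<^sup>2 / 2 * H x) * (iexp (\<theta> * m x) * G (T x)) - ?Q x) \<le> \<bar>\<theta>\<bar> ^ 3 * A ^ 3" .
    qed
  qed
  have "cmod (\<integral>x. of_real (H x) * G x \<partial>M) \<le> A\<^sup>2"
    using H(2) by (intro norm_integral_le_AE intG H) (auto elim!: eventually_mono simp: norm_mult nG)
  then have 2: "cmod (of_real (\<theta> ^ 4 * v / 4) * (\<integral>x. of_real (H x) * G x \<partial>M)) \<le> \<theta> ^ 4 * v / 4 * A\<^sup>2"
    unfolding norm_mult norm_of_real using v by (intro mult_mono) (auto simp: prob_space)
  have "V (Suc j) - of_real (1 - \<theta>\<^sup>2 * v / 2) * V j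
      = (V (Suc j) - (\<integral>x. ?Q x \<partial>M)) - of_real (\<theta> ^ 4 * v / 4) * (\<integral>x. of_real (H x) * G x \<partial>M)"
    unfolding Q by (simp only: diff_diff_eq2 diff_diff_add algebra_simps)
  also have "cmod \<dots> \<le> \<bar>\<theta>\<bar> ^ 3 * A ^ 3 + \<theta> ^ 4 * v / 4 * A\<^sup>2"
    using norm_triangle_ineq4 1 2 by (meson add_mono order_trans)
  finally show ?thesis by (simp add: mult_ac)
qed

text \<open>The factor of the recursion lies in [0, 1] by \<open>small\<close>, so the errors of the
  k steps just add up. Replacing the weight by 1 costs \<theta>^2 A^2 / 2 at time k and once more at
  time 0.\<close>

lemma char_birkhoff_martingale:
  assumes small: "\<theta>\<^sup>2 * v \<le> 2"
  shows "cmod ((\<integral>x. iexp (\<theta> * birkhoff m k x) \<partial>M) - of_real (1 - \<theta>\<^sup>2 * v / 2) ^ k)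
    \<le> real k * (\<bar>\<theta>\<bar> ^ 3 * A ^ 3 + \<theta> ^ 4 * v * A\<^sup>2 / 4) + \<theta>\<^sup>2 * A\<^sup>2"
proof -
  note [measurable] = bdd_measD[OF m(1)] bdd_measD[OF H(1)] bdd_measD[OF bdd_meas_birkhoff[OF m(1)]]
  define V where "V j = (\<integral>x. of_real (1 - \<theta>\<^sup>2 / 2 * H x) * iexp (\<theta> * birkhoff m j x) \<partial>M)" for j
  define \<rho> where "\<rho> = 1 - \<theta>\<^sup>2 * v / 2"
  define \<delta> where "\<delta> = \<bar>\<theta>\<bar> ^ 3 * A ^ 3 + \<theta> ^ 4 * v * A\<^sup>2 / 4"
  have \<rho>: "0 \<le> \<rho>" "\<rho> \<le> 1" unfolding \<rho>_def using small v by auto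
  have rec: "cmod (V (Suc j) - of_real \<rho> * V j) \<le> \<delta>" for j
    unfolding V_def \<rho>_def \<delta>_def by (rule char_recursion)
  have iter: "cmod (V j - of_real \<rho> ^ j * V 0) \<le> real j * \<delta>" for j
  proof (induction j)
    case (Suc j)
    have "V (Suc j) - of_real \<rho> ^ Suc j * V 0 = (V (Suc j) - of_real \<rho> * V j) + of_real \<rho> * (V j - of_real \<rho> ^ j * V 0)"
      by (simp add: algebra_simps)
    also have "cmod \<dots> \<le> \<delta> + 1 * (real j * \<delta>)"
    proof (rule order_trans[OF norm_triangle_ineq], rule add_mono[OF rec])
      show "cmod (of_real \<rho> * (V j - of_real \<rho> ^ j * V 0)) \<le> 1 * (real j * \<delta>)"
        unfolding norm_mult using \<rho> Suc.IH by (intro mult_mono) auto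
    qed
    finally show ?case by (simp add: algebra_simps)
  qed simp
  have near: "cmod ((\<integral>x. iexp (\<theta> * birkhoff m j x) \<partial>M) - V j) \<le> \<theta>\<^sup>2 / 2 * A\<^sup>2" for j
  proof -
    have i: "integrable M (\<lambda>x. iexp (\<theta> * birkhoff m j x))"
      by (rule integrable_complex_bdd[where B = 1]) auto
    have bW: "bdd_meas M (\<lambda>x. 1 - \<theta>\<^sup>2 / 2 * H x)" by (intro bdd_meas_intros H)
    have i': "integrable M (\<lambda>x. of_real (1 - \<theta>\<^sup>2 / 2 * H x) * iexp (\<theta> * birkhoff m j x))"
      by (rule integrable_bdd_mult_complex[OF bW]) auto
    show ?thesis
      unfolding V_def Bochner_Integration.integral_diff[OF i i', symmetric]
    proof (rule norm_integral_le_AE[OF Bochner_Integration.integrable_diff[OF i i']])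
      show "AE x in M. norm (iexp (\<theta> * birkhoff m j x) - of_real (1 - \<theta>\<^sup>2 / 2 * H x) * iexp (\<theta> * birkhoff m j x)) \<le> \<theta>\<^sup>2 / 2 * A\<^sup>2"
        using H(2)
      proof eventually_elim
        fix x assume HA: "\<bar>H x\<bar> \<le> A\<^sup>2"
        have "iexp (\<theta> * birkhoff m j x) - of_real (1 - \<theta>\<^sup>2 / 2 * H x) * iexp (\<theta> * birkhoff m j x)
            = of_real (\<theta>\<^sup>2 / 2 * H x) * iexp (\<theta> * birkhoff m j x)" by (simp add: algebra_simps)
        also have "cmod \<dots> = \<bar>\<theta>\<^sup>2 / 2 * H x\<bar>" unfolding norm_mult norm_of_real by simp
        also have "\<dots> \<le> \<theta>\<^sup>2 / 2 * A\<^sup>2" unfolding abs_mult using HA by (intro mult_mono) auto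
        finally show "norm (iexp (\<theta> * birkhoff m j x) - of_real (1 - \<theta>\<^sup>2 / 2 * H x) * iexp (\<theta> * birkhoff m j x)) \<le> \<theta>\<^sup>2 / 2 * A\<^sup>2" .
      qed
    qed
  qed
  have n0: "cmod (1 - V 0) \<le> \<theta>\<^sup>2 / 2 * A\<^sup>2" using near[of 0] by (simp add: prob_space)
  let ?E = "\<integral>x. iexp (\<theta> * birkhoff m k x) \<partial>M"
  have "?E - of_real \<rho> ^ k = (?E - V k) + ((V k - of_real \<rho> ^ k * V 0) - of_real \<rho> ^ k * (1 - V 0))"
    by (simp add: algebra_simps)
  also have "cmod \<dots> \<le> \<theta>\<^sup>2 / 2 * A\<^sup>2 + (real k * \<delta> + 1 * (\<theta>\<^sup>2 / 2 * A\<^sup>2))"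
  proof (rule order_trans[OF norm_triangle_ineq], rule add_mono[OF near],
      rule order_trans[OF norm_triangle_ineq4], rule add_mono[OF iter])
    show "cmod (of_real \<rho> ^ k * (1 - V 0)) \<le> 1 * (\<theta>\<^sup>2 / 2 * A\<^sup>2)"
      unfolding norm_mult norm_power norm_of_real using \<rho> n0 by (intro mult_mono power_le_one) auto
  qed
  finally show ?thesis unfolding \<rho>_def \<delta>_def by (simp add: algebra_simps)
qed

text \<open>All errors are compared with u^3 / w, where u = A / sqrt v and w = sqrt k. Since v \<le>
  A^2 gives u \<ge> 1, and also w \<ge> 1, the lower powers of u and the higher powers of 1 / w are
  dominated.\<close>

lemma char_birkhoff_normalized:
  assumes v_pos: "0 < v" and k: "1 \<le> k" "t\<^sup>2 \<le> 2 * real k"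
  shows "cmod ((\<integral>x. iexp (t / (sqrt v * sqrt k) * birkhoff f k x) \<partial>M) - of_real ((1 - t\<^sup>2 / (2 * real k)) ^ k))
    \<le> char_error t * (A ^ 3 / (sqrt v ^ 3 * sqrt k))"
proof -
  define s where "s = sqrt v"
  define w where "w = sqrt (real k)"
  define u where "u = A / s"
  define \<theta> where "\<theta> = t / (s * w)"
  have w: "1 \<le> w" "w\<^sup>2 = real k" unfolding w_def using k by auto
  have s: "0 < s" "s\<^sup>2 = v" "s \<le> A"
    unfolding s_def using v_pos A v_le by (auto intro: real_le_lsqrt)
  have u: "1 \<le> u" unfolding u_def using s by auto
  have A_eq: "A = u * s" unfolding u_def using s by simp
  have \<theta>s: "\<theta> * s = t / w" unfolding \<theta>_def using s by simp
  have \<theta>A: "\<theta> * A = t * u / w" unfolding A_eq using \<theta>s by (metis mult.assoc mult.commute times_divide_eq_left)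
  have \<theta>v: "\<theta>\<^sup>2 * s\<^sup>2 = t\<^sup>2 / real k"
    unfolding power_mult_distrib[symmetric] \<theta>s by (simp add: power_divide w)
  have lam: "1 - \<theta>\<^sup>2 * s\<^sup>2 / 2 = 1 - t\<^sup>2 / (2 * real k)" unfolding \<theta>v by simp
  note [measurable] = bdd_measD[OF m(1)] f(1)
  let ?Em = "\<integral>x. iexp (\<theta> * birkhoff m k x) \<partial>M" and ?Ef = "\<integral>x. iexp (\<theta> * birkhoff f k x) \<partial>M"
  have 1: "cmod (?Em - of_real (1 - \<theta>\<^sup>2 * s\<^sup>2 / 2) ^ k)
      \<le> real k * (\<bar>\<theta>\<bar> ^ 3 * A ^ 3 + \<theta> ^ 4 * s\<^sup>2 * A\<^sup>2 / 4) + \<theta>\<^sup>2 * A\<^sup>2"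
    unfolding s(2)
  proof (rule char_birkhoff_martingale)
    show "\<theta>\<^sup>2 * v \<le> 2" unfolding s(2)[symmetric] \<theta>v using k by (simp add: field_simps)
  qed
  \<comment> \<open>The two Birkhoff sums differ by h (T^k x) - h x, which is at most 2 A almost
    surely, and y |-> exp (i y) is 1-Lipschitz.\<close>
  have 2: "cmod (?Ef - ?Em) \<le> 2 * \<bar>\<theta> * A\<bar>"
  proof -
    have [measurable]: "birkhoff f k \<in> borel_measurable M" "birkhoff m k \<in> borel_measurable M"
      unfolding birkhoff_def by measurable
    have i: "integrable M (\<lambda>x. iexp (\<theta> * birkhoff f k x))" "integrable M (\<lambda>x. iexp (\<theta> * birkhoff m k x))"
      by (rule integrable_complex_bdd[where B = 1]; simp)+
    show ?thesis
      unfolding Bochner_Integration.integral_diff[OF i, symmetric]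
    proof (rule norm_integral_le_AE[OF Bochner_Integration.integrable_diff[OF i]])
      show "AE x in M. norm (iexp (\<theta> * birkhoff f k x) - iexp (\<theta> * birkhoff m k x)) \<le> 2 * \<bar>\<theta> * A\<bar>"
        using birkhoff_cohomologous[OF f(2)] h(2) AE_Tn[OF h(2), of k]
      proof eventually_elim
        fix x assume eq: "\<forall>n. birkhoff f n x = birkhoff m n x - h x + h ((T ^^ n) x)"
          and hA: "\<bar>h x\<bar> \<le> A" "\<bar>h ((T ^^ k) x)\<bar> \<le> A"
        let ?y = "h ((T ^^ k) x) - h x"
        have "birkhoff f k x = birkhoff m k x + ?y" using eq by simp
        then have "iexp (\<theta> * birkhoff f k x) - iexp (\<theta> * birkhoff m k x) = iexp (\<theta> * birkhoff m k x) * (iexp (\<theta> * ?y) - 1)"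
          by (simp only:) (simp add: algebra_simps exp_add[symmetric])
        also have "cmod \<dots> = cmod (iexp (\<theta> * ?y) - 1)" unfolding norm_mult by simp
        also have "\<dots> \<le> \<bar>\<theta> * ?y\<bar>" using iexp_approx1[of "\<theta> * ?y" 0] by simp
        also have "\<dots> \<le> \<bar>\<theta>\<bar> * (2 * A)" unfolding abs_mult using hA by (intro mult_left_mono) auto
        finally show "norm (iexp (\<theta> * birkhoff f k x) - iexp (\<theta> * birkhoff m k x)) \<le> 2 * \<bar>\<theta> * A\<bar>"
          using A by (simp add: abs_mult)
      qed
    qed
  qed
  have e1: "real k * (\<bar>\<theta>\<bar> ^ 3 * A ^ 3) = \<bar>t\<bar> ^ 3 * (u ^ 3 / w)"
  proof -
    have "\<bar>\<theta>\<bar> ^ 3 * A ^ 3 = \<bar>\<theta> * A\<bar> ^ 3" using A by (simp add: abs_mult power_mult_distrib)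
    also have "\<dots> = \<bar>t\<bar> ^ 3 * u ^ 3 / w ^ 3" unfolding \<theta>A using u w by (simp add: abs_mult power_mult_distrib power_divide)
    finally show ?thesis unfolding w(2)[symmetric] using w(1) by (simp add: field_simps eval_nat_numeral)
  qed
  have uw: "u\<^sup>2 / w\<^sup>2 \<le> u ^ 3 / w" "u / w \<le> u ^ 3 / w"
  proof -
    have "u\<^sup>2 \<le> u ^ 3" "u ^ 1 \<le> u ^ 3" using u by (intro power_increasing; simp)+
    then show "u / w \<le> u ^ 3 / w" using w by (simp add: divide_right_mono)
    have "w ^ 1 \<le> w\<^sup>2" using w by (intro power_increasing) auto
    then show "u\<^sup>2 / w\<^sup>2 \<le> u ^ 3 / w" using \<open>u\<^sup>2 \<le> u ^ 3\<close> w u by (intro frac_le) auto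
  qed
  have e2: "real k * (\<theta> ^ 4 * s\<^sup>2 * A\<^sup>2 / 4) \<le> t ^ 4 * (u ^ 3 / w)"
  proof -
    have "\<theta> ^ 4 * s\<^sup>2 * A\<^sup>2 = (\<theta> * s)\<^sup>2 * (\<theta> * A)\<^sup>2" by (simp add: power_mult_distrib eval_nat_numeral)
    also have "\<dots> = t ^ 4 * u\<^sup>2 / w ^ 4" unfolding \<theta>s \<theta>A by (simp add: power_mult_distrib power_divide eval_nat_numeral mult_ac)
    finally have "real k * (\<theta> ^ 4 * s\<^sup>2 * A\<^sup>2 / 4) = t ^ 4 * (u\<^sup>2 / w\<^sup>2) / 4"
      unfolding w(2)[symmetric] using w(1) by (simp add: field_simps eval_nat_numeral)
    also have "\<dots> \<le> t ^ 4 * (u\<^sup>2 / w\<^sup>2)"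
    proof -
      have quarter: "y / 4 \<le> y" if "0 \<le> y" for y :: real using that by simp
      show ?thesis by (rule quarter) simp
    qed
    also have "\<dots> \<le> t ^ 4 * (u ^ 3 / w)" using uw by (intro mult_left_mono) auto
    finally show ?thesis .
  qed
  have e3: "\<theta>\<^sup>2 * A\<^sup>2 \<le> t\<^sup>2 * (u ^ 3 / w)"
  proof -
    have "\<theta>\<^sup>2 * A\<^sup>2 = t\<^sup>2 * (u\<^sup>2 / w\<^sup>2)"
      unfolding power_mult_distrib[symmetric] \<theta>A by (simp add: power_mult_distrib power_divide)
    also have "\<dots> \<le> t\<^sup>2 * (u ^ 3 / w)" using uw by (intro mult_left_mono) auto
    finally show ?thesis .
  qed
  have e4: "2 * \<bar>\<theta> * A\<bar> \<le> 2 * \<bar>t\<bar> * (u ^ 3 / w)"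
  proof -
    have "2 * \<bar>\<theta> * A\<bar> = 2 * \<bar>t\<bar> * (u / w)" unfolding \<theta>A using u w by (simp add: abs_mult)
    also have "\<dots> \<le> 2 * \<bar>t\<bar> * (u ^ 3 / w)" using uw by (intro mult_left_mono) auto
    finally show ?thesis .
  qed
  have "cmod (?Ef - of_real (1 - \<theta>\<^sup>2 * s\<^sup>2 / 2) ^ k) \<le> cmod (?Ef - ?Em) + cmod (?Em - of_real (1 - \<theta>\<^sup>2 * s\<^sup>2 / 2) ^ k)"
    using norm_triangle_ineq[of "?Ef - ?Em" "?Em - of_real (1 - \<theta>\<^sup>2 * s\<^sup>2 / 2) ^ k"]
    by (simp only: diff_add_cancel add_diff_eq)
  also have "\<dots> \<le> char_error t * (u ^ 3 / w)"
    using 1[unfolded distrib_left] 2 e1 e2 e3 e4 unfolding char_error_def distrib_right by linarith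
  finally have "cmod (?Ef - of_real (1 - t\<^sup>2 / (2 * real k)) ^ k) \<le> char_error t * (u ^ 3 / w)"
    unfolding lam .
  moreover have "u ^ 3 / w = A ^ 3 / (s ^ 3 * sqrt k)" unfolding u_def w_def by (simp add: power_divide)
  ultimately show ?thesis unfolding \<theta>_def w_def s_def by (simp only: of_real_power)
qed

text \<open>Orthogonality of m to every function of T x makes the second moment of its Birkhoff sum
  exactly n v. Passing to f adds a bounded boundary term, whose influence is of order sqrt n before
  division by n.\<close>

lemma asymptotic_variance_martingale: "asymptotic_variance M T f = v"
proof -
  have bS: "bdd_meas M (birkhoff m n)" for n by (rule bdd_meas_birkhoff[OF m(1)])
  note it = integrable_bdd_meas and bi = bdd_meas_intros m(1) bS bdd_meas_T bdd_meas_Tn h(1)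
  have var: "(\<integral>x. (birkhoff m n x)\<^sup>2 \<partial>M) = real n * v" for n
  proof (induction n)
    case (Suc n)
    have "(\<integral>x. (birkhoff m (Suc n) x)\<^sup>2 \<partial>M)
        = (\<integral>x. (m x)\<^sup>2 + (2 * (m x * birkhoff m n (T x)) + (birkhoff m n (T x))\<^sup>2) \<partial>M)"
      unfolding birkhoff_Suc by (simp add: power2_sum algebra_simps)
    also have "\<dots> = (\<integral>x. (m x)\<^sup>2 \<partial>M) + (2 * (\<integral>x. m x * birkhoff m n (T x) \<partial>M) + (\<integral>x. (birkhoff m n (T x))\<^sup>2 \<partial>M))"
      by (subst Bochner_Integration.integral_add; (intro it bi)?) 
        (subst Bochner_Integration.integral_add; (intro it bi)?; simp)
    also have "\<dots> = v + real n * v"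
      unfolding v_def[symmetric] using m0[OF bS] integral_T[OF bdd_measD[OF bdd_meas_power2[OF bS]]] Suc.IH by simp
    finally show ?case by (simp add: algebra_simps)
  qed simp
  obtain K where K: "\<And>x. \<bar>h x\<bar> \<le> K" using h(1) unfolding bdd_meas_def by auto
  have K0: "0 \<le> K" using K[of undefined] by simp
  let ?c = "2 * K * (1 + v) + 4 * K\<^sup>2"
  let ?a = "\<lambda>n. 1 / real n * (\<integral>x. (\<Sum>j<n. f ((T ^^ j) x))\<^sup>2 \<partial>M)"
  have bound: "\<bar>?a n - v\<bar> \<le> ?c / sqrt (real n)" if n: "1 \<le> n" for n
  proof -
    define b where "b x = h ((T ^^ n) x) - h x" for x
    define S where "S = birkhoff m n"
    define w where "w = sqrt (real n)"
    have w: "1 \<le> w" "w * w = real n" unfolding w_def using n by auto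
    have bb: "bdd_meas M b" unfolding b_def by (intro bi)
    have bS': "bdd_meas M S" unfolding S_def by (rule bS)
    note [measurable] = bdd_measD[OF bb] bdd_measD[OF bS']
    have bK: "\<bar>b x\<bar> \<le> 2 * K" for x unfolding b_def using K[of "(T ^^ n) x"] K[of x] by linarith
    let ?R = "\<lambda>x. 2 * (S x * b x) + (b x)\<^sup>2"
    have R: "\<bar>?R x\<bar> \<le> 2 * K * (w + (S x)\<^sup>2 / w) + 4 * K\<^sup>2" for x
    proof -
      \<comment> \<open>The arithmetic-geometric mean inequality with w = sqrt n balances the cross
        term: w and the integral of S^2 / w are both of order sqrt n.\<close>
      have "0 \<le> (\<bar>S x\<bar> - w)\<^sup>2" by simp
      then have "2 * \<bar>S x\<bar> * w \<le> (w + (S x)\<^sup>2 / w) * w"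
        using w by (simp add: power2_eq_square algebra_simps)
      then have *: "2 * \<bar>S x\<bar> \<le> w + (S x)\<^sup>2 / w" by (rule mult_right_le_imp_le) (use w(1) in linarith)
      have "\<bar>?R x\<bar> \<le> \<bar>2 * (S x * b x)\<bar> + \<bar>(b x)\<^sup>2\<bar>" by (rule abs_triangle_ineq)
      also have "\<dots> = 2 * \<bar>S x\<bar> * \<bar>b x\<bar> + \<bar>b x\<bar>\<^sup>2" by (simp add: abs_mult)
      also have "\<dots> \<le> (w + (S x)\<^sup>2 / w) * (2 * K) + (2 * K)\<^sup>2"
        using * bK[of x] w by (intro add_mono mult_mono power_mono) auto
      finally show ?thesis by (simp add: power_mult_distrib mult_ac)
    qed
    have bR: "bdd_meas M ?R" by (intro bi bb bS')
    have "(\<integral>x. (\<Sum>j<n. f ((T ^^ j) x))\<^sup>2 \<partial>M) = (\<integral>x. (S x)\<^sup>2 + ?R x \<partial>M)"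
    proof (rule integral_cong_AE)
      show "(\<lambda>x. (\<Sum>j<n. f ((T ^^ j) x))\<^sup>2) \<in> borel_measurable M" using f(1) by measurable
      show "(\<lambda>x. (S x)\<^sup>2 + ?R x) \<in> borel_measurable M" by measurable
      show "AE x in M. (\<Sum>j<n. f ((T ^^ j) x))\<^sup>2 = (S x)\<^sup>2 + ?R x"
        using birkhoff_cohomologous[OF f(2)]
      proof eventually_elim
        fix x assume "\<forall>n. birkhoff f n x = birkhoff m n x - h x + h ((T ^^ n) x)"
        then have "(\<Sum>j<n. f ((T ^^ j) x)) = S x + b x" unfolding S_def b_def birkhoff_def by simp
        then show "(\<Sum>j<n. f ((T ^^ j) x))\<^sup>2 = (S x)\<^sup>2 + ?R x" by (simp add: power2_sum)
      qed
    qed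
    also have "\<dots> = (\<integral>x. (S x)\<^sup>2 \<partial>M) + (\<integral>x. ?R x \<partial>M)"
      by (rule Bochner_Integration.integral_add; intro it bi bb bS')
    finally have eq: "?a n - v = (\<integral>x. ?R x \<partial>M) / real n"
      using n var[of n] unfolding S_def by (simp add: field_simps)
    have "\<bar>\<integral>x. ?R x \<partial>M\<bar> \<le> (\<integral>x. 2 * K * (w + (S x)\<^sup>2 / w) + 4 * K\<^sup>2 \<partial>M)"
    proof (rule order_trans[OF integral_abs_bound], rule integral_mono)
      show "integrable M (\<lambda>x. \<bar>?R x\<bar>)" by (intro integrable_abs it bR)
      show "integrable M (\<lambda>x. 2 * K * (w + (S x)\<^sup>2 / w) + 4 * K\<^sup>2)"
        using it[OF bdd_meas_power2[OF bS']] by simp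
    qed (rule R)
    also have "\<dots> = 2 * K * (w + (\<integral>x. (S x)\<^sup>2 \<partial>M) / w) + 4 * K\<^sup>2"
      using it[OF bdd_meas_power2[OF bS']] by (simp add: prob_space)
    also have "(\<integral>x. (S x)\<^sup>2 \<partial>M) / w = w * v"
      unfolding S_def var w(2)[symmetric] using w(1) by simp
    also have "2 * K * (w + w * v) + 4 * K\<^sup>2 \<le> ?c * w"
      using mult_left_mono[OF w(1), of "4 * K\<^sup>2"] by (simp add: algebra_simps)
    finally have "\<bar>?a n - v\<bar> \<le> ?c * w / real n"
      unfolding eq using n by (simp add: divide_right_mono)
    also have "\<dots> = ?c / w" unfolding w(2)[symmetric] using w(1) by simp
    finally show ?thesis unfolding w_def .
  qed
  have "filterlim (\<lambda>n. sqrt (real n)) at_top sequentially"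
    by (rule filterlim_compose[OF sqrt_at_top filterlim_real_sequentially])
  then have "(\<lambda>n. ?c / sqrt (real n)) \<longlonglongrightarrow> 0"
    by (intro tendsto_divide_0[OF tendsto_const] filterlim_at_top_imp_at_infinity)
  moreover have "\<forall>\<^sub>F n in sequentially. norm (?a n - v) \<le> ?c / sqrt (real n)"
    using eventually_ge_at_top[of 1] by eventually_elim (use bound in simp)
  ultimately have "(\<lambda>n. ?a n - v) \<longlonglongrightarrow> 0" by (rule Lim_null_comparison[rotated])
  then have "?a \<longlonglongrightarrow> v" by (simp add: LIM_zero_iff)
  then show ?thesis unfolding asymptotic_variance_def by (rule limI)
qed

end

section \<open>The Markov structure modulo null sets\<close>

lemma sigma_mod_subset_sets: "G \<subseteq> sets M \<Longrightarrow> sigma_mod M G \<subseteq> sets M"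
  unfolding sigma_mod_def by (auto intro!: sets.sigma_sets_subset)

text \<open>The sets that meet a in a null set or contain it up to a null set are closed under
  complements and countable unions. In a union, one member containing a decides; otherwise countably
  many null sets are united.\<close>

lemma sigma_mod_atom:
  assumes G: "G \<subseteq> sets M" and a: "a \<in> sets M"
    and atom: "\<And>g. g \<in> G \<Longrightarrow> a \<inter> g \<in> null_sets M \<or> a - g \<in> null_sets M"
    and E: "E \<in> sigma_mod M G"
  shows "a \<inter> E \<in> null_sets M \<or> a - E \<in> null_sets M"
  using E unfolding sigma_mod_def
proof (induction rule: sigma_sets.induct)
  case (Basic E)
  then show ?case using atom a by (auto intro: null_set_Int1)
next
  case Empty
  then show ?case by simp
next
  case (Compl E)
  have "a \<inter> (space M - E) = a - E" "a - (space M - E) = a \<inter> E"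
    using sets.sets_into_space[OF a] by auto
  then show ?case using Compl.IH by auto
next
  case (Union A)
  have A: "A i \<in> sets M" for i
    using Union.hyps sigma_mod_subset_sets[OF G] unfolding sigma_mod_def by auto
  show ?case
  proof (cases "\<exists>i. a - A i \<in> null_sets M")
    case True
    then obtain i where "a - A i \<in> null_sets M" by auto
    moreover have "a - (\<Union>i. A i) \<in> sets M" using A a by auto
    ultimately have "a - (\<Union>i. A i) \<in> null_sets M" by (rule null_sets_subset) auto
    then show ?thesis by simp
  next
    case False
    then have "a \<inter> A i \<in> null_sets M" for i using Union.IH by auto
    then have "(\<Union>i. a \<inter> A i) \<in> null_sets M" by (rule null_sets_UN)
    moreover have "(\<Union>i. a \<inter> A i) = a \<inter> (\<Union>i. A i)" by auto
    ultimately show ?thesis by simp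
  qed
qed

lemma partition_mod_atom:
  assumes "partition_mod M P" "a \<in> P" "E \<in> sigma_mod M P"
  shows "a \<inter> E \<in> null_sets M \<or> a - E \<in> null_sets M"
proof (rule sigma_mod_atom)
  show "a \<inter> g \<in> null_sets M \<or> a - g \<in> null_sets M" if "g \<in> P" for g
    using assms that unfolding partition_mod_def by (cases "a = g") auto
qed (use assms in \<open>auto simp: partition_mod_def\<close>)

section \<open>Cylinders\<close>

lemma cylinders_Suc:
  assumes T: "T \<in> M \<rightarrow>\<^sub>M M" and \<alpha>: "\<alpha> \<subseteq> sets M" and c: "c \<in> cylinders M T \<alpha> (Suc n)"
  shows "\<exists>a\<in>\<alpha>. \<exists>c'\<in>cylinders M T \<alpha> n. c = a \<inter> T -` c'"
proof -
  obtain w where w: "\<And>i. i < Suc n \<Longrightarrow> w i \<in> \<alpha>"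
    and cw: "c = space M \<inter> (\<Inter>i<Suc n. (T ^^ i) -` w i)"
    using c unfolding cylinders_def by auto
  let ?c' = "space M \<inter> (\<Inter>i<n. (T ^^ i) -` w (Suc i))"
  have w0: "w 0 \<subseteq> space M" using w[of 0] \<alpha> sets.sets_into_space by auto
  have "x \<in> c \<longleftrightarrow> x \<in> w 0 \<inter> T -` ?c'" for x
  proof -
    have "(\<forall>i<Suc n. (T ^^ i) x \<in> w i) \<longleftrightarrow> x \<in> w 0 \<and> (\<forall>i<n. (T ^^ Suc i) x \<in> w (Suc i))"
      by (subst All_less_Suc2) simp
    then show ?thesis
      unfolding cw using w0 measurable_space[OF T] by (auto simp: funpow_swap1)
  qed
  moreover have "?c' \<in> cylinders M T \<alpha> n" unfolding cylinders_def using w by auto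
  ultimately show ?thesis using w by blast
qed

lemma cylinders_subset_element:
  assumes "c \<in> cylinders M T \<alpha> n" "n \<ge> 1"
  shows "\<exists>a\<in>\<alpha>. c \<subseteq> a"
proof -
  obtain w where w: "\<And>i. i < n \<Longrightarrow> w i \<in> \<alpha>"
    and cw: "c = space M \<inter> (\<Inter>i<n. (T ^^ i) -` w i)"
    using assms(1) unfolding cylinders_def by auto
  have "(T ^^ 0) -` w 0 = w 0" by simp
  then have "c \<subseteq> w 0" unfolding cw using assms(2) by fastforce
  then show ?thesis using w[of 0] assms(2) by auto
qed

lemma cylinders_sets:
  assumes T: "T \<in> M \<rightarrow>\<^sub>M M" and \<alpha>: "\<alpha> \<subseteq> sets M"
  shows "cylinders M T \<alpha> n \<subseteq> sets M"
proof (induction n)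
  case 0
  show ?case by (auto simp: cylinders_def)
next
  case (Suc n)
  show ?case
  proof
    fix c assume "c \<in> cylinders M T \<alpha> (Suc n)"
    then obtain a c' where *: "a \<in> \<alpha>" "c' \<in> cylinders M T \<alpha> n" "c = a \<inter> T -` c'"
      using cylinders_Suc[OF T \<alpha>] by blast
    then have "c = a \<inter> (T -` c' \<inter> space M)" using \<alpha> sets.sets_into_space by auto
    moreover have "T -` c' \<inter> space M \<in> sets M" using * Suc.IH measurable_sets[OF T] by auto
    ultimately show "c \<in> sets M" using * \<alpha> by auto
  qed
qed

lemma countable_cylinders:
  assumes T: "T \<in> M \<rightarrow>\<^sub>M M" and \<alpha>: "\<alpha> \<subseteq> sets M" and count: "countable \<alpha>"
  shows "countable (cylinders M T \<alpha> n)"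
proof (induction n)
  case 0
  show ?case by (simp add: cylinders_def)
next
  case (Suc n)
  have "cylinders M T \<alpha> (Suc n) \<subseteq> (\<lambda>(a, c). a \<inter> T -` c) ` (\<alpha> \<times> cylinders M T \<alpha> n)"
    using cylinders_Suc[OF T \<alpha>] by (fastforce simp: image_iff)
  then show ?case using Suc.IH count by (meson countable_SIGMA countable_image countable_subset)
qed

locale gibbs_markov_mixing =
  fixes M :: "'a measure" and T :: "'a \<Rightarrow> 'a" and \<alpha> \<beta> :: "'a set set" and r :: real
  assumes gm: "gibbs_markov M T \<alpha> r" and mp: "measure_preserving_map M T"
    and top_mix: "topologically_mixing M T \<alpha>" and part_\<beta>: "partition_mod M \<beta>"
    and sigma_\<beta>: "sigma_mod M \<beta> = sigma_mod M (images M T \<alpha>)"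

sublocale gibbs_markov_mixing \<subseteq> mp_prob_space M T
  using gm mp unfolding gibbs_markov_def standard_prob_space_def mp_prob_space_def mp_prob_space_axioms_def
  by auto

context gibbs_markov_mixing
begin

abbreviation d :: "'a \<Rightarrow> 'a \<Rightarrow> real" where "d \<equiv> sep_dist T \<alpha> r"

lemma r_pos: "0 < r" and r_less_1: "r < 1"
  using gm unfolding gibbs_markov_def by auto

lemma part_\<alpha>: "partition_mod M \<alpha>"
  using gm unfolding gibbs_markov_def by auto

lemma \<alpha>_sets: "\<alpha> \<subseteq> sets M" and countable_\<alpha>: "countable \<alpha>"
  using part_\<alpha> unfolding partition_mod_def by auto

lemma \<beta>_sets: "\<beta> \<subseteq> sets M" and countable_\<beta>: "countable \<beta>"
  using part_\<beta> unfolding partition_mod_def by auto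

lemma emeasure_vimage_Tn: "E \<in> sets M \<Longrightarrow> emeasure M ((T ^^ n) -` E \<inter> space M) = emeasure M E"
  using emeasure_distr[OF Tn_measurable, of E n] by (simp add: distr_Tn)

lemma measure_vimage_Tn: "E \<in> sets M \<Longrightarrow> measure M ((T ^^ n) -` E \<inter> space M) = measure M E"
  using emeasure_vimage_Tn[of E n] by (simp add: measure_def)

lemma null_vimage_Tn: "N \<in> null_sets M \<Longrightarrow> (T ^^ n) -` N \<inter> space M \<in> null_sets M"
  using emeasure_vimage_Tn[of N n] measurable_sets[OF Tn_measurable, of N n] by (auto simp: null_sets_def)

lemma null_vimage_T: "N \<in> null_sets M \<Longrightarrow> T -` N \<inter> space M \<in> null_sets M"
  using null_vimage_Tn[of N 1] by simp

section \<open>Itineraries and the separation distance\<close>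

text \<open>Off this set every point has exactly one itinerary. On it, overlapping elements may even
  separate a point from itself, so distances can be read off from symbols only outside.\<close>

definition bad_points :: "'a set" where
  "bad_points = (\<Union>n. (T ^^ n) -` ((space M - \<Union>\<alpha>) \<union> (\<Union>a\<in>\<alpha>. \<Union>b\<in>\<alpha>-{a}. a \<inter> b)) \<inter> space M)"

lemma null_bad_points: "bad_points \<in> null_sets M"
proof -
  have "(\<Union>a\<in>\<alpha>. \<Union>b\<in>\<alpha>-{a}. a \<inter> b) \<in> null_sets M"
    using part_\<alpha> countable_\<alpha> unfolding partition_mod_def by (intro null_sets_UN') auto
  then have "(space M - \<Union>\<alpha>) \<union> (\<Union>a\<in>\<alpha>. \<Union>b\<in>\<alpha>-{a}. a \<inter> b) \<in> null_sets M"
    using part_\<alpha> unfolding partition_mod_def by auto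
  then show ?thesis unfolding bad_points_def by (intro null_sets_UN null_vimage_Tn)
qed

lemma itinerary_ex1:
  assumes "x \<in> space M - bad_points"
  shows "\<exists>!a. a \<in> \<alpha> \<and> (T ^^ n) x \<in> a"
proof -
  have "(T ^^ n) x \<in> space M" using assms measurable_space[OF Tn_measurable] by auto
  moreover have "(T ^^ n) x \<notin> (space M - \<Union>\<alpha>) \<union> (\<Union>a\<in>\<alpha>. \<Union>b\<in>\<alpha>-{a}. a \<inter> b)"
    using assms unfolding bad_points_def by auto
  ultimately show ?thesis by blast
qed

definition separated :: "nat \<Rightarrow> 'a \<Rightarrow> 'a \<Rightarrow> bool" where
  "separated n x y \<longleftrightarrow> (\<exists>a\<in>\<alpha>. \<exists>b\<in>\<alpha>. a \<noteq> b \<and> (T ^^ n) x \<in> a \<and> (T ^^ n) y \<in> b)"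

lemma d_eq_0: "(\<And>n. \<not> separated n x y) \<Longrightarrow> d x y = 0"
  unfolding sep_dist_def sep_time_def separated_def
  by (subst Collect_empty_eq[THEN iffD2]) (auto simp: top_enat_def)

lemma d_eq_power:
  assumes "separated k x y" "\<And>m. m < k \<Longrightarrow> \<not> separated m x y"
  shows "d x y = r ^ (k + 1)"
proof -
  have "sep_time T \<alpha> x y = enat (k + 1)"
    unfolding sep_time_def
  proof (rule antisym)
    show "(INF n\<in>{n. \<exists>a\<in>\<alpha>. \<exists>b\<in>\<alpha>. a \<noteq> b \<and> (T ^^ n) x \<in> a \<and> (T ^^ n) y \<in> b}. enat (n + 1)) \<le> enat (k + 1)"
      using assms(1) unfolding separated_def by (intro INF_lower) auto
    show "enat (k + 1) \<le> (INF n\<in>{n. \<exists>a\<in>\<alpha>. \<exists>b\<in>\<alpha>. a \<noteq> b \<and> (T ^^ n) x \<in> a \<and> (T ^^ n) y \<in> b}. enat (n + 1))"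
      using assms(2) unfolding separated_def by (intro INF_greatest) (force simp: not_less[symmetric])
  qed
  then show ?thesis unfolding sep_dist_def by simp
qed

lemma d_cases:
  obtains "\<And>n. \<not> separated n x y" "d x y = 0"
  | k where "separated k x y" "\<And>m. m < k \<Longrightarrow> \<not> separated m x y" "d x y = r ^ (k + 1)"
proof (cases "\<exists>k. separated k x y")
  case True
  define k where "k = (LEAST k. separated k x y)"
  have "separated k x y" unfolding k_def using True by (rule LeastI_ex)
  moreover have "\<not> separated m x y" if "m < k" for m using that unfolding k_def by (rule not_less_Least)
  ultimately show ?thesis using that(2) d_eq_power by metis
next
  case False
  then show ?thesis using that(1) d_eq_0 by metis
qed

lemma d_nonneg: "0 \<le> d x y"
  by (cases x y rule: d_cases) (use r_pos in simp_all)

lemma d_le_power: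
  assumes "\<And>m. m < n \<Longrightarrow> \<not> separated m x y"
  shows "d x y \<le> r ^ n"
proof (cases x y rule: d_cases)
  case 1
  then show ?thesis using r_pos by simp
next
  case (2 k)
  then have "\<not> k < n" using assms by metis
  then have "r ^ (k + 1) \<le> r ^ n" using r_pos r_less_1 by (intro power_decreasing) auto
  then show ?thesis using 2(3) by simp
qed

lemma d_le_1: "d x y \<le> 1"
  using d_le_power[of 0 x y] by simp

lemma d_distinct_elements:
  assumes "a \<in> \<alpha>" "b \<in> \<alpha>" "a \<noteq> b" "x \<in> a" "y \<in> b"
  shows "d x y = r"
proof -
  have "separated 0 x y" unfolding separated_def using assms by auto
  then show ?thesis using d_eq_power[of 0 x y] by simp
qed

text \<open>Two good points of the same element are not separated at time 0, so T lowers the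
  separation time by exactly one. Read backwards, an inverse branch contracts distances by
  r.\<close>

lemma d_T:
  assumes x: "x \<in> space M - bad_points" and y: "y \<in> space M - bad_points"
    and a: "a \<in> \<alpha>" "x \<in> a" "y \<in> a"
  shows "d x y = r * d (T x) (T y)"
proof -
  have 0: "\<not> separated 0 x y"
    using itinerary_ex1[OF x, of 0] itinerary_ex1[OF y, of 0] a unfolding separated_def by auto
  have Suc: "separated (Suc n) x y \<longleftrightarrow> separated n (T x) (T y)" for n
    unfolding separated_def by (simp add: funpow_swap1)
  show ?thesis
  proof (cases "T x" "T y" rule: d_cases)
    case 1
    have "\<not> separated n x y" for n using 0 Suc 1(1) by (cases n) simp_all
    then show ?thesis using d_eq_0 1(2) by simp
  next
    case (2 k)
    have "\<not> separated m x y" if "m < Suc k" for m using 0 Suc 2(2) that by (cases m) simp_all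
    then have "d x y = r ^ (Suc k + 1)" using d_eq_power[of "Suc k" x y] Suc 2(1) by simp
    then show ?thesis using 2(3) by simp
  qed
qed

lemma d_cylinder:
  assumes x: "x \<in> space M - bad_points" and y: "y \<in> space M - bad_points"
    and c: "c \<in> cylinders M T \<alpha> n" "x \<in> c" "y \<in> c"
  shows "d x y \<le> r ^ n"
proof (rule d_le_power)
  fix m assume m: "m < n"
  obtain w where "\<And>i. i < n \<Longrightarrow> w i \<in> \<alpha>" "c = space M \<inter> (\<Inter>i<n. (T ^^ i) -` w i)"
    using c unfolding cylinders_def by auto
  then have "w m \<in> \<alpha>" "(T ^^ m) x \<in> w m" "(T ^^ m) y \<in> w m" using m c by auto
  then show "\<not> separated m x y"
    using itinerary_ex1[OF x, of m] itinerary_ex1[OF y, of m] unfolding separated_def by auto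
qed

lemma cylinder_ex1:
  assumes x: "x \<in> space M - bad_points"
  shows "\<exists>!c. c \<in> cylinders M T \<alpha> n \<and> x \<in> c"
proof -
  define w where "w i = (THE a. a \<in> \<alpha> \<and> (T ^^ i) x \<in> a)" for i
  have w: "w i \<in> \<alpha> \<and> (T ^^ i) x \<in> w i" for i
    unfolding w_def using itinerary_ex1[OF x, of i] by (rule theI')
  show ?thesis
  proof
    show "space M \<inter> (\<Inter>i<n. (T ^^ i) -` w i) \<in> cylinders M T \<alpha> n \<and> x \<in> space M \<inter> (\<Inter>i<n. (T ^^ i) -` w i)"
      using w x unfolding cylinders_def by auto
  next
    fix c assume c: "c \<in> cylinders M T \<alpha> n \<and> x \<in> c"
    then obtain u where u: "\<And>i. i < n \<Longrightarrow> u i \<in> \<alpha>" "c = space M \<inter> (\<Inter>i<n. (T ^^ i) -` u i)"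
      unfolding cylinders_def by auto
    then have "u i = w i" if "i < n" for i
      using itinerary_ex1[OF x, of i] w[of i] c that by auto
    then show "c = space M \<inter> (\<Inter>i<n. (T ^^ i) -` w i)" using u by auto
  qed
qed

lemma cyl_sets: "c \<in> cylinders M T \<alpha> n \<Longrightarrow> c \<in> sets M"
  using cylinders_sets[OF T_measurable \<alpha>_sets] by auto

lemma countable_cyl: "countable (cylinders M T \<alpha> n)"
  by (rule countable_cylinders[OF T_measurable \<alpha>_sets countable_\<alpha>])

section \<open>Compatibility of \<alpha>, \<beta> and the images\<close>

text \<open>Up to null sets these are the unions of elements of \<alpha>. Testing against each
  element makes invariance under a change on a null set immediate.\<close>

definition markov_set :: "'a set \<Rightarrow> bool" where
  "markov_set B \<longleftrightarrow> B \<in> sets M \<and> (\<forall>a\<in>\<alpha>. a \<inter> B \<in> null_sets M \<or> a - B \<in> null_sets M)"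

lemma markov_set_cong:
  assumes B: "markov_set B" and B': "B' \<in> sets M" and null: "B - B' \<in> null_sets M" "B' - B \<in> null_sets M"
  shows "markov_set B'"
  unfolding markov_set_def
proof (intro conjI ballI B')
  fix a assume a: "a \<in> \<alpha>"
  have [measurable]: "a \<in> sets M" "B \<in> sets M" "B' \<in> sets M" using a \<alpha>_sets B B' unfolding markov_set_def by auto
  consider "a \<inter> B \<in> null_sets M" | "a - B \<in> null_sets M" using B a unfolding markov_set_def by auto
  then show "a \<inter> B' \<in> null_sets M \<or> a - B' \<in> null_sets M"
  proof cases
    case 1
    then have "(a \<inter> B) \<union> (B' - B) \<in> null_sets M" using null by auto
    then have "a \<inter> B' \<in> null_sets M" by (rule null_sets_subset) auto
    then show ?thesis by simp
  next
    case 2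
    then have "(a - B) \<union> (B - B') \<in> null_sets M" using null by auto
    then have "a - B' \<in> null_sets M" by (rule null_sets_subset) auto
    then show ?thesis by simp
  qed
qed

lemma images_sets: "images M T \<alpha> \<subseteq> sets M"
  unfolding images_def inverse_branch_def by auto

text \<open>The Markov condition supplies one version of each image in the sigma-algebra of
  \<alpha>; all other versions agree with it modulo null sets.\<close>

lemma markov_set_images:
  assumes "B \<in> images M T \<alpha>"
  shows "markov_set B"
proof -
  obtain a v where a: "a \<in> \<alpha>" and ib: "inverse_branch M T a B v"
    using assms unfolding images_def by auto
  obtain B' v' where ib': "inverse_branch M T a B' v'" and B': "B' \<in> sigma_mod M \<alpha>"
    using a gm unfolding gibbs_markov_def by blast
  have "markov_set B'"
    unfolding markov_set_def using partition_mod_atom[OF part_\<alpha> _ B'] sigma_mod_subset_sets[OF \<alpha>_sets] B' by auto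
  then show ?thesis
    using inverse_branch_unique[OF ib ib'] inverse_branch_unique[OF ib' ib] images_sets assms
    by (meson markov_set_cong subset_eq)
qed

text \<open>This is the reason for measuring regularity on \<beta>: two typical points of one
  element of \<beta> lie in the domains of the same inverse branches, so the sums defining P at both
  points can be compared term by term.\<close>

lemma \<beta>_image_atom:
  assumes "b \<in> \<beta>" "B \<in> images M T \<alpha>"
  shows "b \<inter> B \<in> null_sets M \<or> b - B \<in> null_sets M"
proof (rule partition_mod_atom[OF part_\<beta> assms(1)])
  show "B \<in> sigma_mod M \<beta>" unfolding sigma_\<beta> using assms(2) by (auto simp: sigma_mod_def)
qed

text \<open>Images do not split elements of \<alpha>, and \<beta> generates the same sigma-algebra
  as the images. So \<alpha> refines \<beta>, and a Lipschitz bound on \<beta> applies to both ends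
  of an inverse branch.\<close>

lemma \<alpha>_\<beta>_atom:
  assumes a: "a \<in> \<alpha>" and b: "b \<in> \<beta>"
  shows "a \<inter> b \<in> null_sets M \<or> a - b \<in> null_sets M"
proof (rule sigma_mod_atom[OF images_sets])
  show "b \<in> sigma_mod M (images M T \<alpha>)" unfolding sigma_\<beta>[symmetric] using b by (auto simp: sigma_mod_def)
  show "a \<inter> g \<in> null_sets M \<or> a - g \<in> null_sets M" if "g \<in> images M T \<alpha>" for g
    using markov_set_images[OF that] a unfolding markov_set_def by auto
qed (use a \<alpha>_sets in auto)

section \<open>Chosen branches and the constants of the system\<close>

definition \<iota> :: "'a set \<Rightarrow> 'a set \<times> ('a \<Rightarrow> 'a)" where
  "\<iota> a = (SOME (B, v). inverse_branch M T a B v)"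

abbreviation im :: "'a set \<Rightarrow> 'a set" where "im a \<equiv> fst (\<iota> a)"
abbreviation br :: "'a set \<Rightarrow> 'a \<Rightarrow> 'a" where "br a \<equiv> snd (\<iota> a)"

lemma ib_im: "a \<in> \<alpha> \<Longrightarrow> inverse_branch M T a (im a) (br a)"
proof -
  assume "a \<in> \<alpha>"
  then obtain B v where "inverse_branch M T a B v" using gm unfolding gibbs_markov_def by blast
  then have "\<exists>p. (\<lambda>(B, v). inverse_branch M T a B v) p" by auto
  then have "(\<lambda>(B, v). inverse_branch M T a B v) (\<iota> a)" unfolding \<iota>_def by (rule someI_ex)
  then show ?thesis by (simp add: case_prod_beta)
qed

lemma im_images: "a \<in> \<alpha> \<Longrightarrow> im a \<in> images M T \<alpha>"
  using ib_im unfolding images_def by blast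

lemma im_sets: "a \<in> \<alpha> \<Longrightarrow> im a \<in> sets M"
  using im_images images_sets by auto

lemma \<alpha>_nonempty: "\<alpha> \<noteq> {}"
proof
  assume "\<alpha> = {}"
  then have "space M \<in> null_sets M" using part_\<alpha> unfolding partition_mod_def by simp
  then show False using emeasure_space_1 by auto
qed

lemma big_images: "\<exists>e>0. \<forall>B\<in>images M T \<alpha>. e \<le> measure M B"
proof -
  define i where "i = (INF B\<in>images M T \<alpha>. emeasure M B)"
  have "i > 0" using gm unfolding gibbs_markov_def i_def by auto
  obtain a where "a \<in> \<alpha>" using \<alpha>_nonempty by auto
  have le: "i \<le> emeasure M B" if "B \<in> images M T \<alpha>" for B unfolding i_def using that by (rule INF_lower)
  then have "i \<le> emeasure M (im a)" using im_images[OF \<open>a \<in> \<alpha>\<close>] by auto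
  then have "i < \<infinity>" by (simp add: emeasure_eq_measure le_less_trans[OF _ ennreal_less_top])
  then have "enn2real i > 0" using \<open>i > 0\<close> by (simp add: enn2real_positive_iff)
  moreover have "enn2real i \<le> measure M B" if "B \<in> images M T \<alpha>" for B
    unfolding measure_def using le[OF that] by (intro enn2real_mono) (auto simp: less_top[symmetric])
  ultimately show ?thesis by blast
qed

definition eps :: real where "eps = (SOME e. e > 0 \<and> (\<forall>B\<in>images M T \<alpha>. e \<le> measure M B))"

lemma eps_pos: "eps > 0" and eps_le: "B \<in> images M T \<alpha> \<Longrightarrow> eps \<le> measure M B"
proof -
  have "eps > 0 \<and> (\<forall>B\<in>images M T \<alpha>. eps \<le> measure M B)"
    unfolding eps_def by (rule someI_ex) (use big_images in blast)
  then show "eps > 0" "B \<in> images M T \<alpha> \<Longrightarrow> eps \<le> measure M B" by auto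
qed

text \<open>A null element would have a null image by nonsingularity of its branch, against the big
  image condition.\<close>

lemma \<alpha>_not_null: "a \<in> \<alpha> \<Longrightarrow> a \<notin> null_sets M"
proof
  assume a: "a \<in> \<alpha>" "a \<in> null_sets M"
  note ib = ib_im[OF a(1)]
  have "br a ` im a \<subseteq> a" using ib unfolding inverse_branch_def by auto
  then have "br a ` im a \<in> null_sets M"
    using inverse_branch_sets[OF ib im_sets] a by (meson null_sets_subset subset_refl)
  then have "im a \<in> null_sets M"
    using inverse_branch_null_iff[OF ib im_sets[OF a(1)]] by simp
  then show False using eps_le[OF im_images[OF a(1)]] eps_pos by (auto simp: measure_eq_0_null_sets)
qed

lemma distortion_ex:
  "\<exists>C>0. \<forall>n\<ge>1. \<forall>a\<in>cylinders M T \<alpha> n. \<forall>B v. inverse_branch M (T ^^ n) a B v \<longrightarrow>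
        (\<exists>N\<in>null_sets M. \<forall>x\<in>B - N. \<forall>y\<in>B - N.
           \<bar>branch_deriv M B v x / branch_deriv M B v y - 1\<bar> \<le> C * d x y)"
  using gm unfolding gibbs_markov_def by auto

definition dist_const :: real where
  "dist_const = (SOME C. C > 0 \<and> (\<forall>n\<ge>1. \<forall>a\<in>cylinders M T \<alpha> n. \<forall>B v. inverse_branch M (T ^^ n) a B v \<longrightarrow>
        (\<exists>N\<in>null_sets M. \<forall>x\<in>B - N. \<forall>y\<in>B - N.
           \<bar>branch_deriv M B v x / branch_deriv M B v y - 1\<bar> \<le> C * d x y)))"

lemma dist_const_pos: "dist_const > 0"
  and distortion: "\<lbrakk>n \<ge> 1; a \<in> cylinders M T \<alpha> n; inverse_branch M (T ^^ n) a B v\<rbrakk> \<Longrightarrow>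
        \<exists>N\<in>null_sets M. \<forall>x\<in>B - N. \<forall>y\<in>B - N.
           \<bar>branch_deriv M B v x / branch_deriv M B v y - 1\<bar> \<le> dist_const * d x y"
proof -
  have "dist_const > 0 \<and> (\<forall>n\<ge>1. \<forall>a\<in>cylinders M T \<alpha> n. \<forall>B v. inverse_branch M (T ^^ n) a B v \<longrightarrow>
        (\<exists>N\<in>null_sets M. \<forall>x\<in>B - N. \<forall>y\<in>B - N.
           \<bar>branch_deriv M B v x / branch_deriv M B v y - 1\<bar> \<le> dist_const * d x y))"
    unfolding dist_const_def by (rule someI_ex) (use distortion_ex in blast)
  then show "dist_const > 0" "\<lbrakk>n \<ge> 1; a \<in> cylinders M T \<alpha> n; inverse_branch M (T ^^ n) a B v\<rbrakk> \<Longrightarrow>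
        \<exists>N\<in>null_sets M. \<forall>x\<in>B - N. \<forall>y\<in>B - N.
           \<bar>branch_deriv M B v x / branch_deriv M B v y - 1\<bar> \<le> dist_const * d x y" by blast+
qed

text \<open>The distortion bound without a quotient, with the factor at y kept on the right: in this
  form it can be integrated, and summed over branches.\<close>

lemma distortion_mult:
  assumes n: "n \<ge> 1" and c: "c \<in> cylinders M T \<alpha> n" and ib: "inverse_branch M (T ^^ n) c B v"
  shows "\<exists>N\<in>null_sets M. \<forall>x\<in>B - N. \<forall>y\<in>B - N.
     \<bar>branch_deriv M B v x - branch_deriv M B v y\<bar> \<le> dist_const * d x y * branch_deriv M B v y"
proof -
  let ?J = "branch_deriv M B v"
  obtain N where N: "N \<in> null_sets M" "\<And>x y. x \<in> B - N \<Longrightarrow> y \<in> B - N \<Longrightarrow> \<bar>?J x / ?J y - 1\<bar> \<le> dist_const * d x y"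
    using distortion[OF assms] by blast
  have "AE y in M. y \<in> B \<longrightarrow> 0 < ?J y"
    by (rule branch_deriv_pos(1)[OF ib Tn_measurable cyl_sets[OF c] null_vimage_Tn])
  then obtain N' where N': "N' \<in> null_sets M" "{y \<in> space M. \<not> (y \<in> B \<longrightarrow> 0 < ?J y)} \<subseteq> N'"
    by (auto elim!: AE_E simp: null_sets_def)
  have B: "B \<subseteq> space M" using ib sets.sets_into_space unfolding inverse_branch_def by auto
  show ?thesis
  proof (rule bexI[of _ "N \<union> N'"], intro ballI)
    fix x y assume *: "x \<in> B - (N \<union> N')" "y \<in> B - (N \<union> N')"
    then have pos: "0 < ?J y" using N' B by auto
    have "\<bar>?J x - ?J y\<bar> = \<bar>?J x / ?J y - 1\<bar> * ?J y"
      using pos by (simp add: abs_if field_simps)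
    also have "\<dots> \<le> dist_const * d x y * ?J y"
      using N(2)[of x y] * pos by (intro mult_right_mono) auto
    finally show "\<bar>?J x - ?J y\<bar> \<le> dist_const * d x y * ?J y" .
  qed (use N N' in auto)
qed

section \<open>Images and measures of cylinders\<close>

text \<open>The Markov property gives T^(n+1) c = T^n c' for a cylinder c = a \<inter> T^(-1) c'
  that is not null: the element containing c' then lies in the image of a, so cutting down the
  domain of the composed branch removes only a null set. Induction leads to the image of a single
  element, which is a Markov set of measure at least \<open>eps\<close>.\<close>

lemma cylinder_branch:
  assumes "n \<ge> 1" "c \<in> cylinders M T \<alpha> n"
  shows "\<exists>B v. inverse_branch M (T ^^ n) c B v \<and> (c \<notin> null_sets M \<longrightarrow> markov_set B \<and> eps \<le> measure M B)"
  using assms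
proof (induction n arbitrary: c)
  case 0
  then show ?case by simp
next
  case (Suc n)
  obtain a c' where a: "a \<in> \<alpha>" and c': "c' \<in> cylinders M T \<alpha> n" and c: "c = a \<inter> T -` c'"
    using cylinders_Suc[OF T_measurable \<alpha>_sets Suc.prems(2)] by blast
  note ib = ib_im[OF a]
  have as: "a \<in> sets M" using a \<alpha>_sets by auto
  have asp: "a \<subseteq> space M" using as sets.sets_into_space by auto
  show ?case
  proof (cases "n = 0")
    case True
    have "c' = space M" using c' True by (auto simp: cylinders_def)
    then have "c = a" using c asp measurable_space[OF T_measurable] by auto
    then show ?thesis
      using ib True markov_set_images[OF im_images[OF a]] eps_le[OF im_images[OF a]]
      by (intro exI[of _ "im a"] exI[of _ "br a"]) simp
  next
    case False
    then obtain B v where ib': "inverse_branch M (T ^^ n) c' B v"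
      and B: "c' \<notin> null_sets M \<longrightarrow> markov_set B \<and> eps \<le> measure M B"
      using Suc.IH[OF _ c'] by auto
    let ?B = "{y \<in> B. v y \<in> im a}"
    have ib'': "inverse_branch M (T ^^ Suc n) c ?B (br a \<circ> v)"
      unfolding funpow_Suc_right c
      by (rule inverse_branch_comp[OF ib ib' T_measurable null_vimage_T as cyl_sets[OF c']])
    have Bs: "B \<in> sets M" "?B \<in> sets M" by (fact inverse_branchD(1)[OF ib'], fact inverse_branchD(1)[OF ib''])
    have "markov_set ?B \<and> eps \<le> measure M ?B" if nn: "c \<notin> null_sets M"
    proof -
      have c'nn: "c' \<notin> null_sets M"
      proof
        assume "c' \<in> null_sets M"
        then have "a \<inter> (T -` c' \<inter> space M) \<in> null_sets M"
          by (intro null_set_Int1 null_vimage_T as)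
        moreover have "a \<inter> (T -` c' \<inter> space M) = c" unfolding c using asp by blast
        ultimately show False using nn by simp
      qed
      obtain a1 where a1: "a1 \<in> \<alpha>" "c' \<subseteq> a1"
        using cylinders_subset_element[OF c'] False by auto
      \<comment> \<open>Otherwise c would be covered by the points of a missed by the branch and the
        branch image of a null set, hence be null.\<close>
      have "a1 \<inter> im a \<notin> null_sets M"
      proof
        assume null: "a1 \<inter> im a \<in> null_sets M"
        have "br a ` (c' \<inter> im a) \<in> null_sets M"
        proof -
          have *: "c' \<inter> im a \<in> null_sets M"
            using cyl_sets[OF c'] im_sets[OF a] a1(2) by (intro null_sets_subset[OF null]) auto
          then show ?thesis using inverse_branch_null_iff[OF ib null_setsD2[OF *]] by simp
        qed
        moreover have "a - br a ` im a \<in> null_sets M" by (rule inverse_branchD(3)[OF ib])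
        ultimately have "(a - br a ` im a) \<union> br a ` (c' \<inter> im a) \<in> null_sets M" by (intro null_sets.Un)
        then have "c \<in> null_sets M"
        proof (rule null_sets_subset)
          show "c \<in> sets M" using cyl_sets Suc.prems(2) by blast
          show "c \<subseteq> (a - br a ` im a) \<union> br a ` (c' \<inter> im a)"
            using inverse_branch_image_diff(1)[OF ib, of c'] unfolding c by blast
        qed
        then show False using nn by contradiction
      qed
      then have "a1 - im a \<in> null_sets M"
        using markov_set_images[OF im_images[OF a]] a1(1) unfolding markov_set_def by auto
      moreover have "v ` (B - ?B) \<subseteq> a1 - im a"
        using inverse_branchD(4)[OF ib'] a1(2) by auto
      moreover have BB: "B - ?B \<in> sets M" "B - ?B \<subseteq> B" using Bs by (intro sets.Diff) auto
      moreover have "v ` (B - ?B) \<in> sets M" by (rule inverse_branch_sets[OF ib' BB])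
      ultimately have "v ` (B - ?B) \<in> null_sets M" by (meson null_sets_subset)
      then have null: "B - ?B \<in> null_sets M"
        using inverse_branch_null_iff[OF ib' BB] by simp
      have "?B - B = {}" by auto
      then have "?B - B \<in> null_sets M" by (simp only: null_sets.empty_sets)
      then have "markov_set ?B"
        using B c'nn Bs null by (intro markov_set_cong[of B ?B]) simp_all
      moreover have "measure M ?B = measure M B"
      proof -
        have "measure M (B - (B - ?B)) = measure M B" using Bs(1) null by (rule measure_Diff_null_set)
        moreover have "B - (B - ?B) = ?B" by blast
        ultimately show ?thesis by (simp only:)
      qed
      ultimately show ?thesis using B c'nn by auto
    qed
    then show ?thesis using ib'' by blast
  qed
qed

text \<open>One constant for both directions: comparison with a whole image of measure at least
  \<open>eps\<close> costs (1 + \<open>dist_const\<close>) / \<open>eps\<close> from above and 1 +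
  \<open>dist_const\<close> from below.\<close>

definition cyl_const :: real where "cyl_const = (1 + dist_const) * (1 + 1 / eps)"

lemma cyl_const_ge_1: "1 \<le> cyl_const"
proof -
  have "1 * 1 \<le> (1 + dist_const) * (1 + 1 / eps)"
    using dist_const_pos eps_pos by (intro mult_mono) auto
  then show ?thesis unfolding cyl_const_def by simp
qed

lemma cyl_vimage_sets:
  assumes "c \<in> sets M" "E \<in> sets M"
  shows "c \<inter> (T ^^ n) -` E \<in> sets M"
proof -
  have "c \<inter> (T ^^ n) -` E = c \<inter> ((T ^^ n) -` E \<inter> space M)"
    using sets.sets_into_space[OF assms(1)] by auto
  then show ?thesis using assms measurable_sets[OF Tn_measurable assms(2)] by auto
qed

text \<open>As distances are at most 1, values of the branch derivative at two typical points of B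
  differ at most by the factor 1 + \<open>dist_const\<close>. Integrating over x in E and y in E'
  gives the claim.\<close>

lemma cylinder_ratio:
  assumes n: "n \<ge> 1" and c: "c \<in> cylinders M T \<alpha> n" and ib: "inverse_branch M (T ^^ n) c B v"
    and E: "E \<in> sets M" "E \<subseteq> B" and E': "E' \<in> sets M" "E' \<subseteq> B"
  shows "measure M (c \<inter> (T ^^ n) -` E) * measure M E'
    \<le> (1 + dist_const) * (measure M (c \<inter> (T ^^ n) -` E') * measure M E)"
proof -
  let ?J = "branch_deriv M B v"
  have cs: "c \<in> sets M" using cyl_sets[OF c] .
  have [measurable]: "?J \<in> borel_measurable M"
    by (rule branch_deriv_density(1)[OF ib Tn_measurable cs null_vimage_Tn])
  obtain N where N: "N \<in> null_sets M"
    and JN: "\<And>x y. x \<in> B - N \<Longrightarrow> y \<in> B - N \<Longrightarrow> \<bar>?J x - ?J y\<bar> \<le> dist_const * d x y * ?J y"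
    using distortion_mult[OF n c ib] by blast
  have J: "?J x \<le> (1 + dist_const) * ?J y" if "x \<in> B - N" "y \<in> B - N" for x y
  proof -
    have "dist_const * d x y * ?J y \<le> dist_const * 1 * ?J y"
      using dist_const_pos d_le_1 branch_deriv_nonneg by (intro mult_right_mono mult_left_mono) auto
    then show ?thesis using JN[OF that] by (simp add: algebra_simps)
  qed
  have int: "(\<integral>\<^sup>+y. ennreal (?J y) * indicator F y \<partial>M) = emeasure M (c \<inter> (T ^^ n) -` F)"
    if F: "F \<in> sets M" for F
  proof -
    have "(\<integral>\<^sup>+y. ennreal (?J y) * indicator F y \<partial>M) = (\<integral>\<^sup>+x. indicator c x * indicator F ((T ^^ n) x) \<partial>M)"
      by (rule nn_integral_branch_deriv[OF ib Tn_measurable cs null_vimage_Tn]) (use F in auto)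
    also have "\<dots> = (\<integral>\<^sup>+x. indicator (c \<inter> (T ^^ n) -` F) x \<partial>M)"
      by (intro nn_integral_cong) (auto simp: indicator_def)
    finally show ?thesis using cyl_vimage_sets[OF cs F] by simp
  qed
  have AE_N: "AE y in M. y \<notin> N" using N by (rule AE_not_in)
  have 1: "ennreal (?J x) * emeasure M E' \<le> ennreal (1 + dist_const) * emeasure M (c \<inter> (T ^^ n) -` E')"
    if x: "x \<in> B - N" for x
  proof -
    have "ennreal (?J x) * emeasure M E' = (\<integral>\<^sup>+y. ennreal (?J x) * indicator E' y \<partial>M)"
      using E' by (simp add: nn_integral_cmult)
    also have "\<dots> \<le> (\<integral>\<^sup>+y. ennreal (1 + dist_const) * (ennreal (?J y) * indicator E' y) \<partial>M)"
    proof (rule nn_integral_mono_AE, use AE_N in eventually_elim)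
      fix y assume "y \<notin> N"
      then show "ennreal (?J x) * indicator E' y \<le> ennreal (1 + dist_const) * (ennreal (?J y) * indicator E' y)"
        using J[OF x, of y] E'(2) dist_const_pos branch_deriv_nonneg
        by (auto simp: indicator_def subset_eq ennreal_mult[symmetric] simp del: ennreal_plus)
    qed
    also have "\<dots> = ennreal (1 + dist_const) * emeasure M (c \<inter> (T ^^ n) -` E')"
      using E' int[of E'] by (subst nn_integral_cmult) auto
    finally show ?thesis .
  qed
  have "emeasure M (c \<inter> (T ^^ n) -` E) * emeasure M E'
      = (\<integral>\<^sup>+x. (ennreal (?J x) * indicator E x) * emeasure M E' \<partial>M)"
    using E int[of E] by (subst nn_integral_multc) auto
  also have "\<dots> \<le> (\<integral>\<^sup>+x. (ennreal (1 + dist_const) * emeasure M (c \<inter> (T ^^ n) -` E')) * indicator E x \<partial>M)"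
  proof (rule nn_integral_mono_AE, use AE_N in eventually_elim)
    fix x assume "x \<notin> N"
    then show "(ennreal (?J x) * indicator E x) * emeasure M E'
      \<le> (ennreal (1 + dist_const) * emeasure M (c \<inter> (T ^^ n) -` E')) * indicator E x"
      using 1[of x] E(2) by (auto simp: indicator_def subset_eq)
  qed
  also have "\<dots> = (ennreal (1 + dist_const) * emeasure M (c \<inter> (T ^^ n) -` E')) * emeasure M E"
    using E by (subst nn_integral_cmult) auto
  finally have "ennreal (measure M (c \<inter> (T ^^ n) -` E) * measure M E')
      \<le> ennreal ((1 + dist_const) * measure M (c \<inter> (T ^^ n) -` E') * measure M E)"
    using dist_const_pos by (simp add: emeasure_eq_measure ennreal_mult)
  then show ?thesis
    using dist_const_pos by (subst (asm) ennreal_le_iff) (auto simp: mult.assoc)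
qed

text \<open>Bounded distortion makes the cylinder and the event at time n quasi-independent.
  Comparing E with the whole image B gives the upper bound because the measure of B is at least
  \<open>eps\<close>, and the lower bound because it is at most 1.\<close>

lemma cylinder_bounds:
  assumes n: "n \<ge> 1" and c: "c \<in> cylinders M T \<alpha> n" and nn: "c \<notin> null_sets M"
  obtains B where "markov_set B" "eps \<le> measure M B"
    and "c - (T ^^ n) -` B \<in> null_sets M"
    and "\<And>E. E \<in> sets M \<Longrightarrow> measure M (c \<inter> (T ^^ n) -` E) \<le> cyl_const * (measure M c * measure M E)"
    and "\<And>E. E \<in> sets M \<Longrightarrow> E \<subseteq> B \<Longrightarrow> measure M c * measure M E \<le> cyl_const * measure M (c \<inter> (T ^^ n) -` E)"
proof -
  obtain B v where ib: "inverse_branch M (T ^^ n) c B v" and B: "markov_set B" "eps \<le> measure M B"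
    using cylinder_branch[OF n c] nn by blast
  have cs: "c \<in> sets M" using cyl_sets[OF c] .
  have Bs: "B \<in> sets M" using B unfolding markov_set_def by auto
  have cB: "c - (T ^^ n) -` B \<in> null_sets M"
  proof (rule null_sets_subset[OF inverse_branchD(3)[OF ib]])
    have "c - (T ^^ n) -` B = c - (c \<inter> (T ^^ n) -` B)" by auto
    then show "c - (T ^^ n) -` B \<in> sets M" using cyl_vimage_sets[OF cs Bs] cs by auto
    show "c - (T ^^ n) -` B \<subseteq> c - v ` B" using inverse_branchD(5)[OF ib] by auto
  qed
  have red: "measure M (c \<inter> (T ^^ n) -` E) = measure M (c \<inter> (T ^^ n) -` (E \<inter> B))" if E: "E \<in> sets M" for E
  proof -
    have "c \<inter> (T ^^ n) -` (E \<inter> B) = (c \<inter> (T ^^ n) -` E) - (c - (T ^^ n) -` B)" by auto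
    then show ?thesis
      using measure_Diff_null_set[OF cyl_vimage_sets[OF cs E] cB] by simp
  qed
  have cBm: "measure M (c \<inter> (T ^^ n) -` B) = measure M c"
  proof -
    have "c \<inter> (T ^^ n) -` B = c - (c - (T ^^ n) -` B)" by auto
    then show ?thesis using measure_Diff_null_set[OF cs cB] by simp
  qed
  have up: "measure M (c \<inter> (T ^^ n) -` E) \<le> cyl_const * (measure M c * measure M E)" if E: "E \<in> sets M" for E
  proof -
    let ?m = "measure M (c \<inter> (T ^^ n) -` E)"
    have "?m * eps \<le> ?m * measure M B" using B by (intro mult_left_mono) auto
    also have "\<dots> \<le> (1 + dist_const) * (measure M c * measure M (E \<inter> B))"
      using cylinder_ratio[OF n c ib, of "E \<inter> B" B] E Bs cBm red[OF E] by auto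
    also have "\<dots> \<le> (1 + dist_const) * (measure M c * measure M E)"
      using dist_const_pos E Bs by (intro mult_left_mono finite_measure_mono) auto
    finally have "?m \<le> (1 + dist_const) * (1 / eps) * (measure M c * measure M E)"
      using eps_pos by (simp add: field_simps)
    also have "\<dots> \<le> cyl_const * (measure M c * measure M E)"
      unfolding cyl_const_def using dist_const_pos eps_pos by (intro mult_right_mono mult_left_mono) auto
    finally show ?thesis .
  qed
  have lo: "measure M c * measure M E \<le> cyl_const * measure M (c \<inter> (T ^^ n) -` E)"
    if E: "E \<in> sets M" "E \<subseteq> B" for E
  proof -
    let ?m = "measure M (c \<inter> (T ^^ n) -` E)"
    have "measure M c * measure M E \<le> (1 + dist_const) * (?m * measure M B)"
      using cylinder_ratio[OF n c ib Bs subset_refl E] cBm by simp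
    also have "\<dots> \<le> (1 + dist_const) * (?m * 1)"
      using dist_const_pos by (intro mult_left_mono) auto
    also have "\<dots> \<le> cyl_const * ?m"
      unfolding cyl_const_def using dist_const_pos eps_pos by (auto simp: algebra_simps)
    finally show ?thesis .
  qed
  show ?thesis using that[OF B cB up lo] by blast
qed

end

section \<open>The transfer operator\<close>

lemma nn_integral_count_space_indicator_ex1:
  assumes "\<exists>!c. c \<in> C \<and> x \<in> c"
  shows "(\<integral>\<^sup>+c. indicator c x \<partial>count_space C) = (1 :: ennreal)"
proof -
  obtain c0 where c0: "c0 \<in> C" "x \<in> c0" "\<And>c. c \<in> C \<Longrightarrow> x \<in> c \<Longrightarrow> c = c0" using assms by auto
  have *: "indicator c x = (indicator {c0} c :: ennreal)" if "c \<in> C" for c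
    using c0(2) c0(3)[OF that] by (cases "c = c0") (simp_all add: indicator_def, metis)
  have "(\<integral>\<^sup>+c. indicator c x \<partial>count_space C) = (\<integral>\<^sup>+c. (indicator {c0} c :: ennreal) \<partial>count_space C)"
    by (rule nn_integral_cong) (rule *, simp)
  also have "\<dots> = 1" using c0(1) by (subst nn_integral_indicator) auto
  finally show ?thesis .
qed

lemma nn_integral_partition:
  fixes f :: "'a \<Rightarrow> ennreal"
  assumes C: "countable C" "C \<subseteq> sets M" and ex1: "AE x in M. \<exists>!c. c \<in> C \<and> x \<in> c"
    and f[measurable]: "f \<in> borel_measurable M"
  shows "(\<integral>\<^sup>+x. f x \<partial>M) = (\<integral>\<^sup>+c. (\<integral>\<^sup>+x. indicator c x * f x \<partial>M) \<partial>count_space C)"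
proof -
  have "(\<integral>\<^sup>+x. f x \<partial>M) = (\<integral>\<^sup>+x. (\<integral>\<^sup>+c. indicator c x * f x \<partial>count_space C) \<partial>M)"
    using ex1 by (intro nn_integral_cong_AE, eventually_elim)
      (simp add: nn_integral_multc nn_integral_count_space_indicator_ex1)
  also have "\<dots> = (\<integral>\<^sup>+c. (\<integral>\<^sup>+x. indicator c x * f x \<partial>M) \<partial>count_space C)"
    using C by (intro nn_integral_count_space_nn_integral) auto
  finally show ?thesis .
qed

context gibbs_markov_mixing
begin

lemma AE_not_bad: "AE x in M. x \<in> space M - bad_points"
  using AE_not_in[OF null_bad_points] AE_space by eventually_elim auto

lemma AE_\<alpha>_ex1: "AE x in M. \<exists>!a. a \<in> \<alpha> \<and> x \<in> a"
  using AE_not_bad by eventually_elim (use itinerary_ex1[of _ 0] in simp)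

lemma AE_cyl_ex1: "AE x in M. \<exists>!c. c \<in> cylinders M T \<alpha> n \<and> x \<in> c"
  using AE_not_bad by eventually_elim (rule cylinder_ex1)

lemma integral_Tn:
  fixes f :: "'a \<Rightarrow> 'b :: {banach, second_countable_topology}"
  assumes "f \<in> borel_measurable M"
  shows "(\<integral>x. f ((T ^^ n) x) \<partial>M) = (\<integral>x. f x \<partial>M)"
  using integral_distr[OF Tn_measurable assms, of n] distr_Tn[of n] by simp

section \<open>Pointwise construction of the transfer operator\<close>

text \<open>The indicator is there because \<open>br a\<close> is arbitrary off \<open>im a\<close>,
  where the derivative vanishes only almost everywhere. With it, the sum may run over all of
  \<alpha> at every point.\<close>

definition weight :: "'a set \<Rightarrow> 'a \<Rightarrow> real" where
  "weight a y = indicator (im a) y * branch_deriv M (im a) (br a) y"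

definition full_points :: "'a set" where
  "full_points = {y \<in> space M. (\<integral>\<^sup>+a. ennreal (weight a y) \<partial>count_space \<alpha>) = 1}"

text \<open>The value 0 off \<open>full_points\<close> makes \<open>P\<close> linear and bounded at every point, not just almost
  everywhere, on functions that are bounded everywhere.\<close>

definition P :: "('a \<Rightarrow> real) \<Rightarrow> 'a \<Rightarrow> real" where
  "P f y = indicator full_points y * (\<integral>a. weight a y * f (br a y) \<partial>count_space \<alpha>)"

lemma weight_nonneg: "0 \<le> weight a y"
  unfolding weight_def using branch_deriv_nonneg by simp

lemma weight_measurable: "a \<in> \<alpha> \<Longrightarrow> weight a \<in> borel_measurable M"
proof -
  assume a: "a \<in> \<alpha>"
  then have [measurable]: "im a \<in> sets M" "branch_deriv M (im a) (br a) \<in> borel_measurable M"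
    using im_sets branch_deriv_density(1)[OF ib_im T_measurable _ null_vimage_T] \<alpha>_sets by auto
  show ?thesis unfolding weight_def by measurable
qed

lemma br_measurable:
  fixes f :: "'a \<Rightarrow> real"
  assumes a: "a \<in> \<alpha>" and f: "f \<in> borel_measurable M"
  shows "(\<lambda>y. indicator (im a) y * f (br a y)) \<in> borel_measurable M"
proof -
  have "(\<lambda>y. f (br a y)) \<in> borel_measurable (restrict_space M (im a))"
    by (rule measurable_compose[OF inverse_branchD(2)[OF ib_im[OF a]] f])
  then show ?thesis
    using im_sets[OF a] by (subst (asm) borel_measurable_restrict_space_iff) auto
qed

lemma weight_br_measurable:
  assumes a: "a \<in> \<alpha>" and f: "f \<in> borel_measurable M"
  shows "(\<lambda>y. weight a y * f (br a y)) \<in> borel_measurable M"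
proof -
  have "(\<lambda>y. weight a y * f (br a y)) = (\<lambda>y. weight a y * (indicator (im a) y * f (br a y)))"
    unfolding weight_def by (auto simp: indicator_def)
  then show ?thesis using weight_measurable[OF a] br_measurable[OF a f] by simp
qed

lemma measurable_pair_count_\<alpha>:
  assumes "\<And>a. a \<in> \<alpha> \<Longrightarrow> g a \<in> measurable M K"
  shows "(\<lambda>(y, a). g a y) \<in> measurable (M \<Otimes>\<^sub>M count_space \<alpha>) K"
proof -
  have "(\<lambda>(a, y). g a y) \<in> measurable (count_space \<alpha> \<Otimes>\<^sub>M M) K"
    by (rule measurable_pair_measure_countable1[OF countable_\<alpha>]) (use assms in simp)
  from measurable_pair_swap[OF this] show ?thesis by (simp add: case_prod_beta)
qed

lemma full_points_sets [measurable]: "full_points \<in> sets M"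
proof -
  interpret C: sigma_finite_measure "count_space \<alpha>"
    by (rule sigma_finite_measure_count_space_countable[OF countable_\<alpha>])
  have "(\<lambda>(y, a). ennreal (weight a y)) \<in> borel_measurable (M \<Otimes>\<^sub>M count_space \<alpha>)"
    by (rule measurable_pair_count_\<alpha>) (use weight_measurable in measurable)
  then have [measurable]: "(\<lambda>y. \<integral>\<^sup>+a. ennreal (weight a y) \<partial>count_space \<alpha>) \<in> borel_measurable M"
    by (rule C.borel_measurable_nn_integral)
  show ?thesis unfolding full_points_def by measurable
qed

lemma P_measurable:
  assumes f: "f \<in> borel_measurable M"
  shows "P f \<in> borel_measurable M"
proof -
  interpret C: sigma_finite_measure "count_space \<alpha>"
    by (rule sigma_finite_measure_count_space_countable[OF countable_\<alpha>])
  have "(\<lambda>(y, a). weight a y * f (br a y)) \<in> borel_measurable (M \<Otimes>\<^sub>M count_space \<alpha>)"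
    by (rule measurable_pair_count_\<alpha>) (rule weight_br_measurable[OF _ f])
  then have "(\<lambda>y. \<integral>a. weight a y * f (br a y) \<partial>count_space \<alpha>) \<in> borel_measurable M"
    by (rule C.borel_measurable_lebesgue_integral)
  then show ?thesis unfolding P_def by measurable
qed

lemma weight_integrable:
  assumes "y \<in> full_points"
  shows "integrable (count_space \<alpha>) (\<lambda>a. weight a y)" "(\<integral>a. weight a y \<partial>count_space \<alpha>) = 1"
proof -
  have *: "(\<integral>\<^sup>+a. ennreal (weight a y) \<partial>count_space \<alpha>) = ennreal 1"
    using assms unfolding full_points_def by simp
  show "integrable (count_space \<alpha>) (\<lambda>a. weight a y)"
    by (rule integrableI_nn_integral_finite[OF _ _ *]) (auto simp: weight_nonneg)
  show "(\<integral>a. weight a y \<partial>count_space \<alpha>) = 1"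
    using * by (subst integral_eq_nn_integral) (auto simp: weight_nonneg)
qed

lemma weight_br_integrable:
  assumes y: "y \<in> full_points" and f: "\<And>x. \<bar>f x\<bar> \<le> K"
  shows "integrable (count_space \<alpha>) (\<lambda>a. weight a y * f (br a y))"
proof (rule Bochner_Integration.integrable_bound)
  show "integrable (count_space \<alpha>) (\<lambda>a. K * weight a y)"
    using weight_integrable(1)[OF y] by simp
  have "\<bar>weight a y * f (br a y)\<bar> \<le> \<bar>K * weight a y\<bar>" for a
  proof -
    have "\<bar>weight a y * f (br a y)\<bar> \<le> weight a y * K"
      unfolding abs_mult using f weight_nonneg by (simp add: mult_left_mono)
    then show ?thesis by (simp add: mult.commute abs_le_iff)
  qed
  then show "AE a in count_space \<alpha>. norm (weight a y * f (br a y)) \<le> norm (K * weight a y)" by simp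
qed simp

lemma P_bound:
  assumes f: "\<And>x. \<bar>f x\<bar> \<le> K"
  shows "\<bar>P f y\<bar> \<le> K"
proof (cases "y \<in> full_points")
  case True
  have "\<bar>\<integral>a. weight a y * f (br a y) \<partial>count_space \<alpha>\<bar> \<le> (\<integral>a. K * weight a y \<partial>count_space \<alpha>)"
  proof (rule order_trans[OF integral_abs_bound], rule integral_mono)
    show "integrable (count_space \<alpha>) (\<lambda>a. \<bar>weight a y * f (br a y)\<bar>)"
      using weight_br_integrable[of y f K, OF True f] by simp
    show "integrable (count_space \<alpha>) (\<lambda>a. K * weight a y)"
      using weight_integrable(1)[OF True] by simp
    show "\<bar>weight a y * f (br a y)\<bar> \<le> K * weight a y" for a
      unfolding abs_mult using mult_left_mono[OF f weight_nonneg[of a y], of "br a y"] weight_nonneg[of a y]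
      by (simp add: mult.commute)
  qed
  then show ?thesis using True weight_integrable(2)[OF True] unfolding P_def by simp
next
  case False
  then show ?thesis using f[of y] unfolding P_def by simp
qed

lemma bdd_meas_P: "bdd_meas M f \<Longrightarrow> bdd_meas M (P f)"
proof -
  assume f: "bdd_meas M f"
  then obtain K where "\<And>x. \<bar>f x\<bar> \<le> K" unfolding bdd_meas_def by auto
  then show ?thesis using P_bound P_measurable[OF bdd_measD[OF f]] by (intro bdd_measI) auto
qed

lemma P_lin:
  assumes f: "bdd_meas M f" and g: "bdd_meas M g"
  shows "P (\<lambda>x. s * f x + t * g x) y = s * P f y + t * P g y"
proof (cases "y \<in> full_points")
  case True
  obtain K L where *: "\<And>x. \<bar>f x\<bar> \<le> K" "\<And>x. \<bar>g x\<bar> \<le> L" using f g unfolding bdd_meas_def by auto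
  have "(\<integral>a. weight a y * (s * f (br a y) + t * g (br a y)) \<partial>count_space \<alpha>)
    = (\<integral>a. s * (weight a y * f (br a y)) + t * (weight a y * g (br a y)) \<partial>count_space \<alpha>)"
    by (intro Bochner_Integration.integral_cong) (auto simp: algebra_simps)
  also have "\<dots> = s * (\<integral>a. weight a y * f (br a y) \<partial>count_space \<alpha>) + t * (\<integral>a. weight a y * g (br a y) \<partial>count_space \<alpha>)"
    using weight_br_integrable[of y f K, OF True *(1)] weight_br_integrable[of y g L, OF True *(2)]
    by (subst Bochner_Integration.integral_add) auto
  finally show ?thesis using True unfolding P_def by simp
qed (simp add: P_def)

section \<open>Change of variables and duality\<close>

text \<open>The substitution is applied to the product of f \<circ> \<open>br a\<close> and G;
  almost every x in a satisfies \<open>br a (T x) = x\<close>, which restores f on the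
  right.\<close>

lemma branch_change_of_variables:
  assumes a: "a \<in> \<alpha>" and f: "f \<in> borel_measurable M" "\<And>x. 0 \<le> f x" and G: "G \<in> borel_measurable M"
  shows "(\<integral>\<^sup>+y. ennreal (weight a y * f (br a y)) * G y \<partial>M) = (\<integral>\<^sup>+x. indicator a x * (ennreal (f x) * G (T x)) \<partial>M)"
proof -
  note ib = ib_im[OF a]
  have as: "a \<in> sets M" using a \<alpha>_sets by auto
  note [measurable] = br_measurable[OF a f(1)] G im_sets[OF a] as f(1)
  let ?g = "\<lambda>y. ennreal (indicator (im a) y * f (br a y)) * G y"
  have "(\<integral>\<^sup>+y. ennreal (weight a y * f (br a y)) * G y \<partial>M)
      = (\<integral>\<^sup>+y. ennreal (branch_deriv M (im a) (br a) y) * ?g y \<partial>M)"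
    unfolding weight_def using f(2) branch_deriv_nonneg
    by (intro nn_integral_cong) (auto simp: indicator_def ennreal_mult mult.assoc)
  also have "\<dots> = (\<integral>\<^sup>+x. indicator a x * ?g (T x) \<partial>M)"
    by (rule nn_integral_branch_deriv[OF ib T_measurable as null_vimage_T]) measurable
  also have "\<dots> = (\<integral>\<^sup>+x. indicator a x * (ennreal (f x) * G (T x)) \<partial>M)"
  proof (rule nn_integral_cong_AE, use AE_not_in[OF inverse_branchD(3)[OF ib]] in eventually_elim)
    fix x assume *: "x \<notin> a - br a ` im a"
    show "indicator a x * ?g (T x) = indicator a x * (ennreal (f x) * G (T x))"
    proof (cases "x \<in> a")
      case True
      then obtain y where "y \<in> im a" "x = br a y" using * by auto
      then show ?thesis using inverse_branchD(5)[OF ib] by simp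
    qed simp
  qed
  finally show ?thesis .
qed

lemma nn_integral_weight_sum:
  assumes f: "f \<in> borel_measurable M" "\<And>x. 0 \<le> f x" and G[measurable]: "G \<in> borel_measurable M"
  shows "(\<integral>\<^sup>+y. (\<integral>\<^sup>+a. ennreal (weight a y * f (br a y)) \<partial>count_space \<alpha>) * G y \<partial>M)
    = (\<integral>\<^sup>+x. ennreal (f x) * G (T x) \<partial>M)"
proof -
  note [measurable] = f(1)
  have m: "(\<lambda>y. ennreal (weight a y * f (br a y)) * G y) \<in> borel_measurable M" if "a \<in> \<alpha>" for a
    using weight_br_measurable[OF that f(1)] by measurable
  have "(\<integral>\<^sup>+y. (\<integral>\<^sup>+a. ennreal (weight a y * f (br a y)) \<partial>count_space \<alpha>) * G y \<partial>M)
      = (\<integral>\<^sup>+y. (\<integral>\<^sup>+a. ennreal (weight a y * f (br a y)) * G y \<partial>count_space \<alpha>) \<partial>M)"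
    by (intro nn_integral_cong) (simp add: nn_integral_multc)
  also have "\<dots> = (\<integral>\<^sup>+a. (\<integral>\<^sup>+y. ennreal (weight a y * f (br a y)) * G y \<partial>M) \<partial>count_space \<alpha>)"
    by (rule nn_integral_count_space_nn_integral[OF countable_\<alpha> m])
  also have "\<dots> = (\<integral>\<^sup>+a. (\<integral>\<^sup>+x. indicator a x * (ennreal (f x) * G (T x)) \<partial>M) \<partial>count_space \<alpha>)"
    by (intro nn_integral_cong branch_change_of_variables f G) simp
  also have "\<dots> = (\<integral>\<^sup>+x. ennreal (f x) * G (T x) \<partial>M)"
    by (rule nn_integral_partition[OF countable_\<alpha> \<alpha>_sets AE_\<alpha>_ex1, symmetric]) measurable
  finally show ?thesis .
qed

text \<open>Invariance of the measure is dual to P 1 = 1: the sum of the weights and the constant 1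
  have the same integral over every measurable set.\<close>

lemma AE_full_points: "AE y in M. y \<in> full_points"
proof -
  interpret C: sigma_finite_measure "count_space \<alpha>"
    by (rule sigma_finite_measure_count_space_countable[OF countable_\<alpha>])
  have "(\<lambda>(y, a). ennreal (weight a y)) \<in> borel_measurable (M \<Otimes>\<^sub>M count_space \<alpha>)"
    by (rule measurable_pair_count_\<alpha>) (use weight_measurable in measurable)
  then have m: "(\<lambda>y. \<integral>\<^sup>+a. ennreal (weight a y) \<partial>count_space \<alpha>) \<in> borel_measurable M"
    by (rule C.borel_measurable_nn_integral)
  have "AE y in M. (\<integral>\<^sup>+a. ennreal (weight a y) \<partial>count_space \<alpha>) = 1"
  proof (rule density_unique_finite_measure[OF m])
    fix E assume E: "E \<in> sets M"
    have "(\<integral>\<^sup>+y. (\<integral>\<^sup>+a. ennreal (weight a y) \<partial>count_space \<alpha>) * indicator E y \<partial>M)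
        = (\<integral>\<^sup>+x. indicator E (T x) \<partial>M)"
      using nn_integral_weight_sum[of "\<lambda>_. 1" "indicator E"] E by simp
    also have "\<dots> = (\<integral>\<^sup>+x. indicator E x \<partial>distr M M T)"
      using E by (subst nn_integral_distr) auto
    also have "\<dots> = (\<integral>\<^sup>+x. 1 * indicator E x \<partial>M)"
      using mp unfolding measure_preserving_map_def by simp
    finally show "(\<integral>\<^sup>+y. (\<integral>\<^sup>+a. ennreal (weight a y) \<partial>count_space \<alpha>) * indicator E y \<partial>M)
      = (\<integral>\<^sup>+x. 1 * indicator E x \<partial>M)" .
  qed auto
  then show ?thesis using AE_space by eventually_elim (simp add: full_points_def)
qed

lemma P_duality_nonneg:
  assumes f: "bdd_meas M f" "\<And>x. 0 \<le> f x" and G: "bdd_meas M G" "\<And>x. 0 \<le> G x"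
  shows "(\<integral>y. P f y * G y \<partial>M) = (\<integral>x. f x * G (T x) \<partial>M)"
proof -
  note [measurable] = bdd_measD[OF f(1)] bdd_measD[OF G(1)] P_measurable[OF bdd_measD[OF f(1)]]
  obtain K where K: "\<And>x. \<bar>f x\<bar> \<le> K" using f(1) unfolding bdd_meas_def by auto
  have Pf: "0 \<le> P f y" for y
    unfolding P_def using f(2) weight_nonneg by (intro mult_nonneg_nonneg integral_nonneg_AE) auto
  have "(\<integral>\<^sup>+y. ennreal (P f y * G y) \<partial>M)
      = (\<integral>\<^sup>+y. (\<integral>\<^sup>+a. ennreal (weight a y * f (br a y)) \<partial>count_space \<alpha>) * ennreal (G y) \<partial>M)"
  proof (rule nn_integral_cong_AE, use AE_full_points in eventually_elim)
    fix y assume y: "y \<in> full_points"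
    have "(\<integral>\<^sup>+a. ennreal (weight a y * f (br a y)) \<partial>count_space \<alpha>) = ennreal (P f y)"
      using y f(2) weight_nonneg weight_br_integrable[of y f K, OF y K]
      unfolding P_def by (subst nn_integral_eq_integral) auto
    then show "ennreal (P f y * G y) = (\<integral>\<^sup>+a. ennreal (weight a y * f (br a y)) \<partial>count_space \<alpha>) * ennreal (G y)"
      using Pf G(2) by (simp add: ennreal_mult)
  qed
  also have "\<dots> = (\<integral>\<^sup>+x. ennreal (f x * G (T x)) \<partial>M)"
    using f(2) G(2) by (subst nn_integral_weight_sum) (auto simp: ennreal_mult)
  finally show ?thesis
    using Pf f(2) G(2) by (subst (1 2) integral_eq_nn_integral) auto
qed

text \<open>Adding constants makes f and G nonnegative. Expanding both shifts gives four instances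
  of the nonnegative case.\<close>

lemma P_duality:
  assumes f: "bdd_meas M f" and G: "bdd_meas M G"
  shows "(\<integral>y. P f y * G y \<partial>M) = (\<integral>x. f x * G (T x) \<partial>M)"
proof -
  obtain K L where K: "\<And>x. \<bar>f x\<bar> \<le> K" and L: "\<And>x. \<bar>G x\<bar> \<le> L" using f G unfolding bdd_meas_def by auto
  have K0: "0 \<le> f x + K" "0 \<le> K" for x using K[of x] by auto
  have L0: "0 \<le> G x + L" "0 \<le> L" for x using L[of x] by auto
  let ?f = "\<lambda>x. f x + K" and ?G = "\<lambda>x. G x + L" and ?K = "\<lambda>x::'a. K" and ?L = "\<lambda>x::'a. L"
  have Pf: "P f y = P ?f y - P ?K y" for y
    using P_lin[of ?f ?K 1 "-1" y] f by (simp add: bdd_meas_intros)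
  note bm = bdd_meas_intros bdd_meas_P bdd_meas_T f G
  note it = integrable_bdd_meas
  have "P f y * G y = (P ?f y * ?G y - P ?K y * ?G y) - (P ?f y * ?L y - P ?K y * ?L y)" for y
    unfolding Pf by (simp add: algebra_simps)
  moreover have int_diff: "(\<integral>y. (a y - b y) - (c y - e y) \<partial>M)
      = ((\<integral>y. a y \<partial>M) - (\<integral>y. b y \<partial>M)) - ((\<integral>y. c y \<partial>M) - (\<integral>y. e y \<partial>M))"
    if "bdd_meas M a" "bdd_meas M b" "bdd_meas M c" "bdd_meas M e" for a b c e :: "'a \<Rightarrow> real"
    using that[THEN it] by simp
  ultimately have "(\<integral>y. P f y * G y \<partial>M) = ((\<integral>y. P ?f y * ?G y \<partial>M) - (\<integral>y. P ?K y * ?G y \<partial>M))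
      - ((\<integral>y. P ?f y * ?L y \<partial>M) - (\<integral>y. P ?K y * ?L y \<partial>M))"
    by (simp only:) (rule int_diff; intro bm)
  also have "\<dots> = ((\<integral>y. ?f y * ?G (T y) \<partial>M) - (\<integral>y. ?K y * ?G (T y) \<partial>M))
      - ((\<integral>y. ?f y * ?L (T y) \<partial>M) - (\<integral>y. ?K y * ?L (T y) \<partial>M))"
    using K0 L0 by (subst (1 2 3 4) P_duality_nonneg) (auto intro!: bm)
  also have "\<dots> = (\<integral>y. (?f y * ?G (T y) - ?K y * ?G (T y)) - (?f y * ?L (T y) - ?K y * ?L (T y)) \<partial>M)"
    by (rule int_diff[symmetric]; intro bm)
  also have "\<dots> = (\<integral>x. f x * G (T x) \<partial>M)"
    by (intro Bochner_Integration.integral_cong) (auto simp: algebra_simps)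
  finally show ?thesis .
qed

end

section \<open>Lasota-Yorke inequality and minorization\<close>

context gibbs_markov_mixing
begin

section \<open>Lipschitz functions on \<beta>\<close>

text \<open>The seminorm bound in product form, which also covers points at distance 0. A single
  null set serves all elements of \<beta>.\<close>

definition Lip :: "('a \<Rightarrow> real) \<Rightarrow> real \<Rightarrow> bool" where
  "Lip f D \<longleftrightarrow> (\<exists>N\<in>null_sets M. \<forall>b\<in>\<beta>. \<forall>x\<in>b - N. \<forall>y\<in>b - N. \<bar>f x - f y\<bar> \<le> D * d x y)"

lemma LipI:
  assumes "N \<in> null_sets M" "\<And>b x y. b \<in> \<beta> \<Longrightarrow> x \<in> b - N \<Longrightarrow> y \<in> b - N \<Longrightarrow> \<bar>f x - f y\<bar> \<le> D * d x y"
  shows "Lip f D"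
  using assms unfolding Lip_def by blast

lemma LipE:
  assumes "Lip f D"
  obtains N where "N \<in> null_sets M" "\<And>b x y. b \<in> \<beta> \<Longrightarrow> x \<in> b - N \<Longrightarrow> y \<in> b - N \<Longrightarrow> \<bar>f x - f y\<bar> \<le> D * d x y"
  using assms unfolding Lip_def by blast

lemma Lip_mono: "Lip f D \<Longrightarrow> D \<le> D' \<Longrightarrow> Lip f D'"
  by (erule LipE, rule LipI, assumption) (meson order_trans mult_right_mono d_nonneg)

lemma Lip_const: "Lip (\<lambda>x. c) 0"
  by (rule LipI[of "{}"]) auto

lemma Lip_lin:
  assumes "Lip f D" "Lip g D'"
  shows "Lip (\<lambda>x. s * f x + t * g x) (\<bar>s\<bar> * D + \<bar>t\<bar> * D')"
proof -
  obtain N where N: "N \<in> null_sets M" "\<And>b x y. b \<in> \<beta> \<Longrightarrow> x \<in> b - N \<Longrightarrow> y \<in> b - N \<Longrightarrow> \<bar>f x - f y\<bar> \<le> D * d x y"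
    using LipE[OF assms(1)] by metis
  obtain N' where N': "N' \<in> null_sets M" "\<And>b x y. b \<in> \<beta> \<Longrightarrow> x \<in> b - N' \<Longrightarrow> y \<in> b - N' \<Longrightarrow> \<bar>g x - g y\<bar> \<le> D' * d x y"
    using LipE[OF assms(2)] by metis
  show ?thesis
  proof (rule LipI[of "N \<union> N'"])
    fix b x y assume *: "b \<in> \<beta>" "x \<in> b - (N \<union> N')" "y \<in> b - (N \<union> N')"
    have "\<bar>s * f x + t * g x - (s * f y + t * g y)\<bar> = \<bar>s * (f x - f y) + t * (g x - g y)\<bar>"
      by (simp add: algebra_simps)
    also have "\<dots> \<le> \<bar>s\<bar> * \<bar>f x - f y\<bar> + \<bar>t\<bar> * \<bar>g x - g y\<bar>"
      by (metis abs_mult abs_triangle_ineq)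
    also have "\<dots> \<le> \<bar>s\<bar> * (D * d x y) + \<bar>t\<bar> * (D' * d x y)"
      using N(2)[of b x y] N'(2)[of b x y] * by (intro add_mono mult_left_mono) auto
    finally show "\<bar>s * f x + t * g x - (s * f y + t * g y)\<bar> \<le> (\<bar>s\<bar> * D + \<bar>t\<bar> * D') * d x y"
      by (simp add: algebra_simps)
  qed (use N N' in auto)
qed

lemma AE_null_set:
  assumes "AE x in M. Q x"
  obtains N where "N \<in> null_sets M" "\<And>x. x \<in> space M - N \<Longrightarrow> Q x"
  using assms by (auto elim!: AE_E simp: null_sets_def)

lemma \<beta>_space: "b \<in> \<beta> \<Longrightarrow> x \<in> b \<Longrightarrow> x \<in> space M"
  using \<beta>_sets sets.sets_into_space by blast

lemma Lip_mult:
  assumes f: "Lip f D" "AE x in M. \<bar>f x\<bar> \<le> K" and g: "Lip g D'" "AE x in M. \<bar>g x\<bar> \<le> K'"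
    and nonneg: "0 \<le> K" "0 \<le> K'"
  shows "Lip (\<lambda>x. f x * g x) (K * D' + K' * D)"
proof -
  obtain N where N: "N \<in> null_sets M" "\<And>b x y. b \<in> \<beta> \<Longrightarrow> x \<in> b - N \<Longrightarrow> y \<in> b - N \<Longrightarrow> \<bar>f x - f y\<bar> \<le> D * d x y"
    using LipE[OF f(1)] by metis
  obtain N' where N': "N' \<in> null_sets M" "\<And>b x y. b \<in> \<beta> \<Longrightarrow> x \<in> b - N' \<Longrightarrow> y \<in> b - N' \<Longrightarrow> \<bar>g x - g y\<bar> \<le> D' * d x y"
    using LipE[OF g(1)] by metis
  obtain N1 where N1: "N1 \<in> null_sets M" "\<And>x. x \<in> space M - N1 \<Longrightarrow> \<bar>f x\<bar> \<le> K"
    using AE_null_set[OF f(2)] by metis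
  obtain N2 where N2: "N2 \<in> null_sets M" "\<And>x. x \<in> space M - N2 \<Longrightarrow> \<bar>g x\<bar> \<le> K'"
    using AE_null_set[OF g(2)] by metis
  show ?thesis
  proof (rule LipI[of "N \<union> N' \<union> N1 \<union> N2"])
    fix b x y assume *: "b \<in> \<beta>" "x \<in> b - (N \<union> N' \<union> N1 \<union> N2)" "y \<in> b - (N \<union> N' \<union> N1 \<union> N2)"
    then have sp: "x \<in> space M" "y \<in> space M" using \<beta>_space by auto
    have "\<bar>f x * g x - f y * g y\<bar> = \<bar>f x * (g x - g y) + g y * (f x - f y)\<bar>"
      by (simp add: algebra_simps)
    also have "\<dots> \<le> \<bar>f x\<bar> * \<bar>g x - g y\<bar> + \<bar>g y\<bar> * \<bar>f x - f y\<bar>"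
      by (metis abs_mult abs_triangle_ineq)
    also have "\<dots> \<le> K * (D' * d x y) + K' * (D * d x y)"
      using N(2)[of b x y] N'(2)[of b x y] N1(2)[of x] N2(2)[of y] * sp nonneg
      by (intro add_mono mult_mono) auto
    finally show "\<bar>f x * g x - f y * g y\<bar> \<le> (K * D' + K' * D) * d x y"
      by (simp add: algebra_simps)
  qed (use N N' N1 N2 in auto)
qed

text \<open>If exactly one of two good points lies in a, they are separated at time 0 and their
  distance is r; this is the origin of 1 / r.\<close>

lemma Lip_indicator:
  assumes a: "a \<in> \<alpha>"
  shows "Lip (indicator a) (1 / r)"
proof (rule LipI[OF null_bad_points])
  fix b x y assume *: "b \<in> \<beta>" "x \<in> b - bad_points" "y \<in> b - bad_points"
  then have x: "x \<in> space M - bad_points" and y: "y \<in> space M - bad_points" using \<beta>_space by auto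
  show "\<bar>indicator a x - indicator a y\<bar> \<le> 1 / r * d x y"
  proof (cases "x \<in> a \<longleftrightarrow> y \<in> a")
    case True
    then show ?thesis using d_nonneg[of x y] r_pos by (auto simp: indicator_def)
  next
    case False
    obtain a1 a2 where "a1 \<in> \<alpha>" "x \<in> a1" "a2 \<in> \<alpha>" "y \<in> a2"
      using itinerary_ex1[OF x, of 0] itinerary_ex1[OF y, of 0] by auto
    moreover from this have "a1 \<noteq> a2"
      using False a itinerary_ex1[OF x, of 0] itinerary_ex1[OF y, of 0] by auto
    ultimately have "d x y = r" using d_distinct_elements by blast
    then show ?thesis using r_pos by (auto simp: indicator_def)
  qed
qed

text \<open>As a is not null and \<beta> covers almost everything, some b meets a in more than a
  null set, and then it contains a up to a null set.\<close>

lemma \<alpha>_subset_\<beta>: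
  assumes a: "a \<in> \<alpha>"
  obtains b where "b \<in> \<beta>" "a - b \<in> null_sets M"
proof -
  have as: "a \<in> sets M" using a \<alpha>_sets by auto
  have "\<exists>b\<in>\<beta>. a \<inter> b \<notin> null_sets M"
  proof (rule ccontr)
    assume "\<not> ?thesis"
    then have "(\<Union>b\<in>\<beta>. a \<inter> b) \<in> null_sets M" by (intro null_sets_UN' countable_\<beta>) auto
    then have "(\<Union>b\<in>\<beta>. a \<inter> b) \<union> (space M - \<Union>\<beta>) \<in> null_sets M"
      using part_\<beta> unfolding partition_mod_def by (intro null_sets.Un) auto
    then have "a \<in> null_sets M"
      by (rule null_sets_subset) (use as sets.sets_into_space[OF as] in auto)
    then show False using \<alpha>_not_null[OF a] by simp
  qed
  then show ?thesis using \<alpha>_\<beta>_atom[OF a] that by blast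
qed

lemma br_null:
  assumes a: "a \<in> \<alpha>" and N: "N \<in> null_sets M"
  shows "{y \<in> im a. br a y \<in> N} \<in> null_sets M"
proof -
  note ib = ib_im[OF a]
  have "br a -` N \<inter> space (restrict_space M (im a)) \<in> sets (restrict_space M (im a))"
    using inverse_branchD(2)[OF ib] N by (intro measurable_sets) auto
  moreover have "br a -` N \<inter> space (restrict_space M (im a)) = {y \<in> im a. br a y \<in> N}"
    using sets.sets_into_space[OF im_sets[OF a]] by (auto simp: space_restrict_space)
  ultimately have s: "{y \<in> im a. br a y \<in> N} \<in> sets M"
    using im_sets[OF a] by (metis sets.Int_space_eq2 sets_restrict_space_iff)
  have sub: "{y \<in> im a. br a y \<in> N} \<subseteq> im a" by blast
  have "br a ` {y \<in> im a. br a y \<in> N} \<in> null_sets M"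
    by (rule null_sets_subset[OF N inverse_branch_sets[OF ib s sub]]) blast
  then show ?thesis using inverse_branch_null_iff[OF ib s sub] by simp
qed

text \<open>The difference splits into the distortion of the weight times the bound on f, and the
  weight times the variation of f at two points that the branch has brought closer by the factor r.
  Both parts keep the weight at y, whose sum over the branches is 1.\<close>

lemma branch_pair_estimate:
  assumes a: "a \<in> \<alpha>" and f: "Lip f D" "AE x in M. \<bar>f x\<bar> \<le> K" and D: "0 \<le> D"
  shows "\<exists>N\<in>null_sets M. \<forall>x\<in>im a - N. \<forall>y\<in>im a - N.
    \<bar>weight a x * f (br a x) - weight a y * f (br a y)\<bar> \<le> (dist_const * K + r * D) * d x y * weight a y"
proof -
  note ib = ib_im[OF a]
  have as: "a \<in> sets M" using a \<alpha>_sets by auto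
  have asp: "a \<subseteq> space M" using as sets.sets_into_space by auto
  obtain N where N: "N \<in> null_sets M" "\<And>b x y. b \<in> \<beta> \<Longrightarrow> x \<in> b - N \<Longrightarrow> y \<in> b - N \<Longrightarrow> \<bar>f x - f y\<bar> \<le> D * d x y"
    using LipE[OF f(1)] by metis
  obtain N1 where N1: "N1 \<in> null_sets M" "\<And>x. x \<in> space M - N1 \<Longrightarrow> \<bar>f x\<bar> \<le> K"
    using AE_null_set[OF f(2)] by metis
  obtain b where b: "b \<in> \<beta>" "a - b \<in> null_sets M" using \<alpha>_subset_\<beta>[OF a] .
  have acyl: "a \<in> cylinders M T \<alpha> 1"
    unfolding cylinders_def using a asp by (auto intro!: exI[of _ "\<lambda>_. a"])
  let ?J = "branch_deriv M (im a) (br a)"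
  obtain N2 where N2: "N2 \<in> null_sets M"
    "\<And>x y. x \<in> im a - N2 \<Longrightarrow> y \<in> im a - N2 \<Longrightarrow> \<bar>?J x - ?J y\<bar> \<le> dist_const * d x y * ?J y"
    using distortion_mult[OF _ acyl, of "im a" "br a"] ib by auto
  \<comment> \<open>These sets are exceptional for points of a, whereas the estimate concerns points
    of the image; \<open>br_null\<close> pulls them back.\<close>
  let ?N3 = "N \<union> N1 \<union> (a - b) \<union> bad_points"
  have "?N3 \<in> null_sets M" using N N1 b null_bad_points by auto
  then have N4: "{y \<in> im a. br a y \<in> ?N3} \<in> null_sets M" by (rule br_null[OF a])
  show ?thesis
  proof (rule bexI[of _ "{y \<in> im a. br a y \<in> ?N3} \<union> N2"], intro ballI)
    fix x y assume *: "x \<in> im a - ({y \<in> im a. br a y \<in> ?N3} \<union> N2)" "y \<in> im a - ({y \<in> im a. br a y \<in> ?N3} \<union> N2)"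
    have bx: "br a x \<in> a" "T (br a x) = x" and by': "br a y \<in> a" "T (br a y) = y"
      using inverse_branchD(4,5)[OF ib] * by auto
    have gx: "br a x \<in> space M - bad_points" "br a y \<in> space M - bad_points"
      using * bx by' asp by auto
    have Jy: "0 \<le> ?J y" by (rule branch_deriv_nonneg)
    have 1: "\<bar>?J x - ?J y\<bar> \<le> dist_const * d x y * ?J y" using N2(2) * by blast
    have 2: "\<bar>f (br a x)\<bar> \<le> K" using N1(2)[of "br a x"] gx * by auto
    have "\<bar>f (br a x) - f (br a y)\<bar> \<le> D * d (br a x) (br a y)"
      using N(2)[OF b(1)] * bx by' by auto
    also have "\<dots> = D * (r * d x y)" using d_T[OF gx a bx(1) by'(1)] bx by' by simp
    finally have 3: "\<bar>f (br a x) - f (br a y)\<bar> \<le> D * (r * d x y)" .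
    have "\<bar>?J x * f (br a x) - ?J y * f (br a y)\<bar> = \<bar>(?J x - ?J y) * f (br a x) + ?J y * (f (br a x) - f (br a y))\<bar>"
      by (simp add: algebra_simps)
    also have "\<dots> \<le> \<bar>?J x - ?J y\<bar> * \<bar>f (br a x)\<bar> + ?J y * \<bar>f (br a x) - f (br a y)\<bar>"
      using abs_triangle_ineq[of "(?J x - ?J y) * f (br a x)" "?J y * (f (br a x) - f (br a y))"] Jy
      by (simp add: abs_mult)
    also have "\<dots> \<le> (dist_const * d x y * ?J y) * K + ?J y * (D * (r * d x y))"
      using 1 2 3 Jy dist_const_pos d_nonneg by (intro add_mono mult_mono mult_left_mono) auto
    finally show "\<bar>weight a x * f (br a x) - weight a y * f (br a y)\<bar> \<le> (dist_const * K + r * D) * d x y * weight a y"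
      using * unfolding weight_def by (simp add: algebra_simps)
  qed (use N4 N2 in auto)
qed

text \<open>Since the invariant measure makes the weights of the branches sum to 1, one step already
  contracts the Lipschitz constant, at the price of the supremum norm as weak norm.\<close>

lemma Lip_P:
  assumes f: "bdd_meas M f" "Lip f D" "AE x in M. \<bar>f x\<bar> \<le> K" and D: "0 \<le> D"
  shows "Lip (P f) (dist_const * K + r * D)"
proof -
  obtain L where L: "\<And>x. \<bar>f x\<bar> \<le> L" using f(1) unfolding bdd_meas_def by auto
  let ?C = "dist_const * K + r * D"
  have "\<exists>N. \<forall>a\<in>\<alpha>. N a \<in> null_sets M \<and> (\<forall>x\<in>im a - N a. \<forall>y\<in>im a - N a.
    \<bar>weight a x * f (br a x) - weight a y * f (br a y)\<bar> \<le> ?C * d x y * weight a y)"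
    by (rule bchoice) (use branch_pair_estimate[OF _ f(2,3) D] in blast)
  then obtain N where N: "\<And>a. a \<in> \<alpha> \<Longrightarrow> N a \<in> null_sets M" "\<And>a x y. a \<in> \<alpha> \<Longrightarrow> x \<in> im a - N a \<Longrightarrow> y \<in> im a - N a \<Longrightarrow>
      \<bar>weight a x * f (br a x) - weight a y * f (br a y)\<bar> \<le> ?C * d x y * weight a y"
    by metis
  \<comment> \<open>\<open>A a b\<close> is whichever of \<open>b \<inter> im a\<close> and
    \<open>b - im a\<close> is null. Once it is removed, both points of b lie in \<open>im a\<close>
    or neither does, and in the latter case both weights are 0.\<close>
  define A where "A a b = (if b \<inter> im a \<in> null_sets M then b \<inter> im a else b - im a)" for a b
  have A: "A a b \<in> null_sets M" if "a \<in> \<alpha>" "b \<in> \<beta>" for a b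
    using \<beta>_image_atom[OF that(2) im_images[OF that(1)]] unfolding A_def by auto
  have "space M - full_points \<in> null_sets M"
    using AE_full_points by (subst AE_iff_null_sets) (auto elim: eventually_mono)
  then have null: "(space M - full_points) \<union> (\<Union>a\<in>\<alpha>. N a \<union> (\<Union>b\<in>\<beta>. A a b)) \<in> null_sets M" (is "?N \<in> _")
    using N(1) A countable_\<alpha> countable_\<beta> by (intro null_sets.Un null_sets_UN') auto
  show ?thesis
  proof (rule LipI[OF null])
    fix b x y assume *: "b \<in> \<beta>" "x \<in> b - ?N" "y \<in> b - ?N"
    have full: "x \<in> full_points" "y \<in> full_points" using * \<beta>_space by auto
    have est: "\<bar>weight a x * f (br a x) - weight a y * f (br a y)\<bar> \<le> ?C * d x y * weight a y" if a: "a \<in> \<alpha>" for a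
    proof -
      have "x \<notin> A a b" "y \<notin> A a b" using * a by auto
      then have iff: "x \<in> im a \<longleftrightarrow> y \<in> im a" using * unfolding A_def by (auto split: if_splits)
      show ?thesis
      proof (cases "x \<in> im a")
        case True
        then show ?thesis using N(2)[OF a, of x y] * iff a by auto
      next
        case False
        then show ?thesis using iff unfolding weight_def by simp
      qed
    qed
    note i = weight_br_integrable[of x f L, OF full(1) L] weight_br_integrable[of y f L, OF full(2) L]
    have "\<bar>P f x - P f y\<bar> = \<bar>\<integral>a. weight a x * f (br a x) - weight a y * f (br a y) \<partial>count_space \<alpha>\<bar>"
      unfolding P_def using full i by simp
    also have "\<dots> \<le> (\<integral>a. ?C * d x y * weight a y \<partial>count_space \<alpha>)"
    proof (rule order_trans[OF integral_abs_bound], rule integral_mono)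
      show "integrable (count_space \<alpha>) (\<lambda>a. \<bar>weight a x * f (br a x) - weight a y * f (br a y)\<bar>)"
        using i by (intro integrable_abs Bochner_Integration.integrable_diff)
      show "integrable (count_space \<alpha>) (\<lambda>a. ?C * d x y * weight a y)"
        using weight_integrable(1)[OF full(2)] by (intro integrable_mult_right)
    qed (use est in simp)
    also have "\<dots> = ?C * d x y" using weight_integrable(2)[OF full(2)] by simp
    finally show "\<bar>P f x - P f y\<bar> \<le> ?C * d x y" .
  qed
qed

section \<open>Iterates of the transfer operator\<close>

lemma bdd_meas_Pn: "bdd_meas M f \<Longrightarrow> bdd_meas M ((P ^^ n) f)"
  by (induction n) (simp_all add: bdd_meas_P)

lemma Pn_duality:
  assumes "bdd_meas M f" "bdd_meas M G"
  shows "(\<integral>y. (P ^^ n) f y * G y \<partial>M) = (\<integral>x. f x * G ((T ^^ n) x) \<partial>M)"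
  using assms(2)
proof (induction n arbitrary: G)
  case (Suc n)
  have "(\<integral>y. (P ^^ Suc n) f y * G y \<partial>M) = (\<integral>y. (P ^^ n) f y * G (T y) \<partial>M)"
    using P_duality[OF bdd_meas_Pn[OF assms(1)] Suc.prems] by simp
  also have "\<dots> = (\<integral>x. f x * G (T ((T ^^ n) x)) \<partial>M)"
    by (rule Suc.IH[OF bdd_meas_T[OF Suc.prems]])
  finally show ?case by simp
qed simp

lemma Pn_lin:
  assumes f: "bdd_meas M f" and g: "bdd_meas M g"
  shows "(P ^^ n) (\<lambda>x. s * f x + t * g x) = (\<lambda>y. s * (P ^^ n) f y + t * (P ^^ n) g y)"
proof (induction n)
  case (Suc n)
  then show ?case using P_lin[OF bdd_meas_Pn[OF f] bdd_meas_Pn[OF g]] by auto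
qed simp

lemma integral_Pn: "bdd_meas M f \<Longrightarrow> (\<integral>x. (P ^^ n) f x \<partial>M) = (\<integral>x. f x \<partial>M)"
  using Pn_duality[of f "\<lambda>_. 1" n] by (simp add: bdd_meas_const)

lemma Pn_mono:
  assumes f: "bdd_meas M f" and g: "bdd_meas M g" and le: "AE x in M. f x \<le> g x"
  shows "AE x in M. (P ^^ n) f x \<le> (P ^^ n) g x"
proof (rule AE_le_of_set_integral_le[OF bdd_meas_Pn[OF f] bdd_meas_Pn[OF g]])
  fix E assume E: "E \<in> sets M"
  note i = bdd_meas_indicator[OF E]
  have "(\<integral>x. f x * indicator E ((T ^^ n) x) \<partial>M) \<le> (\<integral>x. g x * indicator E ((T ^^ n) x) \<partial>M)"
  proof (intro integral_mono_AE integrable_bdd_meas bdd_meas_mult f g bdd_meas_Tn i)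
    show "AE x in M. f x * indicator E ((T ^^ n) x) \<le> g x * indicator E ((T ^^ n) x)"
      using le by eventually_elim (simp add: mult_right_mono)
  qed
  then show "(\<integral>x. (P ^^ n) f x * indicator E x \<partial>M) \<le> (\<integral>x. (P ^^ n) g x * indicator E x \<partial>M)"
    by (simp add: Pn_duality f g i)
qed

lemma Pn_const: "AE x in M. (P ^^ n) (\<lambda>x. c) x = c"
proof -
  note b = bdd_meas_Pn[OF bdd_meas_const, of n c] bdd_meas_const[of M c]
  have eq: "(\<integral>x. (P ^^ n) (\<lambda>x. c) x * indicator E x \<partial>M) = (\<integral>x. c * indicator E x \<partial>M)"
    if E: "E \<in> sets M" for E
    using Pn_duality[OF b(2) bdd_meas_indicator[OF E], of n] integral_Tn[of "\<lambda>x. c * indicator E x" n] E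
    by simp
  have "AE x in M. (P ^^ n) (\<lambda>x. c) x \<le> c" "AE x in M. c \<le> (P ^^ n) (\<lambda>x. c) x"
    by (rule AE_le_of_set_integral_le; simp only: b eq order_refl)+
  then show ?thesis by eventually_elim simp
qed

lemma Pn_nonneg:
  assumes "bdd_meas M f" "AE x in M. 0 \<le> f x"
  shows "AE x in M. 0 \<le> (P ^^ n) f x"
  using Pn_mono[OF bdd_meas_const assms(1,2), of n] Pn_const[of n 0] by eventually_elim simp

lemma Pn_abs_bound:
  assumes f: "bdd_meas M f" "AE x in M. \<bar>f x\<bar> \<le> K"
  shows "AE x in M. \<bar>(P ^^ n) f x\<bar> \<le> K"
proof -
  have "AE x in M. f x \<le> K" "AE x in M. - K \<le> f x" using f(2) by (auto elim!: eventually_mono)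
  from Pn_mono[OF f(1) bdd_meas_const this(1), of n] Pn_mono[OF bdd_meas_const f(1) this(2), of n]
    Pn_const[of n K] Pn_const[of n "-K"]
  show ?thesis by eventually_elim auto
qed

text \<open>The sum of the geometric series with terms \<open>dist_const * r ^ i\<close>,
  equivalently the fixed point of L |-> \<open>dist_const\<close> + r L. As P does not increase the
  essential supremum, it bounds the accumulated distortion for all iterates.\<close>

definition LY_const :: real where "LY_const = dist_const / (1 - r)"

lemma LY_const_pos: "0 < LY_const"
  unfolding LY_const_def using dist_const_pos r_less_1 by simp

lemma Lip_Pn:
  assumes f: "bdd_meas M f" "Lip f D" "AE x in M. \<bar>f x\<bar> \<le> K" and D: "0 \<le> D" and K: "0 \<le> K"
  shows "Lip ((P ^^ n) f) (LY_const * K + r ^ n * D)"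
proof (induction n)
  case 0
  show ?case using Lip_mono[OF f(2), of "LY_const * K + r ^ 0 * D"] LY_const_pos K by simp
next
  case (Suc n)
  have nn: "0 \<le> LY_const * K + r ^ n * D" using LY_const_pos K D r_pos by simp
  have "Lip (P ((P ^^ n) f)) (dist_const * K + r * (LY_const * K + r ^ n * D))"
    by (rule Lip_P[OF bdd_meas_Pn[OF f(1)] Suc.IH Pn_abs_bound[OF f(1,3)] nn])
  moreover have "dist_const + r * LY_const = LY_const"
    unfolding LY_const_def using r_less_1 by (simp add: field_simps)
  moreover have "dist_const * K + r * (LY_const * K + r ^ n * D) = (dist_const + r * LY_const) * K + r ^ Suc n * D"
    by (simp add: algebra_simps)
  ultimately show ?case by simp
qed

section \<open>Cylinder averages and the upper bound\<close>

lemma Lip_osc_cylinder: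
  assumes f: "Lip f D" and D: "0 \<le> D" and n: "n \<ge> 1" and c: "c \<in> cylinders M T \<alpha> n"
  shows "\<exists>N\<in>null_sets M. \<forall>x\<in>c - N. \<forall>y\<in>c - N. \<bar>f x - f y\<bar> \<le> D * r ^ n"
proof -
  obtain N where N: "N \<in> null_sets M" "\<And>b x y. b \<in> \<beta> \<Longrightarrow> x \<in> b - N \<Longrightarrow> y \<in> b - N \<Longrightarrow> \<bar>f x - f y\<bar> \<le> D * d x y"
    using LipE[OF f] by metis
  obtain a where a: "a \<in> \<alpha>" "c \<subseteq> a" using cylinders_subset_element[OF c n] by auto
  obtain b where b: "b \<in> \<beta>" "a - b \<in> null_sets M" using \<alpha>_subset_\<beta>[OF a(1)] .
  have csp: "c \<subseteq> space M" using cyl_sets[OF c] sets.sets_into_space by auto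
  show ?thesis
  proof (rule bexI[of _ "N \<union> (a - b) \<union> bad_points"], intro ballI)
    fix x y assume *: "x \<in> c - (N \<union> (a - b) \<union> bad_points)" "y \<in> c - (N \<union> (a - b) \<union> bad_points)"
    have "\<bar>f x - f y\<bar> \<le> D * d x y" using N(2)[OF b(1), of x y] * a(2) by auto
    also have "\<dots> \<le> D * r ^ n"
      using d_cylinder[of x y c n] c * csp D by (intro mult_left_mono) auto
    finally show "\<bar>f x - f y\<bar> \<le> D * r ^ n" .
  qed (use N(1) b(2) null_bad_points in auto)
qed

text \<open>On an n-cylinder f oscillates by at most D r^n, hence stays that close to its mean.
  Multiplying by the measure of c avoids dividing by it.\<close>

lemma cylinder_average:
  assumes f: "bdd_meas M f" "Lip f D" and D: "0 \<le> D" and n: "n \<ge> 1" and c: "c \<in> cylinders M T \<alpha> n"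
  shows "AE x in M. x \<in> c \<longrightarrow> \<bar>f x * measure M c - (\<integral>y. indicator c y * f y \<partial>M)\<bar> \<le> D * r ^ n * measure M c"
proof -
  obtain N where N: "N \<in> null_sets M" "\<And>x y. x \<in> c - N \<Longrightarrow> y \<in> c - N \<Longrightarrow> \<bar>f x - f y\<bar> \<le> D * r ^ n"
    using Lip_osc_cylinder[OF f(2) D n c] by blast
  have cs: "c \<in> sets M" by (rule cyl_sets[OF c])
  note bc = bdd_meas_indicator[OF cs]
  note intro = integrable_bdd_meas bdd_meas_mult bdd_meas_diff bdd_meas_const bc f(1)
  show ?thesis
    using AE_not_in[OF N(1)]
  proof (eventually_elim, intro impI)
    fix x assume x: "x \<notin> N" "x \<in> c"
    have "f x * measure M c - (\<integral>y. indicator c y * f y \<partial>M) = (\<integral>y. f x * indicator c y \<partial>M) - (\<integral>y. indicator c y * f y \<partial>M)"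
      using cs by (simp add: Int_absorb2 sets.sets_into_space)
    also have "\<dots> = (\<integral>y. f x * indicator c y - indicator c y * f y \<partial>M)"
      by (rule Bochner_Integration.integral_diff[symmetric]; intro intro)
    also have "\<bar>\<dots>\<bar> \<le> (\<integral>y. D * r ^ n * indicator c y \<partial>M)"
    proof (rule order_trans[OF integral_abs_bound], rule integral_mono_AE)
      show "AE y in M. \<bar>f x * indicator c y - indicator c y * f y\<bar> \<le> D * r ^ n * indicator c y"
        using AE_not_in[OF N(1)]
      proof eventually_elim
        fix y assume "y \<notin> N"
        then show "\<bar>f x * indicator c y - indicator c y * f y\<bar> \<le> D * r ^ n * indicator c y"
          using N(2)[of x y] x by (cases "y \<in> c") simp_all
      qed
      show "integrable M (\<lambda>y. \<bar>f x * indicator c y - indicator c y * f y\<bar>)"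
        by (intro integrable_abs intro)
      show "integrable M (\<lambda>y. D * r ^ n * indicator c y)" by (intro intro)
    qed
    also have "\<dots> = D * r ^ n * measure M c"
      using cs by (simp add: Int_absorb2 sets.sets_into_space)
    finally show "\<bar>f x * measure M c - (\<integral>y. indicator c y * f y \<partial>M)\<bar> \<le> D * r ^ n * measure M c" .
  qed
qed

text \<open>On c the function f may be replaced by its mean, for any S. With S a preimage under an
  iterate of T, the integral of f against a future event reduces to the measure of c \<inter>
  S.\<close>

lemma integral_cylinder_set:
  assumes f: "bdd_meas M f" "Lip f D" and D: "0 \<le> D" and n: "n \<ge> 1" and c: "c \<in> cylinders M T \<alpha> n"
    and S: "S \<in> sets M"
  shows "\<bar>(\<integral>x. indicator c x * (f x * indicator S x) \<partial>M) * measure M c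
      - (\<integral>y. indicator c y * f y \<partial>M) * measure M (c \<inter> S)\<bar> \<le> D * r ^ n * measure M c * measure M (c \<inter> S)"
proof -
  have cs: "c \<in> sets M" by (rule cyl_sets[OF c])
  have cS: "c \<inter> S \<in> sets M" "c \<inter> S \<subseteq> space M" using cs S sets.sets_into_space by auto
  let ?A = "\<integral>y. indicator c y * f y \<partial>M"
  note b = bdd_meas_indicator[OF cs] bdd_meas_indicator[OF S] bdd_meas_indicator[OF cS(1)]
  note intro = integrable_bdd_meas bdd_meas_mult bdd_meas_diff bdd_meas_const b f(1)
  have "(\<integral>x. indicator c x * (f x * indicator S x) \<partial>M) * measure M c - ?A * measure M (c \<inter> S)
      = (\<integral>x. indicator c x * (f x * indicator S x) * measure M c \<partial>M) - (\<integral>x. ?A * indicator (c \<inter> S) x \<partial>M)"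
    using cS by (simp add: Int_absorb2)
  also have "\<dots> = (\<integral>x. indicator c x * (f x * indicator S x) * measure M c - ?A * indicator (c \<inter> S) x \<partial>M)"
    by (rule Bochner_Integration.integral_diff[symmetric]; intro intro)
  also have "\<bar>\<dots>\<bar> \<le> (\<integral>x. D * r ^ n * measure M c * indicator (c \<inter> S) x \<partial>M)"
  proof (rule order_trans[OF integral_abs_bound], rule integral_mono_AE)
    show "AE x in M. \<bar>indicator c x * (f x * indicator S x) * measure M c - ?A * indicator (c \<inter> S) x\<bar>
        \<le> D * r ^ n * measure M c * indicator (c \<inter> S) x"
      using cylinder_average[OF f D n c] by eventually_elim (simp add: indicator_def)
    show "integrable M (\<lambda>x. \<bar>indicator c x * (f x * indicator S x) * measure M c - ?A * indicator (c \<inter> S) x\<bar>)"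
      by (intro integrable_abs intro)
    show "integrable M (\<lambda>x. D * r ^ n * measure M c * indicator (c \<inter> S) x)" by (intro intro)
  qed
  also have "\<dots> = D * r ^ n * measure M c * measure M (c \<inter> S)"
    using cS by (simp add: Int_absorb2)
  finally show ?thesis .
qed

lemma integral_cylinders_sum:
  assumes f: "bdd_meas M f" and nn: "AE x in M. 0 \<le> f x"
  shows "ennreal (\<integral>x. f x \<partial>M) = (\<integral>\<^sup>+c. ennreal (\<integral>x. indicator c x * f x \<partial>M) \<partial>count_space (cylinders M T \<alpha> n))"
proof -
  have "ennreal (\<integral>x. f x \<partial>M) = (\<integral>\<^sup>+x. ennreal (f x) \<partial>M)"
    using integrable_bdd_meas[OF f] nn by (rule nn_integral_eq_integral[symmetric])
  also have "\<dots> = (\<integral>\<^sup>+c. (\<integral>\<^sup>+x. indicator c x * ennreal (f x) \<partial>M) \<partial>count_space (cylinders M T \<alpha> n))"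
    using bdd_measD[OF f] cylinders_sets[OF T_measurable \<alpha>_sets]
    by (intro nn_integral_partition countable_cyl AE_cyl_ex1) auto
  also have "\<dots> = (\<integral>\<^sup>+c. ennreal (\<integral>x. indicator c x * f x \<partial>M) \<partial>count_space (cylinders M T \<alpha> n))"
  proof (rule nn_integral_cong)
    fix c assume "c \<in> space (count_space (cylinders M T \<alpha> n))"
    then have c: "c \<in> sets M" using cyl_sets by simp
    have "(\<integral>\<^sup>+x. indicator c x * ennreal (f x) \<partial>M) = (\<integral>\<^sup>+x. ennreal (indicator c x * f x) \<partial>M)"
      by (intro nn_integral_cong) (simp add: indicator_def)
    also have "\<dots> = ennreal (\<integral>x. indicator c x * f x \<partial>M)"
    proof (rule nn_integral_eq_integral)
      show "integrable M (\<lambda>x. indicator c x * f x)"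
        by (intro integrable_bdd_meas bdd_meas_mult bdd_meas_indicator c f)
      show "AE x in M. 0 \<le> indicator c x * f x" using nn by eventually_elim simp
    qed
    finally show "(\<integral>\<^sup>+x. indicator c x * ennreal (f x) \<partial>M) = ennreal (\<integral>x. indicator c x * f x \<partial>M)" .
  qed
  finally show ?thesis .
qed

lemma integral_le_of_cylinders:
  assumes f: "bdd_meas M f" "AE x in M. 0 \<le> f x" and g: "bdd_meas M g" "AE x in M. 0 \<le> g x"
    and le: "\<And>c. c \<in> cylinders M T \<alpha> n \<Longrightarrow> c \<notin> null_sets M \<Longrightarrow>
      (\<integral>x. indicator c x * f x \<partial>M) \<le> (\<integral>x. indicator c x * g x \<partial>M)"
  shows "(\<integral>x. f x \<partial>M) \<le> (\<integral>x. g x \<partial>M)"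
proof -
  have "ennreal (\<integral>x. f x \<partial>M) \<le> ennreal (\<integral>x. g x \<partial>M)"
    unfolding integral_cylinders_sum[OF f, of n] integral_cylinders_sum[OF g, of n]
  proof (intro nn_integral_mono ennreal_leI)
    fix c assume "c \<in> space (count_space (cylinders M T \<alpha> n))"
    then have c: "c \<in> cylinders M T \<alpha> n" by simp
    show "(\<integral>x. indicator c x * f x \<partial>M) \<le> (\<integral>x. indicator c x * g x \<partial>M)"
    proof (cases "c \<in> null_sets M")
      case True
      have "(\<integral>x. indicator c x * h x \<partial>M) = 0" for h :: "'a \<Rightarrow> real"
        by (rule integral_eq_zero_AE) (use AE_not_in[OF True] in \<open>auto elim!: eventually_mono\<close>)
      then show ?thesis by simp
    qed (rule le[OF c])
  qed
  moreover have "0 \<le> (\<integral>x. g x \<partial>M)" by (rule integral_nonneg_AE[OF g(2)])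
  ultimately show ?thesis by simp
qed

lemma measure_pos_not_null:
  assumes "c \<in> sets M" "c \<notin> null_sets M"
  shows "0 < measure M c"
proof (rule ccontr)
  assume "\<not> 0 < measure M c"
  then have "measure M c = 0" using measure_nonneg[of M c] by linarith
  then have "emeasure M c = 0" by (simp add: emeasure_eq_measure)
  then show False using assms null_setsI by blast
qed

text \<open>On each n-cylinder f is at most its mean plus D r^n, and the cylinder is
  quasi-independent of the event at time n; summing over the cylinders leaves the integral of f. The
  supremum is thus controlled by the integral up to an exponentially small part, which is what lets
  one class of densities be invariant.\<close>

lemma Pn_upper:
  assumes f: "bdd_meas M f" "Lip f D" "AE x in M. 0 \<le> f x" and D: "0 \<le> D" and n: "n \<ge> 1"
  shows "AE x in M. (P ^^ n) f x \<le> cyl_const * ((\<integral>x. f x \<partial>M) + D * r ^ n)"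
proof (rule AE_le_of_set_integral_le[OF bdd_meas_Pn[OF f(1)] bdd_meas_const])
  fix E assume E: "E \<in> sets M"
  define S where "S = (T ^^ n) -` E \<inter> space M"
  have S: "S \<in> sets M" unfolding S_def using E by measurable
  let ?g = "\<lambda>x. cyl_const * measure M E * (f x + D * r ^ n)"
  have Dr: "0 \<le> D * r ^ n" using D r_pos by simp
  have bg: "bdd_meas M ?g" by (intro bdd_meas_intros f(1))
  have "(\<integral>x. f x * indicator S x \<partial>M) \<le> (\<integral>x. ?g x \<partial>M)"
  proof (rule integral_le_of_cylinders[where n = n])
    show "bdd_meas M (\<lambda>x. f x * indicator S x)" by (intro bdd_meas_intros f(1) S)
    show "AE x in M. 0 \<le> f x * indicator S x" using f(3) by eventually_elim simp
    show "AE x in M. 0 \<le> ?g x" using f(3) by eventually_elim (use Dr cyl_const_ge_1 in simp)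
    fix c assume c: "c \<in> cylinders M T \<alpha> n" "c \<notin> null_sets M"
    have cs: "c \<in> sets M" by (rule cyl_sets[OF c(1)])
    then have pos: "0 < measure M c" using c(2) by (rule measure_pos_not_null)
    let ?A = "\<integral>y. indicator c y * f y \<partial>M"
    have A: "0 \<le> ?A" by (rule integral_nonneg_AE) (use f(3) in eventually_elim, simp)
    have "c \<inter> S = c \<inter> (T ^^ n) -` E" unfolding S_def using sets.sets_into_space[OF cs] by auto
    then have mS: "measure M (c \<inter> S) \<le> cyl_const * (measure M c * measure M E)"
      using cylinder_bounds[OF n c] E by metis
    have "(\<integral>x. indicator c x * (f x * indicator S x) \<partial>M) * measure M c \<le> (?A + D * r ^ n * measure M c) * measure M (c \<inter> S)"
      using integral_cylinder_set[OF f(1,2) D n c(1) S] by (simp add: algebra_simps abs_le_iff)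
    also have "\<dots> \<le> (?A + D * r ^ n * measure M c) * (cyl_const * (measure M c * measure M E))"
      using mS A Dr by (intro mult_left_mono) auto
    also have "\<dots> = ((?A + D * r ^ n * measure M c) * (cyl_const * measure M E)) * measure M c"
      by (simp only: mult_ac)
    finally have "(\<integral>x. indicator c x * (f x * indicator S x) \<partial>M) \<le> (?A + D * r ^ n * measure M c) * (cyl_const * measure M E)"
      using pos by (rule mult_right_le_imp_le)
    also have "?A + D * r ^ n * measure M c = ?A + (\<integral>y. D * r ^ n * indicator c y \<partial>M)"
      using cs by (simp add: Int_absorb2 sets.sets_into_space)
    also have "\<dots> = (\<integral>y. indicator c y * f y + D * r ^ n * indicator c y \<partial>M)"
      by (rule Bochner_Integration.integral_add[symmetric]; intro integrable_bdd_meas bdd_meas_intros f(1) cs)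
    also have "\<dots> * (cyl_const * measure M E) = (\<integral>y. (indicator c y * f y + D * r ^ n * indicator c y) * (cyl_const * measure M E) \<partial>M)"
      by simp
    also have "\<dots> = (\<integral>x. indicator c x * ?g x \<partial>M)"
      by (intro Bochner_Integration.integral_cong) (auto simp: algebra_simps)
    finally show "(\<integral>x. indicator c x * (f x * indicator S x) \<partial>M) \<le> (\<integral>x. indicator c x * ?g x \<partial>M)" .
  qed (rule bg)
  also have "(\<integral>x. ?g x \<partial>M) = cyl_const * measure M E * ((\<integral>x. f x \<partial>M) + D * r ^ n)"
    using integrable_bdd_meas[OF f(1)] by (simp add: prob_space)
  also have "(\<integral>x. f x * indicator S x \<partial>M) = (\<integral>x. f x * indicator E ((T ^^ n) x) \<partial>M)"
    by (intro Bochner_Integration.integral_cong) (auto simp: S_def indicator_def)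
  also have "\<dots> = (\<integral>x. (P ^^ n) f x * indicator E x \<partial>M)"
    by (rule Pn_duality[symmetric, OF f(1) bdd_meas_indicator[OF E]])
  also have "cyl_const * measure M E * ((\<integral>x. f x \<partial>M) + D * r ^ n)
      = (\<integral>x. cyl_const * ((\<integral>x. f x \<partial>M) + D * r ^ n) * indicator E x \<partial>M)"
    using E by (simp add: Int_absorb2 sets.sets_into_space)
  finally show "(\<integral>x. (P ^^ n) f x * indicator E x \<partial>M) \<le> (\<integral>x. cyl_const * ((\<integral>x. f x \<partial>M) + D * r ^ n) * indicator E x \<partial>M)" .
qed

section \<open>Topological mixing and the lower bound\<close>

text \<open>Up to null sets, a is covered by the T^q-images of the countably many non-null
  q-cylinders in b. One of these images meets a in a set that is not null and, being a Markov set,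
  contains a; the lower cylinder bound for that cylinder c gives k = measure of c /
  \<open>cyl_const\<close>.\<close>

lemma mixing_branch:
  assumes b: "b \<in> \<alpha>" and a: "a \<in> \<alpha>" and q: "q \<ge> 1" and mix: "subset_image_mod M (T ^^ q) a b"
  shows "\<exists>k>0. \<forall>E\<in>sets M. E \<subseteq> a \<longrightarrow> k * measure M E \<le> measure M (b \<inter> (T ^^ q) -` E)"
proof -
  let ?C = "{c \<in> cylinders M T \<alpha> q. c \<notin> null_sets M}"
  have as: "a \<in> sets M" and bs: "b \<in> sets M" using a b \<alpha>_sets by auto
  have "\<exists>B. \<forall>c\<in>?C. markov_set (B c) \<and> c - (T ^^ q) -` B c \<in> null_sets M \<and>
     (\<forall>E\<in>sets M. E \<subseteq> B c \<longrightarrow> measure M c * measure M E \<le> cyl_const * measure M (c \<inter> (T ^^ q) -` E))"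
  proof (rule bchoice, rule ballI)
    fix c assume "c \<in> ?C"
    then have "c \<in> cylinders M T \<alpha> q" "c \<notin> null_sets M" by auto
    from cylinder_bounds[OF q this]
    show "\<exists>B. markov_set B \<and> c - (T ^^ q) -` B \<in> null_sets M \<and>
     (\<forall>E\<in>sets M. E \<subseteq> B \<longrightarrow> measure M c * measure M E \<le> cyl_const * measure M (c \<inter> (T ^^ q) -` E))"
      by metis
  qed
  then obtain B where B: "\<And>c. c \<in> ?C \<Longrightarrow> markov_set (B c)" "\<And>c. c \<in> ?C \<Longrightarrow> c - (T ^^ q) -` B c \<in> null_sets M"
     "\<And>c E. c \<in> ?C \<Longrightarrow> E \<in> sets M \<Longrightarrow> E \<subseteq> B c \<Longrightarrow> measure M c * measure M E \<le> cyl_const * measure M (c \<inter> (T ^^ q) -` E)"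
    by blast
  have cC: "countable ?C" using countable_cyl by (rule countable_subset[rotated]) auto
  \<comment> \<open>Removing N leaves points of unique itinerary that lie in a non-null cylinder and
    are sent into its chosen image. Mixing in the sense of \<open>subset_image_mod\<close> tolerates
    this removal.\<close>
  define N where "N = bad_points \<union> (\<Union>c\<in>cylinders M T \<alpha> q - ?C. c) \<union> (\<Union>c\<in>?C. c - (T ^^ q) -` B c)"
  have "N \<in> null_sets M"
    unfolding N_def using null_bad_points B(2) cC countable_cyl
    by (intro null_sets.Un null_sets_UN') auto
  then obtain N' where N': "N' \<in> null_sets M" "a - N' \<subseteq> (T ^^ q) ` (b - N)"
    using mix unfolding subset_image_mod_def by blast
  let ?C' = "{c \<in> ?C. c \<subseteq> b}"
  have sub: "a - N' \<subseteq> (\<Union>c\<in>?C'. a \<inter> B c)"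
  proof
    fix y assume y: "y \<in> a - N'"
    from subsetD[OF N'(2) y] obtain z where zy: "y = (T ^^ q) z" and zN: "z \<in> b - N" by (rule imageE)
    then have z: "z \<in> b" "z \<notin> N" "y = (T ^^ q) z" by simp_all
    have zg: "z \<in> space M - bad_points"
      using z(1,2) sets.sets_into_space[OF bs] unfolding N_def by auto
    from cylinder_ex1[OF zg, of q] obtain c where c: "c \<in> cylinders M T \<alpha> q" "z \<in> c" by (elim ex1E conjE)
    have cC: "c \<in> ?C"
    proof (rule ccontr)
      assume "c \<notin> ?C"
      then have "z \<in> N" using c unfolding N_def by blast
      then show False using z(2) by contradiction
    qed
    obtain b' where b': "b' \<in> \<alpha>" "c \<subseteq> b'" using cylinders_subset_element[OF c(1) q] by blast
    have "b' = b"
      using itinerary_ex1[OF zg, of 0] b'(1) b z(1) subsetD[OF b'(2) c(2)] by (auto simp only: funpow_0)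
    moreover have "y \<in> B c"
    proof (rule ccontr)
      assume "y \<notin> B c"
      then have "z \<in> c - (T ^^ q) -` B c" using c(2) z(3) by simp
      then have "z \<in> N" using cC unfolding N_def by blast
      then show False using z(2) by contradiction
    qed
    ultimately have "y \<in> a \<inter> B c" "c \<in> ?C'" using y b'(2) cC by simp_all
    then show "y \<in> (\<Union>c\<in>?C'. a \<inter> B c)" by (rule UN_I[rotated])
  qed
  have "\<exists>c\<in>?C'. a \<inter> B c \<notin> null_sets M"
  proof (rule ccontr)
    assume *: "\<not> ?thesis"
    have "countable ?C'" using cC by (rule countable_subset[rotated]) blast
    then have "(\<Union>c\<in>?C'. a \<inter> B c) \<in> null_sets M"
      by (rule null_sets_UN') (use * in blast)
    then have "(\<Union>c\<in>?C'. a \<inter> B c) \<union> N' \<in> null_sets M" using N' by (intro null_sets.Un)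
    then have "a \<in> null_sets M" by (rule null_sets_subset[OF _ as]) (use sub in blast)
    then show False using \<alpha>_not_null[OF a] by simp
  qed
  then obtain c where c: "c \<in> ?C" "c \<subseteq> b" "a \<inter> B c \<notin> null_sets M" by blast
  have cs: "c \<in> sets M" using c(1) cyl_sets by blast
  have aB: "a - B c \<in> null_sets M" and Bs: "B c \<in> sets M"
    using B(1)[OF c(1)] a c(3) unfolding markov_set_def by auto
  have pos: "0 < measure M c" using measure_pos_not_null[OF cs] c(1) by blast
  have "measure M c / cyl_const * measure M E \<le> measure M (b \<inter> (T ^^ q) -` E)" if E: "E \<in> sets M" "E \<subseteq> a" for E
  proof -
    have "measure M E = measure M (E - (E - B c))"
    proof (rule measure_Diff_null_set[OF E(1), symmetric])
      show "E - B c \<in> null_sets M" by (rule null_sets_subset[OF aB]) (use E Bs in auto)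
    qed
    also have "E - (E - B c) = E \<inter> B c" by auto
    finally have "measure M c * measure M E = measure M c * measure M (E \<inter> B c)" by simp
    also have "\<dots> \<le> cyl_const * measure M (c \<inter> (T ^^ q) -` (E \<inter> B c))"
      by (rule B(3)[OF c(1)]) (use E Bs in auto)
    also have "\<dots> \<le> cyl_const * measure M (b \<inter> (T ^^ q) -` E)"
      using cyl_const_ge_1 c(2) cyl_vimage_sets[OF bs E(1)] by (intro mult_left_mono finite_measure_mono) auto
    finally show ?thesis using cyl_const_ge_1 by (simp add: field_simps)
  qed
  moreover have "0 < measure M c / cyl_const" using pos cyl_const_ge_1 by simp
  ultimately show ?thesis by blast
qed

lemma finite_large_union:
  assumes "0 < e"
  obtains F where "finite F" "F \<subseteq> \<alpha>" "1 - e < measure M (\<Union>F)"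
proof -
  define s where "s n = (\<Union>i<n. from_nat_into \<alpha> i)" for n :: nat
  have in\<alpha>: "from_nat_into \<alpha> i \<in> \<alpha>" for i using from_nat_into[OF \<alpha>_nonempty] .
  have "range (from_nat_into \<alpha>) = \<alpha>" by (rule range_from_nat_into[OF \<alpha>_nonempty countable_\<alpha>])
  then have U: "(\<Union>n. s n) = \<Union>\<alpha>" unfolding s_def by blast
  have "(\<lambda>n. measure M (s n)) \<longlonglongrightarrow> measure M (\<Union>n. s n)"
  proof (rule finite_Lim_measure_incseq)
    show "range s \<subseteq> sets M" using in\<alpha> \<alpha>_sets unfolding s_def by auto
    show "incseq s" unfolding s_def incseq_def by (auto intro: order_less_le_trans)
  qed
  moreover have "measure M (\<Union>\<alpha>) = 1"
  proof -
    have "\<Union>\<alpha> \<in> sets M" using countable_\<alpha> \<alpha>_sets by (simp add: sets.countable_Union)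
    moreover have "measure M (space M - \<Union>\<alpha>) = 0"
      using part_\<alpha> unfolding partition_mod_def by (simp add: measure_eq_0_null_sets)
    ultimately show ?thesis using prob_compl[of "\<Union>\<alpha>"] by simp
  qed
  ultimately have "(\<lambda>n. measure M (s n)) \<longlonglongrightarrow> 1" using U by simp
  then have "\<forall>\<^sub>F n in sequentially. 1 - e < measure M (s n)" using assms by (intro order_tendstoD) auto
  then obtain n where n: "1 - e < measure M (s n)" by (auto simp: eventually_sequentially)
  show ?thesis
    by (rule that[of "from_nat_into \<alpha> ` {..<n}"]) (use in\<alpha> n in \<open>auto simp: s_def\<close>)
qed

text \<open>Every image has measure at least \<open>eps\<close>, so it contains an element of a fixed finite
  family up to null sets; this makes the mixing time towards one element uniform.\<close>

lemma uniform_mixing: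
  obtains a q k where "a \<in> \<alpha>" "q \<ge> 1" "0 < k"
    "\<And>B E. markov_set B \<Longrightarrow> eps \<le> measure M B \<Longrightarrow> E \<in> sets M \<Longrightarrow> E \<subseteq> a \<Longrightarrow>
      k * measure M E \<le> measure M (B \<inter> (T ^^ q) -` E)"
proof -
  obtain a where a: "a \<in> \<alpha>" using \<alpha>_nonempty by blast
  obtain F where F: "finite F" "F \<subseteq> \<alpha>" "1 - eps < measure M (\<Union>F)" using finite_large_union[OF eps_pos] .
  have "\<forall>\<^sub>F q in sequentially. subset_image_mod M (T ^^ q) a b" if "b \<in> F" for b
    using top_mix F(2) that a unfolding topologically_mixing_def eventually_sequentially
    by (meson Suc_le_eq subsetD)
  then have "\<forall>\<^sub>F q in sequentially. \<forall>b\<in>F. subset_image_mod M (T ^^ q) a b"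
    using F(1) by (simp add: eventually_ball_finite)
  then obtain q0 where "\<forall>q\<ge>q0. \<forall>b\<in>F. subset_image_mod M (T ^^ q) a b" unfolding eventually_sequentially by blast
  then obtain q where q: "q \<ge> 1" "\<And>b. b \<in> F \<Longrightarrow> subset_image_mod M (T ^^ q) a b"
    by (metis max.cobounded1 max.cobounded2)
  have "\<exists>k. \<forall>b\<in>F. 0 < k b \<and> (\<forall>E\<in>sets M. E \<subseteq> a \<longrightarrow> k b * measure M E \<le> measure M (b \<inter> (T ^^ q) -` E))"
    by (rule bchoice) (use mixing_branch[OF _ a q(1) q(2)] F(2) in blast)
  then obtain k where k: "\<And>b. b \<in> F \<Longrightarrow> 0 < k b"
      "\<And>b E. b \<in> F \<Longrightarrow> E \<in> sets M \<Longrightarrow> E \<subseteq> a \<Longrightarrow> k b * measure M E \<le> measure M (b \<inter> (T ^^ q) -` E)"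
    by blast
  define k0 where "k0 = Min (insert 1 (k ` F))"
  have k0: "0 < k0" "\<And>b. b \<in> F \<Longrightarrow> k0 \<le> k b"
    unfolding k0_def using F(1) k(1) by (auto simp: Min_gr_iff)
  have "k0 * measure M E \<le> measure M (B \<inter> (T ^^ q) -` E)"
    if B: "markov_set B" "eps \<le> measure M B" and E: "E \<in> sets M" "E \<subseteq> a" for B E
  proof -
    have Bs: "B \<in> sets M" using B unfolding markov_set_def by simp
    have Us: "\<Union>F \<in> sets M" using F \<alpha>_sets by (auto intro: sets.finite_Union)
    \<comment> \<open>Otherwise B would lie, up to a null set, outside the union of F, whose
      complement has measure less than \<open>eps\<close>.\<close>
    have "\<exists>b\<in>F. b \<inter> B \<notin> null_sets M"
    proof (rule ccontr)
      assume "\<not> ?thesis"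
      then have "(\<Union>b\<in>F. b \<inter> B) \<in> null_sets M"
        using F(1) by (intro null_sets_UN') (auto intro: countable_finite)
      then have "measure M (B - (\<Union>b\<in>F. b \<inter> B)) = measure M B" by (rule measure_Diff_null_set[OF Bs])
      moreover have "measure M (B - (\<Union>b\<in>F. b \<inter> B)) \<le> measure M (space M - \<Union>F)"
        using Us sets.sets_into_space[OF Bs] by (intro finite_measure_mono) auto
      moreover have "measure M (space M - \<Union>F) = 1 - measure M (\<Union>F)" by (rule prob_compl[OF Us])
      ultimately show False using F(3) B(2) by linarith
    qed
    then obtain b where b: "b \<in> F" "b \<inter> B \<notin> null_sets M" by blast
    have bs: "b \<in> sets M" using b F \<alpha>_sets by auto
    have null: "b - B \<in> null_sets M" using B(1) b F(2) unfolding markov_set_def by auto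
    have "k0 * measure M E \<le> k b * measure M E" using k0 b by (intro mult_right_mono) auto
    also have "\<dots> \<le> measure M (b \<inter> (T ^^ q) -` E)" by (rule k(2)[OF b(1) E])
    also have "\<dots> = measure M (b \<inter> (T ^^ q) -` E - (b - B))"
      by (rule measure_Diff_null_set[OF cyl_vimage_sets[OF bs E(1)] null, symmetric])
    also have "\<dots> \<le> measure M (B \<inter> (T ^^ q) -` E)"
      by (rule finite_measure_mono[OF _ cyl_vimage_sets[OF Bs E(1)]]) auto
    finally show ?thesis .
  qed
  then show ?thesis using that[OF a q(1) k0(1)] by blast
qed

text \<open>After p steps each p-cylinder has spread over a Markov set of measure at least
  \<open>eps\<close>; after q more steps a fixed fraction k of the measure of any E inside a is
  reached from there. The mass of f on the cylinder is carried along by its mean, at the price D r^p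
  of replacing f by that mean.\<close>

lemma Pn_lower:
  assumes k: "\<And>B E. markov_set B \<Longrightarrow> eps \<le> measure M B \<Longrightarrow> E \<in> sets M \<Longrightarrow> E \<subseteq> a \<Longrightarrow>
      k * measure M E \<le> measure M (B \<inter> (T ^^ q) -` E)" and k0: "0 < k" and a: "a \<in> \<alpha>"
    and f: "bdd_meas M f" "Lip f D" "AE x in M. 0 \<le> f x" and int: "(\<integral>x. f x \<partial>M) = 1"
    and D: "0 \<le> D" and p: "p \<ge> 1"
  shows "AE x in M. (k / cyl_const - D * r ^ p) * indicator a x \<le> (P ^^ (p + q)) f x"
proof (rule AE_le_of_set_integral_le[OF _ bdd_meas_Pn[OF f(1)]])
  have as: "a \<in> sets M" using a \<alpha>_sets by auto
  show "bdd_meas M (\<lambda>x. (k / cyl_const - D * r ^ p) * indicator a x)" by (intro bdd_meas_intros as)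
  fix E' assume E': "E' \<in> sets M"
  \<comment> \<open>Only subsets of a are controlled from below. Passing back to E' is possible
    because the iterate of f is nonnegative.\<close>
  define E where "E = E' \<inter> a"
  have E: "E \<in> sets M" "E \<subseteq> a" using E' as unfolding E_def by auto
  define S where "S = (T ^^ (p + q)) -` E \<inter> space M"
  define F where "F = (T ^^ q) -` E \<inter> space M"
  have S: "S \<in> sets M" unfolding S_def using E by measurable
  have F: "F \<in> sets M" unfolding F_def using E by measurable
  have Dr: "0 \<le> D * r ^ p" using D r_pos by simp
  let ?g = "\<lambda>x. (f x + D * r ^ p) * indicator S x"
  have "(\<integral>x. k / cyl_const * measure M E * f x \<partial>M) \<le> (\<integral>x. ?g x \<partial>M)"
  proof (rule integral_le_of_cylinders[where n = p])
    show "AE x in M. 0 \<le> k / cyl_const * measure M E * f x" using f(3) by eventually_elim (use k0 cyl_const_ge_1 in simp)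
    show "AE x in M. 0 \<le> ?g x" using f(3) by eventually_elim (use Dr in simp)
    show "bdd_meas M (\<lambda>x. k / cyl_const * measure M E * f x)" "bdd_meas M ?g" by (intro bdd_meas_intros f(1) S)+
    fix c assume c: "c \<in> cylinders M T \<alpha> p" "c \<notin> null_sets M"
    have cs: "c \<in> sets M" by (rule cyl_sets[OF c(1)])
    have pos: "0 < measure M c" by (rule measure_pos_not_null[OF cs c(2)])
    let ?A = "\<integral>y. indicator c y * f y \<partial>M"
    have A: "0 \<le> ?A" by (rule integral_nonneg_AE) (use f(3) in eventually_elim, simp)
    obtain B where B: "markov_set B" "eps \<le> measure M B"
      and lo: "\<And>E. E \<in> sets M \<Longrightarrow> E \<subseteq> B \<Longrightarrow> measure M c * measure M E \<le> cyl_const * measure M (c \<inter> (T ^^ p) -` E)"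
      using cylinder_bounds[OF p c] by metis
    have Bs: "B \<in> sets M" using B unfolding markov_set_def by simp
    have BF: "B \<inter> (T ^^ q) -` E = F \<inter> B" unfolding F_def using sets.sets_into_space[OF Bs] by auto
    have cS: "c \<inter> S \<in> sets M" using cs S by auto
    have "(T ^^ p) x \<in> space M" if "x \<in> space M" for x using measurable_space[OF Tn_measurable that] .
    moreover have "(T ^^ (p + q)) x = (T ^^ q) ((T ^^ p) x)" for x
      by (subst add.commute) (simp add: funpow_add)
    ultimately have sub: "c \<inter> (T ^^ p) -` (F \<inter> B) \<subseteq> c \<inter> S"
      unfolding F_def S_def using sets.sets_into_space[OF cs] by auto
    have "measure M c * (k * measure M E) \<le> measure M c * measure M (F \<inter> B)"
      using k[OF B E] BF by (intro mult_left_mono) auto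
    also have "\<dots> \<le> cyl_const * measure M (c \<inter> (T ^^ p) -` (F \<inter> B))" by (rule lo) (use F Bs in auto)
    also have "\<dots> \<le> cyl_const * measure M (c \<inter> S)"
      using cyl_const_ge_1 by (intro mult_left_mono finite_measure_mono[OF sub cS]) auto
    finally have mS: "measure M c * (k / cyl_const * measure M E) \<le> measure M (c \<inter> S)"
      using cyl_const_ge_1 by (simp add: field_simps)
    have "(k / cyl_const * measure M E * ?A) * measure M c \<le> ?A * measure M (c \<inter> S)"
      using mult_left_mono[OF mS A] by (simp add: mult_ac)
    also have "\<dots> \<le> ((\<integral>x. indicator c x * (f x * indicator S x) \<partial>M) + D * r ^ p * measure M (c \<inter> S)) * measure M c"
      using integral_cylinder_set[OF f(1,2) D p c(1) S] by (simp add: algebra_simps abs_le_iff)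
    finally have "k / cyl_const * measure M E * ?A \<le> (\<integral>x. indicator c x * (f x * indicator S x) \<partial>M) + D * r ^ p * measure M (c \<inter> S)"
      using pos by (rule mult_right_le_imp_le)
    also have "D * r ^ p * measure M (c \<inter> S) = (\<integral>x. D * r ^ p * indicator (c \<inter> S) x \<partial>M)"
      using cS sets.sets_into_space[OF cS] by (simp add: Int_absorb2)
    also have "(\<integral>x. indicator c x * (f x * indicator S x) \<partial>M) + \<dots>
        = (\<integral>x. indicator c x * (f x * indicator S x) + D * r ^ p * indicator (c \<inter> S) x \<partial>M)"
      by (rule Bochner_Integration.integral_add[symmetric]; intro integrable_bdd_meas bdd_meas_intros f(1) cs S cS)
    also have "\<dots> = (\<integral>x. indicator c x * ?g x \<partial>M)"
      by (intro Bochner_Integration.integral_cong) (auto simp: indicator_def)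
    also have "k / cyl_const * measure M E * ?A = (\<integral>x. indicator c x * (k / cyl_const * measure M E * f x) \<partial>M)"
      by (subst integral_mult_right_zero[symmetric]) (simp only: mult_ac)
    finally show "(\<integral>x. indicator c x * (k / cyl_const * measure M E * f x) \<partial>M) \<le> (\<integral>x. indicator c x * ?g x \<partial>M)" .
  qed
  also have "(\<integral>x. ?g x \<partial>M) = (\<integral>x. f x * indicator S x + D * r ^ p * indicator S x \<partial>M)"
    by (simp add: algebra_simps)
  also have "\<dots> = (\<integral>x. f x * indicator S x \<partial>M) + (\<integral>x. D * r ^ p * indicator S x \<partial>M)"
    by (rule Bochner_Integration.integral_add; intro integrable_bdd_meas bdd_meas_intros f(1) S)
  also have "(\<integral>x. D * r ^ p * indicator S x \<partial>M) = D * r ^ p * measure M E"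
    using S measure_vimage_Tn[OF E(1), of "p + q"] sets.sets_into_space[OF S] by (simp add: Int_absorb2 S_def)
  also have "(\<integral>x. f x * indicator S x \<partial>M) = (\<integral>x. f x * indicator E ((T ^^ (p + q)) x) \<partial>M)"
    by (intro Bochner_Integration.integral_cong) (auto simp: S_def indicator_def)
  also have "\<dots> = (\<integral>x. (P ^^ (p + q)) f x * indicator E x \<partial>M)"
    by (rule Pn_duality[symmetric, OF f(1) bdd_meas_indicator[OF E(1)]])
  also have "\<dots> \<le> (\<integral>x. (P ^^ (p + q)) f x * indicator E' x \<partial>M)"
  proof (rule integral_mono_AE)
    show "AE x in M. (P ^^ (p + q)) f x * indicator E x \<le> (P ^^ (p + q)) f x * indicator E' x"
      using Pn_nonneg[OF f(1,3), of "p + q"] by eventually_elim (auto simp: E_def indicator_def)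
  qed (intro integrable_bdd_meas bdd_meas_intros bdd_meas_Pn f(1) E(1) E')+
  finally have "(k / cyl_const - D * r ^ p) * measure M E \<le> (\<integral>x. (P ^^ (p + q)) f x * indicator E' x \<partial>M)"
    using int by (simp add: algebra_simps)
  moreover have "(\<integral>x. (k / cyl_const - D * r ^ p) * indicator a x * indicator E' x \<partial>M) = (k / cyl_const - D * r ^ p) * measure M E"
  proof -
    have "(\<integral>x. (k / cyl_const - D * r ^ p) * indicator a x * indicator E' x \<partial>M) = (\<integral>x. (k / cyl_const - D * r ^ p) * indicator E x \<partial>M)"
      by (intro Bochner_Integration.integral_cong) (auto simp: E_def indicator_def)
    also have "\<dots> = (k / cyl_const - D * r ^ p) * measure M E"
      using E(1) sets.sets_into_space[OF E(1)] by (simp add: Int_absorb2)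
    finally show ?thesis .
  qed
  ultimately show "(\<integral>x. (k / cyl_const - D * r ^ p) * indicator a x * indicator E' x \<partial>M) \<le> (\<integral>x. (P ^^ (p + q)) f x * indicator E' x \<partial>M)"
    by simp
qed

end

section \<open>Coupling and the Poisson equation\<close>

context gibbs_markov_mixing
begin

definition dens :: "real \<Rightarrow> ('a \<Rightarrow> real) \<Rightarrow> bool" where
  "dens K f \<longleftrightarrow> bdd_meas M f \<and> (AE x in M. 0 \<le> f x \<and> f x \<le> K) \<and> Lip f K \<and> (\<integral>x. f x \<partial>M) = 1"

text \<open>Some iterate of P regularizes every density of the class and puts it above \<delta>
  times the indicator of a. Subtracting this common part and renormalizing stays in the class, since
  the constants leave enough room.\<close>

lemma dens_minorization:
  obtains K N \<delta> a where "2 \<le> K" "1 \<le> N" "a \<in> \<alpha>" "0 < \<delta>" "\<delta> < 1"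
    "\<And>f. dens K f \<Longrightarrow> dens K (\<lambda>x. 1 / (1 - \<delta> * measure M a) * (P ^^ N) f x + - \<delta> / (1 - \<delta> * measure M a) * indicator a x)"
proof -
  obtain a q k where a: "a \<in> \<alpha>" and q: "q \<ge> 1" and k0: "0 < k"
    and k: "\<And>B E. markov_set B \<Longrightarrow> eps \<le> measure M B \<Longrightarrow> E \<in> sets M \<Longrightarrow> E \<subseteq> a \<Longrightarrow>
      k * measure M E \<le> measure M (B \<inter> (T ^^ q) -` E)"
    by (rule uniform_mixing, rule that)
  have as: "a \<in> sets M" using a \<alpha>_sets by auto
  define C where "C = cyl_const"
  define L where "L = LY_const"
  have C: "1 \<le> C" and L: "0 < L" unfolding C_def L_def using cyl_const_ge_1 LY_const_pos by auto
  \<comment> \<open>K / 2 dominates both the bound 2 C of the regularized density and its Lipschitz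
    bound 2 C L + 1; the other half absorbs the subtracted indicator and the
    renormalization.\<close>
  define K where "K = 2 * (2 * C * L + 1 + 2 * C)"
  have CL: "0 < C * L" using C L by simp
  have K: "2 \<le> K" "2 * C \<le> K / 2" "2 * C * L + 1 \<le> K / 2" "0 < K"
  proof -
    have "K = 4 * (C * L) + 2 + 4 * C" unfolding K_def by (simp add: algebra_simps)
    then show "2 \<le> K" "2 * C \<le> K / 2" "2 * C * L + 1 \<le> K / 2" "0 < K" using C CL by linarith+
  qed
  define \<kappa> where "\<kappa> = k / C"
  have \<kappa>: "0 < \<kappa>" unfolding \<kappa>_def using k0 C by simp
  define t where "t = min (min 1 (\<kappa> / 2)) (1 / (L + 1)) / K"
  have t: "0 < t" unfolding t_def using \<kappa> L K by simp
  have tK: "t * K = min (min 1 (\<kappa> / 2)) (1 / (L + 1))" unfolding t_def using K by simp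
  have "(\<lambda>n. r ^ n) \<longlonglongrightarrow> 0" using r_pos r_less_1 by (intro LIMSEQ_realpow_zero) auto
  then have "\<forall>\<^sub>F n in sequentially. r ^ n < t" using t by (intro order_tendstoD)
  then obtain n1 where n1: "\<And>n. n \<ge> n1 \<Longrightarrow> r ^ n < t" by (auto simp: eventually_sequentially)
  define n0 where "n0 = Suc n1"
  have small: "K * r ^ n \<le> 1" "K * r ^ n \<le> \<kappa> / 2" "(L + 1) * K * r ^ n \<le> 1" if "n \<ge> n0" for n
  proof -
    have "r ^ n \<le> t" using n1[of n] that unfolding n0_def by simp
    then have "r ^ n * K \<le> t * K" using K(4) by (intro mult_right_mono) auto
    then have *: "K * r ^ n \<le> min (min 1 (\<kappa> / 2)) (1 / (L + 1))"
      unfolding tK by (simp only: mult.commute)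
    then show "K * r ^ n \<le> 1" "K * r ^ n \<le> \<kappa> / 2" by simp_all
    have "K * r ^ n \<le> 1 / (L + 1)" using * by simp
    then show "(L + 1) * K * r ^ n \<le> 1" using L by (simp add: field_simps)
  qed
  \<comment> \<open>For the upper bounds, the first \<open>n0\<close> steps bring the supremum below
    2 C and the other \<open>n0\<close> + q steps bring the Lipschitz constant below K / 2. For the
    lower bound, \<open>n0\<close> + \<open>n0\<close> steps resolve cylinders and q steps
    mix.\<close>
  define N where "N = n0 + n0 + q"
  \<comment> \<open>The bound \<kappa> / 2 keeps the difference nonnegative, 1 / 4 keeps the
    normalizing factor below 4 / 3, and r K / 4 limits the Lipschitz constant of the subtracted
    indicator to K / 4; then 4 / 3 (K / 2 + K / 4) = K.\<close>
  define \<delta> where "\<delta> = min (min (\<kappa> / 2) (1 / 4)) (r * K / 4)"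
  have \<delta>: "0 < \<delta>" "\<delta> \<le> \<kappa> / 2" "\<delta> \<le> 1 / 4" "\<delta> \<le> r * K / 4"
    unfolding \<delta>_def using \<kappa> r_pos K by (auto simp: min_le_iff_disj)
  define s where "s = 1 / (1 - \<delta> * measure M a)"
  have \<delta>m: "\<delta> * measure M a \<le> 1 / 4"
    using mult_mono[of \<delta> "1/4" "measure M a" 1] \<delta> by simp
  then have s: "0 < s" "s \<le> 4 / 3" "s * (1 - \<delta> * measure M a) = 1" unfolding s_def by (auto simp: field_simps)
  have main: "dens K (\<lambda>x. s * (P ^^ N) f x + (- \<delta> * s) * indicator a x)" if f: "dens K f" for f
  proof -
    have bf: "bdd_meas M f" and fK: "AE x in M. 0 \<le> f x \<and> f x \<le> K" and Lf: "Lip f K" and If: "(\<integral>x. f x \<partial>M) = 1"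
      using f unfolding dens_def by auto
    have f0: "AE x in M. 0 \<le> f x" and fabs: "AE x in M. \<bar>f x\<bar> \<le> K"
      by (rule eventually_mono[OF fK], simp)+
    let ?g = "(P ^^ n0) f"
    have bg: "bdd_meas M ?g" by (rule bdd_meas_Pn[OF bf])
    have g1: "AE x in M. ?g x \<le> C * (1 + K * r ^ n0)"
      using Pn_upper[OF bf Lf f0, of n0] If K unfolding C_def n0_def by simp
    have g2: "C * (1 + K * r ^ n0) \<le> C * 2" using small(1)[of n0] C by (intro mult_left_mono) auto
    have gC: "AE x in M. \<bar>?g x\<bar> \<le> 2 * C"
      using g1 Pn_nonneg[OF bf f0, of n0] by eventually_elim (use g2 in linarith)
    have Lg: "Lip ?g ((L + 1) * K)"
    proof (rule Lip_mono)
      show "Lip ?g (L * K + r ^ n0 * K)" unfolding L_def using Lip_Pn[OF bf Lf fabs] K by simp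
      have "r ^ n0 * K \<le> 1 * K" using K r_pos r_less_1 by (intro mult_right_mono power_le_one) auto
      then show "L * K + r ^ n0 * K \<le> (L + 1) * K" by (simp add: algebra_simps)
    qed
    have "N = (n0 + q) + n0" unfolding N_def by simp
    then have PN: "(P ^^ N) f = (P ^^ (n0 + q)) ?g"
      by (simp only: funpow_add[where m = "n0 + q" and n = n0] comp_apply)
    have bN: "bdd_meas M ((P ^^ N) f)" by (rule bdd_meas_Pn[OF bf])
    have NC: "AE x in M. \<bar>(P ^^ N) f x\<bar> \<le> K / 2"
      unfolding PN using Pn_abs_bound[OF bg gC, of "n0 + q"] by eventually_elim (use K in linarith)
    have LN: "Lip ((P ^^ N) f) (K / 2)"
    proof (rule Lip_mono)
      show "Lip ((P ^^ N) f) (L * (2 * C) + r ^ (n0 + q) * ((L + 1) * K))"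
        unfolding L_def PN using Lip_Pn[OF bg Lg gC, of "n0 + q"] L K C unfolding L_def by simp
      show "L * (2 * C) + r ^ (n0 + q) * ((L + 1) * K) \<le> K / 2"
        using small(3)[of "n0 + q"] K(3) by (simp add: mult_ac)
    qed
    have low: "AE x in M. (\<kappa> - K * r ^ (n0 + n0)) * indicator a x \<le> (P ^^ N) f x"
      unfolding N_def \<kappa>_def C_def by (rule Pn_lower[OF k k0 a bf Lf f0 If]) (use K n0_def in auto)
    have "AE x in M. 0 \<le> s * (P ^^ N) f x + (- \<delta> * s) * indicator a x \<and> s * (P ^^ N) f x + (- \<delta> * s) * indicator a x \<le> K"
      using low NC
    proof eventually_elim
      fix x assume 1: "(\<kappa> - K * r ^ (n0 + n0)) * indicator a x \<le> (P ^^ N) f x" and 2: "\<bar>(P ^^ N) f x\<bar> \<le> K / 2"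
      have "\<delta> * indicator a x \<le> (\<kappa> - K * r ^ (n0 + n0)) * indicator a x"
        using small(2)[of "n0 + n0"] \<delta> by (intro mult_right_mono) auto
      then have "0 \<le> s * ((P ^^ N) f x - \<delta> * indicator a x)" using 1 s by (intro mult_nonneg_nonneg) auto
      moreover have "s * (P ^^ N) f x \<le> 4 / 3 * (K / 2)"
      proof -
        have "s * (P ^^ N) f x \<le> s * (K / 2)" using 2 s(1) by (intro mult_left_mono) auto
        also have "\<dots> \<le> 4 / 3 * (K / 2)" using s(2) K by (intro mult_right_mono) auto
        finally show ?thesis .
      qed
      moreover have "0 \<le> \<delta> * s * indicator a x" using \<delta> s by simp
      ultimately show "0 \<le> s * (P ^^ N) f x + (- \<delta> * s) * indicator a x \<and> s * (P ^^ N) f x + (- \<delta> * s) * indicator a x \<le> K"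
        using K by (simp add: algebra_simps)
    qed
    moreover have "Lip (\<lambda>x. s * (P ^^ N) f x + (- \<delta> * s) * indicator a x) K"
    proof (rule Lip_mono[OF Lip_lin[OF LN Lip_indicator[OF a]]])
      have "\<delta> / r \<le> K / 4" using \<delta>(4) r_pos by (simp add: field_simps)
      then have "s * (K / 2 + \<delta> / r) \<le> 4 / 3 * (K / 2 + K / 4)"
        using s \<delta> r_pos K by (intro mult_mono add_mono) auto
      then show "\<bar>s\<bar> * (K / 2) + \<bar>- \<delta> * s\<bar> * (1 / r) \<le> K"
        using s \<delta> by (simp add: abs_mult algebra_simps)
    qed
    moreover have "(\<integral>x. s * (P ^^ N) f x + (- \<delta> * s) * indicator a x \<partial>M) = 1"
    proof -
      have "(\<integral>x. s * (P ^^ N) f x + (- \<delta> * s) * indicator a x \<partial>M)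
          = (\<integral>x. s * (P ^^ N) f x \<partial>M) + (\<integral>x. (- \<delta> * s) * indicator a x \<partial>M)"
        by (rule Bochner_Integration.integral_add; intro integrable_bdd_meas bdd_meas_intros bN as)
      also have "\<dots> = s * (1 - \<delta> * measure M a)"
        using integral_Pn[OF bf, of N] If as sets.sets_into_space[OF as] by (simp add: Int_absorb2 algebra_simps)
      finally show ?thesis using s by simp
    qed
    moreover have "bdd_meas M (\<lambda>x. s * (P ^^ N) f x + (- \<delta> * s) * indicator a x)"
      by (intro bdd_meas_intros bN as)
    ultimately show ?thesis unfolding dens_def by simp
  qed
  have "1 \<le> N" unfolding N_def n0_def by simp
  moreover have "\<delta> < 1" using \<delta> by simp
  moreover have "- \<delta> / (1 - \<delta> * measure M a) = - \<delta> * s" unfolding s_def by simp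
  ultimately show ?thesis using that[OF K(1) _ a \<delta>(1)] main unfolding s_def by simp
qed

text \<open>Both densities lose the same multiple of the indicator of a, which cancels in their
  difference. What is left is a difference of two densities of the same class times \<rho>, the mass
  that remains after the subtraction, so the step can be repeated.\<close>

lemma dens_contraction:
  obtains K N \<rho> where "2 \<le> K" "1 \<le> N" "0 < \<rho>" "\<rho> < 1"
    "\<And>f g j. dens K f \<Longrightarrow> dens K g \<Longrightarrow>
      \<exists>f' g'. dens K f' \<and> dens K g' \<and> (\<forall>x. (P ^^ (j * N)) f x - (P ^^ (j * N)) g x = \<rho> ^ j * (f' x - g' x))"
proof -
  obtain K N \<delta> a where *: "2 \<le> K" "1 \<le> N" "a \<in> \<alpha>" "0 < \<delta>" "\<delta> < 1"
    and R: "\<And>f. dens K f \<Longrightarrow> dens K (\<lambda>x. 1 / (1 - \<delta> * measure M a) * (P ^^ N) f x + - \<delta> / (1 - \<delta> * measure M a) * indicator a x)"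
    by (rule dens_minorization, rule that)
  define \<rho> where "\<rho> = 1 - \<delta> * measure M a"
  have "0 < measure M a" using *(3) \<alpha>_sets \<alpha>_not_null by (intro measure_pos_not_null) auto
  then have "0 < \<delta> * measure M a" using *(4) by (intro mult_pos_pos)
  moreover have "\<delta> * measure M a \<le> \<delta> * 1" using *(4) by (intro mult_left_mono) auto
  ultimately have \<rho>: "0 < \<rho>" "\<rho> < 1" unfolding \<rho>_def using *(5) by linarith+
  have "\<exists>f' g'. dens K f' \<and> dens K g' \<and> (\<forall>x. (P ^^ (j * N)) f x - (P ^^ (j * N)) g x = \<rho> ^ j * (f' x - g' x))"
    if "dens K f" "dens K g" for f g j
  proof (induction j)
    case 0
    show ?case using that by auto
  next
    case (Suc j)
    then obtain f' g' where f': "dens K f'" and g': "dens K g'"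
      and eq: "\<And>x. (P ^^ (j * N)) f x - (P ^^ (j * N)) g x = \<rho> ^ j * (f' x - g' x)" by blast
    have b: "bdd_meas M f" "bdd_meas M g" "bdd_meas M f'" "bdd_meas M g'"
      using that f' g' unfolding dens_def by auto
    let ?R = "\<lambda>f x. 1 / \<rho> * (P ^^ N) f x + - \<delta> / \<rho> * indicator a x"
    have "(P ^^ (Suc j * N)) f x - (P ^^ (Suc j * N)) g x = \<rho> ^ Suc j * (?R f' x - ?R g' x)" for x
    proof -
      have lin: "(P ^^ N) u x - (P ^^ N) v x = (P ^^ N) (\<lambda>x. u x - v x) x" if "bdd_meas M u" "bdd_meas M v" for u v
        using Pn_lin[OF that, of N 1 "-1"] by simp
      have "(P ^^ (Suc j * N)) f x - (P ^^ (Suc j * N)) g x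
          = (P ^^ N) ((P ^^ (j * N)) f) x - (P ^^ N) ((P ^^ (j * N)) g) x"
        by (simp add: funpow_add)
      also have "\<dots> = (P ^^ N) (\<lambda>x. \<rho> ^ j * (f' x - g' x)) x"
        using lin[OF bdd_meas_Pn[OF b(1)] bdd_meas_Pn[OF b(2)]] eq by simp
      also have "\<dots> = (P ^^ N) (\<lambda>x. \<rho> ^ j * f' x + (- (\<rho> ^ j)) * g' x) x" by (simp add: algebra_simps)
      also have "\<dots> = \<rho> ^ j * ((P ^^ N) f' x - (P ^^ N) g' x)"
        using Pn_lin[OF b(3,4), of N "\<rho> ^ j" "- (\<rho> ^ j)"] by (simp add: algebra_simps)
      also have "\<dots> = \<rho> ^ Suc j * (?R f' x - ?R g' x)" using \<rho> by (simp add: field_simps)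
      finally show ?thesis .
    qed
    moreover have "dens K (?R f')" "dens K (?R g')" using R[OF f'] R[OF g'] unfolding \<rho>_def .
    ultimately show ?case by blast
  qed
  then show ?thesis using that[OF *(1,2) \<rho>] by blast
qed

section \<open>Exponential decay and the Poisson equation\<close>

definition reg :: "('a \<Rightarrow> real) \<Rightarrow> real \<Rightarrow> bool" where
  "reg f K \<longleftrightarrow> bdd_meas M f \<and> (AE x in M. \<bar>f x\<bar> \<le> K) \<and> Lip f K"

text \<open>For g of mean zero, g / F + 1 is a density of the class because K \<ge> 2; it is coupled
  with the constant density 1. Iterates between two multiples of N are handled by the Lasota-Yorke
  inequality.\<close>

lemma spectral_gap:
  obtains C \<rho> where "0 < C" "0 < \<rho>" "\<rho> < 1"
    "\<And>g F n. reg g F \<Longrightarrow> 0 < F \<Longrightarrow> (\<integral>x. g x \<partial>M) = 0 \<Longrightarrow> reg ((P ^^ n) g) (C * F * \<rho> ^ n)"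
proof -
  obtain K N q where K: "2 \<le> K" and N: "1 \<le> N" and q: "0 < q" "q < 1"
    and contr: "\<And>f g j. dens K f \<Longrightarrow> dens K g \<Longrightarrow>
      \<exists>f' g'. dens K f' \<and> dens K g' \<and> (\<forall>x. (P ^^ (j * N)) f x - (P ^^ (j * N)) g x = q ^ j * (f' x - g' x))"
    by (rule dens_contraction, rule that)
  define \<rho> where "\<rho> = root N q"
  have \<rho>: "0 < \<rho>" "\<rho> < 1" "\<rho> ^ N = q" unfolding \<rho>_def using N q by auto
  define C where "C = (LY_const + 2) * K / q"
  have C: "0 < C" unfolding C_def using LY_const_pos K q by simp
  \<comment> \<open>Rounding n down to a multiple of N loses less than N steps, hence at most one
    factor q; this is the 1 / q in C.\<close>
  have qj: "q ^ (n div N) \<le> \<rho> ^ n / q" for n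
  proof -
    have "q * q ^ (n div N) = \<rho> ^ (N + N * (n div N))" unfolding \<rho>(3)[symmetric] by (simp add: power_add power_mult)
    also have "\<dots> \<le> \<rho> ^ n"
    proof (rule power_decreasing)
      have "n = N * (n div N) + n mod N" by simp
      moreover have "n mod N < N" using N by simp
      ultimately show "n \<le> N + N * (n div N)" by linarith
    qed (use \<rho> in auto)
    finally show ?thesis using q by (simp add: field_simps)
  qed
  have "reg ((P ^^ n) g) (C * F * \<rho> ^ n)" if g: "reg g F" and F: "0 < F" and Ig: "(\<integral>x. g x \<partial>M) = 0" for g F n
  proof -
    have bg: "bdd_meas M g" and gF: "AE x in M. \<bar>g x\<bar> \<le> F" and Lg: "Lip g F" using g unfolding reg_def by auto
    let ?f1 = "\<lambda>x. 1 / F * g x + 1 * 1"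
    have bf1: "bdd_meas M ?f1" by (intro bdd_meas_intros bg)
    have f1: "dens K ?f1" unfolding dens_def
    proof (intro conjI bf1)
      show "AE x in M. 0 \<le> ?f1 x \<and> ?f1 x \<le> K"
        using gF
      proof eventually_elim
        fix x assume "\<bar>g x\<bar> \<le> F"
        then have "\<bar>1 / F * g x\<bar> \<le> 1" using F by (simp add: abs_mult)
        then show "0 \<le> ?f1 x \<and> ?f1 x \<le> K" using K unfolding abs_le_iff by linarith
      qed
      have "Lip ?f1 (\<bar>1 / F\<bar> * F + \<bar>1\<bar> * 0)" by (rule Lip_lin[OF Lg Lip_const])
      then show "Lip ?f1 K" by (rule Lip_mono) (use F K in auto)
      show "(\<integral>x. ?f1 x \<partial>M) = 1" using integrable_bdd_meas[OF bg] Ig by (simp add: prob_space)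
    qed
    have f2: "dens K (\<lambda>x. 1)" unfolding dens_def using K Lip_mono[OF Lip_const, of K 1]
      by (auto intro: bdd_meas_const simp: prob_space)
    let ?j = "n div N" and ?i = "n mod N"
    obtain f' g' where f': "dens K f'" and g': "dens K g'"
      and eq: "\<And>x. (P ^^ (?j * N)) ?f1 x - (P ^^ (?j * N)) (\<lambda>x. 1) x = q ^ ?j * (f' x - g' x)"
      using contr[OF f1 f2] by metis
    let ?u = "\<lambda>x. F * q ^ ?j * f' x + (- (F * q ^ ?j)) * g' x"
    have b: "bdd_meas M f'" "bdd_meas M g'" and K': "AE x in M. 0 \<le> f' x \<and> f' x \<le> K" "AE x in M. 0 \<le> g' x \<and> g' x \<le> K"
      and L': "Lip f' K" "Lip g' K" using f' g' unfolding dens_def by auto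
    have Fq: "0 < F * q ^ ?j" using F q by simp
    have bu: "bdd_meas M ?u" by (intro bdd_meas_intros b)
    have uK: "AE x in M. \<bar>?u x\<bar> \<le> F * q ^ ?j * K"
      using K'
    proof eventually_elim
      fix x assume "0 \<le> f' x \<and> f' x \<le> K" "0 \<le> g' x \<and> g' x \<le> K"
      then have "\<bar>f' x - g' x\<bar> \<le> K" by auto
      then have "F * q ^ ?j * \<bar>f' x - g' x\<bar> \<le> F * q ^ ?j * K" using Fq by (intro mult_left_mono) auto
      moreover have "\<bar>?u x\<bar> = F * q ^ ?j * \<bar>f' x - g' x\<bar>"
      proof -
        have "?u x = (F * q ^ ?j) * (f' x - g' x)" by (simp add: algebra_simps)
        then show ?thesis by (simp only: abs_mult[of "F * q ^ ?j"] abs_of_pos[OF Fq])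
      qed
      ultimately show "\<bar>?u x\<bar> \<le> F * q ^ ?j * K" by simp
    qed
    have Lu: "Lip ?u (2 * (F * q ^ ?j) * K)"
      using Lip_lin[OF L', of "F * q ^ ?j" "- (F * q ^ ?j)"] Fq F q by (simp add: algebra_simps abs_mult)
    have Pu: "(P ^^ n) g = (P ^^ ?i) ?u"
    proof -
      have "n = ?i + ?j * N" by simp
      then have "(P ^^ n) g = (P ^^ ?i) ((P ^^ (?j * N)) g)" by (metis comp_apply funpow_add)
      also have "(P ^^ (?j * N)) g = (P ^^ (?j * N)) (\<lambda>x. F * ?f1 x + (- F) * 1)"
        using F by (simp add: field_simps)
      also have "\<dots> = (\<lambda>x. F * (P ^^ (?j * N)) ?f1 x + (- F) * (P ^^ (?j * N)) (\<lambda>x. 1) x)"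
        by (rule Pn_lin[OF bf1 bdd_meas_const])
      also have "\<dots> = (\<lambda>x. F * ((P ^^ (?j * N)) ?f1 x - (P ^^ (?j * N)) (\<lambda>x. 1) x))"
        by (simp add: right_diff_distrib)
      also have "\<dots> = ?u" unfolding eq by (simp add: algebra_simps)
      finally show ?thesis .
    qed
    have nn: "0 \<le> F * q ^ ?j * K" using Fq K by simp
    have le: "(LY_const + 2) * K * (F * q ^ ?j) \<le> C * F * \<rho> ^ n"
    proof -
      have "(LY_const + 2) * K * F * q ^ ?j \<le> (LY_const + 2) * K * F * (\<rho> ^ n / q)"
        using qj[of n] LY_const_pos K F by (intro mult_left_mono) auto
      then show ?thesis unfolding C_def by (simp add: mult_ac)
    qed
    have "AE x in M. \<bar>(P ^^ n) g x\<bar> \<le> C * F * \<rho> ^ n"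
    proof -
      have le2: "F * q ^ ?j * K \<le> (LY_const + 2) * K * (F * q ^ ?j)"
        using mult_right_mono[of 1 "LY_const + 2" "F * q ^ ?j * K"] LY_const_pos nn by (simp add: mult_ac)
      show ?thesis
        unfolding Pu using Pn_abs_bound[OF bu uK, of ?i] by eventually_elim (use le le2 in linarith)
    qed
    moreover have "Lip ((P ^^ n) g) (C * F * \<rho> ^ n)"
    proof (rule Lip_mono)
      have nn2: "0 \<le> 2 * (F * q ^ ?j) * K" using nn by (simp add: mult_ac)
      show "Lip ((P ^^ n) g) (LY_const * (F * q ^ ?j * K) + r ^ ?i * (2 * (F * q ^ ?j) * K))"
        unfolding Pu by (rule Lip_Pn[OF bu Lu uK nn2 nn])
      have "r ^ ?i * (2 * (F * q ^ ?j) * K) \<le> 1 * (2 * (F * q ^ ?j) * K)"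
        using r_pos r_less_1 nn2 by (intro mult_right_mono power_le_one) auto
      then show "LY_const * (F * q ^ ?j * K) + r ^ ?i * (2 * (F * q ^ ?j) * K) \<le> C * F * \<rho> ^ n"
        using le by (simp add: algebra_simps)
    qed
    ultimately show ?thesis unfolding reg_def using bdd_meas_Pn[OF bg] by simp
  qed
  then show ?thesis using that[OF C \<rho>(1,2)] by blast
qed

text \<open>The solution is the Neumann series of P^n g, whose terms have geometrically decreasing
  norms. The equation is stated by duality, as g is only determined almost everywhere.\<close>

lemma poisson_equation:
  obtains C where "1 \<le> C"
    "\<And>g F. reg g F \<Longrightarrow> 0 < F \<Longrightarrow> (\<integral>x. g x \<partial>M) = 0 \<Longrightarrow>
      \<exists>H. reg H (C * F) \<and> (\<forall>G. bdd_meas M G \<longrightarrow> (\<integral>x. g x * G x \<partial>M) = (\<integral>x. H x * G x \<partial>M) - (\<integral>x. H x * G (T x) \<partial>M))"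
proof -
  obtain C \<rho> where C: "0 < C" and \<rho>: "0 < \<rho>" "\<rho> < 1"
    and gap: "\<And>g F n. reg g F \<Longrightarrow> 0 < F \<Longrightarrow> (\<integral>x. g x \<partial>M) = 0 \<Longrightarrow> reg ((P ^^ n) g) (C * F * \<rho> ^ n)"
    by (rule spectral_gap, rule that)
  define C' where "C' = max 1 (C / (1 - \<rho>))"
  have "\<exists>H. reg H (C' * F) \<and> (\<forall>G. bdd_meas M G \<longrightarrow> (\<integral>x. g x * G x \<partial>M) = (\<integral>x. H x * G x \<partial>M) - (\<integral>x. H x * G (T x) \<partial>M))"
    if g: "reg g F" and F: "0 < F" and Ig: "(\<integral>x. g x \<partial>M) = 0" for g F
  proof -
    define p where "p n = (P ^^ n) g" for n
    define e where "e n = C * F * \<rho> ^ n" for n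
    have rp: "reg (p n) (e n)" for n unfolding p_def e_def by (rule gap[OF g F Ig])
    have bg: "bdd_meas M g" using g unfolding reg_def by simp
    have bp: "bdd_meas M (p n)" for n using rp[of n] unfolding reg_def by simp
    note [measurable] = bp[THEN bdd_measD]
    have se: "summable e" unfolding e_def using \<rho> by (intro summable_mult summable_geometric) auto
    have sum_e: "(\<Sum>n. e n) = C / (1 - \<rho>) * F"
      unfolding e_def using \<rho> by (simp add: suminf_mult suminf_geometric summable_geometric)
    have e0: "0 \<le> e n" for n unfolding e_def using C F \<rho> by simp
    have CF: "(\<Sum>n. e n) \<le> C' * F" unfolding sum_e C'_def using F by (intro mult_right_mono) auto
    \<comment> \<open>On W all almost sure bounds hold simultaneously, so the series converges at
      each of its points; the value 0 elsewhere makes H bounded everywhere.\<close>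
    define W where "W = {x \<in> space M. \<forall>n. \<bar>p n x\<bar> \<le> e n}"
    have W[measurable]: "W \<in> sets M" unfolding W_def by measurable
    have AEW: "AE x in M. x \<in> W"
    proof -
      have "AE x in M. \<forall>n. \<bar>p n x\<bar> \<le> e n" unfolding AE_all_countable using rp unfolding reg_def by blast
      then show ?thesis using AE_space by eventually_elim (simp add: W_def)
    qed
    have sp: "summable (\<lambda>n. p n x)" "summable (\<lambda>n. \<bar>p n x\<bar>)" if "x \<in> W" for x
    proof -
      show "summable (\<lambda>n. \<bar>p n x\<bar>)"
        using that by (intro summable_comparison_test[OF _ se]) (auto simp: W_def)
      then show "summable (\<lambda>n. p n x)" by (rule summable_rabs_cancel)
    qed
    define H where "H x = indicator W x * (\<Sum>n. p n x)" for x
    have absH: "\<bar>H x\<bar> \<le> C' * F" for x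
    proof (cases "x \<in> W")
      case True
      have "\<bar>\<Sum>n. p n x\<bar> \<le> (\<Sum>n. \<bar>p n x\<bar>)" by (rule summable_rabs[OF sp(2)[OF True]])
      also have "\<dots> \<le> (\<Sum>n. e n)" using True by (intro suminf_le sp se) (auto simp: W_def)
      finally show ?thesis using True CF by (simp add: H_def)
    next
      case False
      have "0 \<le> (\<Sum>n. e n)" by (rule suminf_nonneg[OF se e0])
      then show ?thesis using False CF by (simp add: H_def)
    qed
    have bH: "bdd_meas M H"
    proof (rule bdd_measI[OF _ absH])
      show "H \<in> borel_measurable M" unfolding H_def by measurable
    qed
    have "Lip H (C' * F)"
    proof -
      have "\<exists>Z. \<forall>n. Z n \<in> null_sets M \<and> (\<forall>b\<in>\<beta>. \<forall>x\<in>b - Z n. \<forall>y\<in>b - Z n. \<bar>p n x - p n y\<bar> \<le> e n * d x y)"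
      proof (rule choice, rule allI)
        fix n
        have "Lip (p n) (e n)" using rp[of n] unfolding reg_def by blast
        then show "\<exists>Z. Z \<in> null_sets M \<and> (\<forall>b\<in>\<beta>. \<forall>x\<in>b - Z. \<forall>y\<in>b - Z. \<bar>p n x - p n y\<bar> \<le> e n * d x y)"
          unfolding Lip_def by blast
      qed
      then obtain Z where Z: "\<And>n. Z n \<in> null_sets M"
        "\<And>n b x y. b \<in> \<beta> \<Longrightarrow> x \<in> b - Z n \<Longrightarrow> y \<in> b - Z n \<Longrightarrow> \<bar>p n x - p n y\<bar> \<le> e n * d x y" by metis
      have nW: "space M - W \<in> null_sets M"
        using AEW by (subst AE_iff_null_sets) (auto elim: eventually_mono)
      show ?thesis
      proof (rule LipI)
        show "(\<Union>n. Z n) \<union> (space M - W) \<in> null_sets M" using Z nW by (intro null_sets.Un null_sets_UN)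
        fix b x y assume *: "b \<in> \<beta>" "x \<in> b - ((\<Union>n. Z n) \<union> (space M - W))" "y \<in> b - ((\<Union>n. Z n) \<union> (space M - W))"
        then have xW: "x \<in> W" and yW: "y \<in> W" using \<beta>_space by auto
        have le: "\<bar>p n x - p n y\<bar> \<le> e n * d x y" for n using Z(2)[of b x n y] * by auto
        have s: "summable (\<lambda>n. e n * d x y)" by (rule summable_mult2[OF se])
        have s': "summable (\<lambda>n. \<bar>p n x - p n y\<bar>)"
          using le by (intro summable_comparison_test[OF _ s]) auto
        have "\<bar>H x - H y\<bar> = \<bar>\<Sum>n. p n x - p n y\<bar>"
          unfolding H_def using xW yW suminf_diff[OF sp(1)[OF xW] sp(1)[OF yW]] by simp
        also have "\<dots> \<le> (\<Sum>n. \<bar>p n x - p n y\<bar>)" by (rule summable_rabs[OF s'])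
        also have "\<dots> \<le> (\<Sum>n. e n * d x y)" by (rule suminf_le[OF le s' s])
        also have "\<dots> = (\<Sum>n. e n) * d x y" by (rule suminf_mult2[OF se, symmetric])
        also have "\<dots> \<le> C' * F * d x y" using CF d_nonneg by (intro mult_right_mono) auto
        finally show "\<bar>H x - H y\<bar> \<le> C' * F * d x y" .
      qed
    qed
    then have "reg H (C' * F)" unfolding reg_def using bH absH by simp
    moreover have "(\<integral>x. g x * G x \<partial>M) = (\<integral>x. H x * G x \<partial>M) - (\<integral>x. H x * G (T x) \<partial>M)" if G: "bdd_meas M G" for G
    proof -
      have conv: "(\<lambda>n. \<integral>x. (\<Sum>j<n. p j x) * G' x \<partial>M) \<longlonglongrightarrow> (\<integral>x. H x * G' x \<partial>M)" if G': "bdd_meas M G'" for G'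
      proof -
        obtain L where L: "\<And>x. \<bar>G' x\<bar> \<le> L" using G' unfolding bdd_meas_def by auto
        note [measurable] = bdd_measD[OF G'] bdd_measD[OF bH]
        show ?thesis
        proof (rule integral_dominated_convergence[where w = "\<lambda>_. (\<Sum>n. e n) * L"])
          show "AE x in M. (\<lambda>n. (\<Sum>j<n. p j x) * G' x) \<longlonglongrightarrow> H x * G' x"
            using AEW
          proof eventually_elim
            fix x assume x: "x \<in> W"
            then have "(\<lambda>n. \<Sum>j<n. p j x) \<longlonglongrightarrow> H x" using summable_LIMSEQ[OF sp(1)[OF x]] by (simp add: H_def)
            then show "(\<lambda>n. (\<Sum>j<n. p j x) * G' x) \<longlonglongrightarrow> H x * G' x" by (intro tendsto_intros)
          qed
          show "AE x in M. norm ((\<Sum>j<n. p j x) * G' x) \<le> (\<Sum>n. e n) * L" for n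
            using AEW
          proof eventually_elim
            fix x assume x: "x \<in> W"
            have "\<bar>\<Sum>j<n. p j x\<bar> \<le> (\<Sum>j<n. \<bar>p j x\<bar>)" by (rule sum_abs)
            also have "\<dots> \<le> (\<Sum>j<n. e j)" using x by (intro sum_mono) (auto simp: W_def)
            also have "\<dots> \<le> (\<Sum>n. e n)" by (rule sum_le_suminf[OF se]) (use e0 in auto)
            finally show "norm ((\<Sum>j<n. p j x) * G' x) \<le> (\<Sum>n. e n) * L"
              using L[of x] suminf_nonneg[OF se e0] by (auto simp: abs_mult intro!: mult_mono)
          qed
        qed auto
      qed
      have p0: "(\<lambda>n. \<integral>x. p n x * G x \<partial>M) \<longlonglongrightarrow> 0"
      proof -
        obtain L where L: "\<And>x. \<bar>G x\<bar> \<le> L" using G unfolding bdd_meas_def by auto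
        have nb: "norm (\<integral>x. p n x * G x \<partial>M) \<le> e n * L" for n
        proof (rule norm_integral_le_AE)
          show "integrable M (\<lambda>x. p n x * G x)" by (intro integrable_bdd_meas bdd_meas_mult bp G)
          show "AE x in M. norm (p n x * G x) \<le> e n * L"
            using AEW by eventually_elim (use L e0 in \<open>auto simp: W_def abs_mult intro!: mult_mono\<close>)
        qed
        have e0': "(\<lambda>n. e n * L) \<longlonglongrightarrow> 0" using summable_LIMSEQ_zero[OF se] by (rule tendsto_mult_left_zero)
        show ?thesis by (rule Lim_null_comparison[OF always_eventually[OF allI[OF nb]] e0'])
      qed
      have step: "(\<integral>x. p j x * G (T x) \<partial>M) = (\<integral>x. p (Suc j) x * G x \<partial>M)" for j
        using P_duality[OF bp[of j] G] by (simp add: p_def)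
      have sumi: "(\<integral>x. (\<Sum>j<n. p j x) * G' x \<partial>M) = (\<Sum>j<n. \<integral>x. p j x * G' x \<partial>M)" if "bdd_meas M G'" for n G'
        unfolding sum_distrib_right
        by (rule Bochner_Integration.integral_sum) (intro integrable_bdd_meas bdd_meas_mult bp that)
      \<comment> \<open>Composing G with T raises the index of each iterate by one, so the partial
        sums telescope to g - P^n g.\<close>
      have "(\<integral>x. (\<Sum>j<n. p j x) * G x \<partial>M) - (\<integral>x. (\<Sum>j<n. p j x) * G (T x) \<partial>M)
          = (\<integral>x. g x * G x \<partial>M) - (\<integral>x. p n x * G x \<partial>M)" for n
      proof -
        have "(\<Sum>j<n. \<integral>x. p j x * G x \<partial>M) - (\<Sum>j<n. \<integral>x. p (Suc j) x * G x \<partial>M)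
            = (\<integral>x. p 0 x * G x \<partial>M) - (\<integral>x. p n x * G x \<partial>M)"
          unfolding sum_subtractf[symmetric] by (rule sum_lessThan_telescope')
        then show ?thesis unfolding sumi[OF G] sumi[OF bdd_meas_T[OF G]] step by (simp add: p_def)
      qed
      moreover have "(\<lambda>n. (\<integral>x. (\<Sum>j<n. p j x) * G x \<partial>M) - (\<integral>x. (\<Sum>j<n. p j x) * G (T x) \<partial>M))
          \<longlonglongrightarrow> (\<integral>x. H x * G x \<partial>M) - (\<integral>x. H x * G (T x) \<partial>M)"
        by (intro tendsto_diff conv G bdd_meas_T)
      moreover have "(\<lambda>n. (\<integral>x. g x * G x \<partial>M) - (\<integral>x. p n x * G x \<partial>M)) \<longlonglongrightarrow> (\<integral>x. g x * G x \<partial>M) - 0"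
        by (intro tendsto_diff tendsto_const p0)
      ultimately show ?thesis using LIMSEQ_unique by fastforce
    qed
    ultimately show ?thesis by blast
  qed
  moreover have "1 \<le> C'" unfolding C'_def by simp
  ultimately show ?thesis using that by blast
qed

end

section \<open>The central limit theorem\<close>

context gibbs_markov_mixing
begin

section \<open>Martingale decomposition with control of the norm\<close>

lemma reg_mono: "reg f K \<Longrightarrow> K \<le> K' \<Longrightarrow> reg f K'"
  unfolding reg_def by (auto intro: Lip_mono elim!: eventually_mono)

lemma reg_const: "reg (\<lambda>x. c) \<bar>c\<bar>"
  unfolding reg_def using Lip_mono[OF Lip_const, of "\<bar>c\<bar>" c] by (simp add: bdd_meas_const)

lemma reg_lin:
  assumes f: "reg f K" and g: "reg g K'"
  shows "reg (\<lambda>x. s * f x + t * g x) (\<bar>s\<bar> * K + \<bar>t\<bar> * K')"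
  unfolding reg_def
proof (intro conjI)
  show "bdd_meas M (\<lambda>x. s * f x + t * g x)" using f g unfolding reg_def by (intro bdd_meas_intros) auto
  show "Lip (\<lambda>x. s * f x + t * g x) (\<bar>s\<bar> * K + \<bar>t\<bar> * K')" using f g unfolding reg_def by (intro Lip_lin) auto
  have "AE x in M. \<bar>f x\<bar> \<le> K" "AE x in M. \<bar>g x\<bar> \<le> K'" using f g unfolding reg_def by auto
  then show "AE x in M. \<bar>s * f x + t * g x\<bar> \<le> \<bar>s\<bar> * K + \<bar>t\<bar> * K'"
  proof eventually_elim
    fix x assume "\<bar>f x\<bar> \<le> K" "\<bar>g x\<bar> \<le> K'"
    then have "\<bar>s * f x\<bar> \<le> \<bar>s\<bar> * K" "\<bar>t * g x\<bar> \<le> \<bar>t\<bar> * K'" unfolding abs_mult by (simp_all add: mult_left_mono)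
    then show "\<bar>s * f x + t * g x\<bar> \<le> \<bar>s\<bar> * K + \<bar>t\<bar> * K'" by linarith
  qed
qed

lemma reg_power2:
  assumes f: "reg f K" and K: "0 \<le> K"
  shows "reg (\<lambda>x. (f x)\<^sup>2) (2 * K\<^sup>2)"
  unfolding reg_def
proof (intro conjI)
  have b: "bdd_meas M f" "AE x in M. \<bar>f x\<bar> \<le> K" "Lip f K" using f unfolding reg_def by auto
  show "bdd_meas M (\<lambda>x. (f x)\<^sup>2)" by (rule bdd_meas_power2[OF b(1)])
  show "Lip (\<lambda>x. (f x)\<^sup>2) (2 * K\<^sup>2)"
    using Lip_mult[OF b(3,2) b(3,2) K K] by (simp add: power2_eq_square)
  show "AE x in M. \<bar>(f x)\<^sup>2\<bar> \<le> 2 * K\<^sup>2"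
    using b(2)
  proof eventually_elim
    fix x assume "\<bar>f x\<bar> \<le> K"
    then have "\<bar>f x\<bar>\<^sup>2 \<le> K\<^sup>2" by (intro power_mono) auto
    moreover have "0 \<le> K\<^sup>2" by simp
    ultimately have "(f x)\<^sup>2 \<le> 2 * K\<^sup>2" by (simp only: power2_abs)
    then show "\<bar>(f x)\<^sup>2\<bar> \<le> 2 * K\<^sup>2" by simp
  qed
qed

lemma reg_P:
  assumes f: "reg f K" and K: "0 \<le> K"
  shows "reg (P f) ((dist_const + 1) * K)"
  unfolding reg_def
proof (intro conjI)
  have b: "bdd_meas M f" "AE x in M. \<bar>f x\<bar> \<le> K" "Lip f K" using f unfolding reg_def by auto
  have K': "K \<le> (dist_const + 1) * K" using dist_const_pos K by (simp add: distrib_right)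
  show "bdd_meas M (P f)" by (rule bdd_meas_P[OF b(1)])
  show "AE x in M. \<bar>P f x\<bar> \<le> (dist_const + 1) * K"
    using Pn_abs_bound[OF b(1,2), of 1] by simp (auto elim!: eventually_mono intro: order_trans[OF _ K'])
  have "r * K \<le> 1 * K" using r_less_1 K by (intro mult_right_mono) auto
  then show "Lip (P f) ((dist_const + 1) * K)"
    by (intro Lip_mono[OF Lip_P[OF b(1,3,2) K]]) (simp add: distrib_right)
qed

text \<open>If w solves w - P w = f, then h = P w and m = w - h \<circ> T satisfy f = m - h + h
  \<circ> T, and P m = P w - h = 0 because P (h \<circ> T) = h.\<close>

lemma martingale_decomposition:
  obtains C where "1 \<le> C"
    "\<And>f F. reg f F \<Longrightarrow> 0 < F \<Longrightarrow> (\<integral>x. f x \<partial>M) = 0 \<Longrightarrow>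
      \<exists>m h H. reg h (C * F) \<and> martingale_approx M T f m h H (C * F)"
proof -
  obtain C0 where C0: "1 \<le> C0" and poisson: "\<And>g F. reg g F \<Longrightarrow> 0 < F \<Longrightarrow> (\<integral>x. g x \<partial>M) = 0 \<Longrightarrow>
      \<exists>H. reg H (C0 * F) \<and> (\<forall>G. bdd_meas M G \<longrightarrow> (\<integral>x. g x * G x \<partial>M) = (\<integral>x. H x * G x \<partial>M) - (\<integral>x. H x * G (T x) \<partial>M))"
    by (rule poisson_equation, rule that)
  define D where "D = dist_const + 1"
  \<comment> \<open>The two summands bound P (w^2) and h^2. Centring doubles Q, solving the equation
    adds a factor C0, and C is large enough for m, h and H at once; since C \<ge> 1, 2 C0 Q \<le> C
    \<le> C^2 suffices for H.\<close>
  define Q where "Q = 2 * D * C0\<^sup>2 + 2 * D\<^sup>2 * C0\<^sup>2"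
  define C where "C = C0 + D * C0 + 2 * C0 * Q"
  have D: "1 \<le> D" unfolding D_def using dist_const_pos by simp
  have Q: "0 < Q" unfolding Q_def using D C0 by (intro add_pos_pos) simp_all
  have DC: "0 < D * C0" "0 < 2 * C0 * Q" using D C0 Q by simp_all
  have C: "1 \<le> C" "C0 + D * C0 \<le> C" "D * C0 \<le> C" "2 * C0 * Q \<le> C" unfolding C_def using C0 DC by linarith+
  have "\<exists>m h H. reg h (C * F) \<and> martingale_approx M T f m h H (C * F)"
    if f: "reg f F" and F: "0 < F" and If: "(\<integral>x. f x \<partial>M) = 0" for f F
  proof -
    obtain w where w: "reg w (C0 * F)"
      and fw: "\<And>G. bdd_meas M G \<Longrightarrow> (\<integral>x. f x * G x \<partial>M) = (\<integral>x. w x * G x \<partial>M) - (\<integral>x. w x * G (T x) \<partial>M)"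
      using poisson[OF f F If] by blast
    have CF: "0 \<le> C0 * F" using C0 F by simp
    define h where "h = P w"
    define m where "m x = w x - h (T x)" for x
    have h: "reg h (D * C0 * F)" unfolding h_def D_def using reg_P[OF w CF] by (simp add: mult.assoc)
    have bf: "bdd_meas M f" and bw: "bdd_meas M w" and bh: "bdd_meas M h" using f w h unfolding reg_def by auto
    have bm: "bdd_meas M m" unfolding m_def by (intro bdd_meas_diff bw bdd_meas_T bh)
    note it = integrable_bdd_meas and bi = bdd_meas_intros bdd_meas_T bdd_meas_P bf bw bh bm
    have dual_w: "(\<integral>x. w x * G (T x) \<partial>M) = (\<integral>x. h x * G x \<partial>M)" if "bdd_meas M G" for G
      unfolding h_def using P_duality[OF bw that] by simp
    have mF: "AE x in M. \<bar>m x\<bar> \<le> C * F"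
    proof -
      have "AE x in M. \<bar>w x\<bar> \<le> C0 * F" "AE x in M. \<bar>h x\<bar> \<le> D * C0 * F" using w h unfolding reg_def by auto
      from this(1) AE_Tn[OF this(2), of 1] show ?thesis
      proof eventually_elim
        fix x assume "\<bar>w x\<bar> \<le> C0 * F" "\<bar>h ((T ^^ 1) x)\<bar> \<le> D * C0 * F"
        then have "\<bar>m x\<bar> \<le> (C0 + D * C0) * F" unfolding m_def by (simp add: distrib_right)
        also have "\<dots> \<le> C * F" using C F by (intro mult_right_mono) auto
        finally show "\<bar>m x\<bar> \<le> C * F" .
      qed
    qed
    have coh: "AE x in M. f x = w x - h x"
    proof -
      have eq: "(\<integral>x. f x * indicator E x \<partial>M) = (\<integral>x. (w x - h x) * indicator E x \<partial>M)" if E: "E \<in> sets M" for E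
      proof -
        have "(\<integral>x. (w x - h x) * indicator E x \<partial>M) = (\<integral>x. w x * indicator E x - h x * indicator E x \<partial>M)"
          by (simp only: left_diff_distrib)
        also have "\<dots> = (\<integral>x. w x * indicator E x \<partial>M) - (\<integral>x. h x * indicator E x \<partial>M)"
          by (rule Bochner_Integration.integral_diff; intro it bi E)
        finally show ?thesis using fw[OF bdd_meas_indicator[OF E]] dual_w[OF bdd_meas_indicator[OF E]] by simp
      qed
      have bwh: "bdd_meas M (\<lambda>x. w x - h x)" by (intro bi)
      have "AE x in M. f x \<le> w x - h x"
        by (rule AE_le_of_set_integral_le[OF bf bwh]) (simp only: eq order_refl)
      moreover have "AE x in M. w x - h x \<le> f x"
        by (rule AE_le_of_set_integral_le[OF bwh bf]) (simp only: eq order_refl)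
      ultimately show ?thesis by eventually_elim simp
    qed
    have m0: "(\<integral>x. m x * g (T x) \<partial>M) = 0" if g: "bdd_meas M g" for g
    proof -
      have "(\<integral>x. m x * g (T x) \<partial>M) = (\<integral>x. w x * g (T x) - h (T x) * g (T x) \<partial>M)"
        unfolding m_def by (simp only: left_diff_distrib)
      also have "\<dots> = (\<integral>x. w x * g (T x) \<partial>M) - (\<integral>x. h (T x) * g (T x) \<partial>M)"
        by (rule Bochner_Integration.integral_diff; intro it bi g)
      also have "(\<integral>x. h (T x) * g (T x) \<partial>M) = (\<integral>x. h x * g x \<partial>M)"
        by (rule integral_T[of "\<lambda>x. h x * g x"]) (intro bdd_measD bdd_meas_mult bh g)
      finally show ?thesis using dual_w[OF g] by simp
    qed
    \<comment> \<open>This is P (m^2): the cross term and the square of h \<circ> T give -2 h^2 +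
      h^2. The formula avoids estimating the variation of m, which contains h \<circ> T, and shows q
      to be as regular as P (w^2) and h^2.\<close>
    define q where "q x = P (\<lambda>x. (w x)\<^sup>2) x - (h x)\<^sup>2" for x
    have bq: "bdd_meas M q" unfolding q_def by (intro bi)
    have m2: "(\<integral>x. (m x)\<^sup>2 * g (T x) \<partial>M) = (\<integral>x. q x * g x \<partial>M)" if g: "bdd_meas M g" for g
    proof -
      have "(\<integral>x. (m x)\<^sup>2 * g (T x) \<partial>M)
          = (\<integral>x. ((w x)\<^sup>2 * g (T x) - 2 * (w x * (h (T x) * g (T x)))) + (h (T x))\<^sup>2 * g (T x) \<partial>M)"
        unfolding m_def by (intro Bochner_Integration.integral_cong refl) (simp add: power2_eq_square algebra_simps)
      also have "\<dots> = (\<integral>x. (w x)\<^sup>2 * g (T x) - 2 * (w x * (h (T x) * g (T x))) \<partial>M) + (\<integral>x. (h (T x))\<^sup>2 * g (T x) \<partial>M)"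
        by (rule Bochner_Integration.integral_add; intro it bi g)
      also have "(\<integral>x. (w x)\<^sup>2 * g (T x) - 2 * (w x * (h (T x) * g (T x))) \<partial>M)
          = (\<integral>x. (w x)\<^sup>2 * g (T x) \<partial>M) - (\<integral>x. 2 * (w x * (h (T x) * g (T x))) \<partial>M)"
        by (rule Bochner_Integration.integral_diff; intro it bi g)
      also have "(\<integral>x. (w x)\<^sup>2 * g (T x) \<partial>M) = (\<integral>x. P (\<lambda>x. (w x)\<^sup>2) x * g x \<partial>M)"
        by (rule P_duality[symmetric]; intro bi g)
      also have "(\<integral>x. 2 * (w x * (h (T x) * g (T x))) \<partial>M) = 2 * (\<integral>x. h x * (h x * g x) \<partial>M)"
        using dual_w[of "\<lambda>x. h x * g x"] bdd_meas_mult[OF bh g] by simp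
      also have "(\<integral>x. (h (T x))\<^sup>2 * g (T x) \<partial>M) = (\<integral>x. (h x)\<^sup>2 * g x \<partial>M)"
        by (rule integral_T[of "\<lambda>x. (h x)\<^sup>2 * g x"]) (intro bdd_measD bdd_meas_mult bdd_meas_power2 bh g)
      also have "(\<integral>x. P (\<lambda>x. (w x)\<^sup>2) x * g x \<partial>M) - 2 * (\<integral>x. h x * (h x * g x) \<partial>M) + (\<integral>x. (h x)\<^sup>2 * g x \<partial>M)
          = (\<integral>x. P (\<lambda>x. (w x)\<^sup>2) x * g x \<partial>M) - (\<integral>x. (h x)\<^sup>2 * g x \<partial>M)"
        by (simp add: power2_eq_square mult.assoc)
      also have "\<dots> = (\<integral>x. P (\<lambda>x. (w x)\<^sup>2) x * g x - (h x)\<^sup>2 * g x \<partial>M)"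
        by (rule Bochner_Integration.integral_diff[symmetric]; intro it bi g)
      finally show ?thesis unfolding q_def by (simp only: left_diff_distrib)
    qed
    define v where "v = (\<integral>y. (m y)\<^sup>2 \<partial>M)"
    have v: "v = (\<integral>x. q x \<partial>M)" unfolding v_def using m2[OF bdd_meas_const, of 1] by simp
    have rq: "reg q (Q * F\<^sup>2)"
    proof -
      have 1: "reg (P (\<lambda>x. (w x)\<^sup>2)) (D * (2 * (C0 * F)\<^sup>2))"
        unfolding D_def by (rule reg_P[OF reg_power2[OF w CF]]) simp
      have 2: "reg (\<lambda>x. (h x)\<^sup>2) (2 * (D * C0 * F)\<^sup>2)" by (rule reg_power2[OF h]) (use D C0 F in simp)
      show ?thesis
        using reg_lin[OF 1 2, of 1 "-1"] unfolding q_def Q_def by (simp add: power_mult_distrib algebra_simps)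
    qed
    have vQ: "\<bar>v\<bar> \<le> Q * F\<^sup>2"
    proof -
      show ?thesis unfolding v real_norm_def[symmetric]
        using rq by (intro norm_integral_le_AE it bq) (simp add: reg_def)
    qed
    let ?g = "\<lambda>x. 1 * q x + -1 * v"
    have rg: "reg ?g (2 * Q * F\<^sup>2)"
      by (rule reg_mono[OF reg_lin[OF rq reg_const]]) (use vQ in simp)
    have "(\<integral>x. ?g x \<partial>M) = 0" using v it[OF bq] by (simp add: prob_space)
    moreover have "0 < 2 * Q * F\<^sup>2" using Q F by simp
    ultimately obtain H where H: "reg H (C0 * (2 * Q * F\<^sup>2))"
      and gH: "\<And>G. bdd_meas M G \<Longrightarrow> (\<integral>x. ?g x * G x \<partial>M) = (\<integral>x. H x * G x \<partial>M) - (\<integral>x. H x * G (T x) \<partial>M)"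
      using poisson[OF rg] by blast
    have bH: "bdd_meas M H" using H unfolding reg_def by simp
    have HF: "AE x in M. \<bar>H x\<bar> \<le> (C * F)\<^sup>2"
    proof -
      have "C0 * (2 * Q * F\<^sup>2) = (2 * C0 * Q) * F\<^sup>2" by simp
      also have "\<dots> \<le> (C * C) * F\<^sup>2"
      proof (rule mult_right_mono)
        have "1 * C \<le> C * C" using C(1) by (intro mult_right_mono) auto
        then show "2 * C0 * Q \<le> C * C" using C(4) by linarith
      qed simp
      also have "\<dots> = (C * F)\<^sup>2" by (simp add: power2_eq_square)
      finally have le: "C0 * (2 * Q * F\<^sup>2) \<le> (C * F)\<^sup>2" .
      have "AE x in M. \<bar>H x\<bar> \<le> C0 * (2 * Q * F\<^sup>2)" using H unfolding reg_def by simp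
      then show ?thesis by eventually_elim (use le in linarith)
    qed
    have mH: "(\<integral>x. ((m x)\<^sup>2 + H x) * g (T x) \<partial>M) = (\<integral>x. (v + H x) * g x \<partial>M)" if g: "bdd_meas M g" for g
    proof -
      have "(\<integral>x. ((m x)\<^sup>2 + H x) * g (T x) \<partial>M) = (\<integral>x. (m x)\<^sup>2 * g (T x) + H x * g (T x) \<partial>M)"
        by (simp only: distrib_right)
      also have "\<dots> = (\<integral>x. (m x)\<^sup>2 * g (T x) \<partial>M) + (\<integral>x. H x * g (T x) \<partial>M)"
        by (rule Bochner_Integration.integral_add; intro it bi bH g)
      also have "\<dots> = (\<integral>x. q x * g x \<partial>M) + ((\<integral>x. H x * g x \<partial>M) - (\<integral>x. ?g x * g x \<partial>M))"
        using m2[OF g] gH[OF g] by simp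
      also have "(\<integral>x. ?g x * g x \<partial>M) = (\<integral>x. q x * g x - v * g x \<partial>M)" by (simp add: left_diff_distrib)
      also have "\<dots> = (\<integral>x. q x * g x \<partial>M) - (\<integral>x. v * g x \<partial>M)"
        by (rule Bochner_Integration.integral_diff; intro it bi bq g)
      also have "(\<integral>x. q x * g x \<partial>M) + ((\<integral>x. H x * g x \<partial>M) - ((\<integral>x. q x * g x \<partial>M) - (\<integral>x. v * g x \<partial>M)))
          = (\<integral>x. v * g x \<partial>M) + (\<integral>x. H x * g x \<partial>M)" by simp
      also have "\<dots> = (\<integral>x. v * g x + H x * g x \<partial>M)"
        by (rule Bochner_Integration.integral_add[symmetric]; intro it bi bH g)
      finally show ?thesis by (simp only: distrib_right)
    qed
    have hF: "reg h (C * F)" by (rule reg_mono[OF h]) (use C F in \<open>intro mult_right_mono, auto\<close>)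
    have "AE x in M. f x = m x - h x + h (T x)" using coh by eventually_elim (simp add: m_def)
    then have "martingale_approx M T f m h H (C * F)"
      using bdd_measD[OF bf] hF bm mF bH HF m0 mH unfolding v_def reg_def by unfold_locales auto
    then show ?thesis using hF by blast
  qed
  then show ?thesis using that[OF C(1)] by blast
qed

section \<open>The space L and regular real functions\<close>

text \<open>Places the corrector h in L, so that a degenerate variance contradicts the assumption
  that f is not a coboundary over L.\<close>

lemma lip_space_regI:
  assumes h: "reg h K"
  shows "(\<lambda>x. complex_of_real (h x)) \<in> lip_space M T \<alpha> r \<beta>"
proof -
  have bh: "bdd_meas M h" and hK: "AE x in M. \<bar>h x\<bar> \<le> K" and Lh: "Lip h K" using h unfolding reg_def by auto
  note [measurable] = bdd_measD[OF bh]
  have "esssup M (\<lambda>x. ennreal (cmod (complex_of_real (h x)))) \<le> ennreal K"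
    by (rule esssup_I) (use hK in \<open>auto elim!: eventually_mono intro!: ennreal_leI\<close>)
  moreover obtain N where N: "N \<in> null_sets M" "\<And>b x y. b \<in> \<beta> \<Longrightarrow> x \<in> b - N \<Longrightarrow> y \<in> b - N \<Longrightarrow> \<bar>h x - h y\<bar> \<le> K * d x y"
    using LipE[OF Lh] by metis
  have "lip_seminorm M T \<alpha> r \<beta> (\<lambda>x. complex_of_real (h x)) \<le> ennreal K"
    unfolding lip_seminorm_def
  proof (rule INF_lower2[OF N(1)], intro SUP_least)
    fix b p assume b: "b \<in> \<beta>" and p: "p \<in> {(x, y). x \<in> b - N \<and> y \<in> b - N \<and> x \<noteq> y}"
    obtain x y where xy: "p = (x, y)" "x \<in> b - N" "y \<in> b - N" using p by auto
    have le: "\<bar>h x - h y\<bar> \<le> K * d x y" by (rule N(2)[OF b xy(2,3)])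
    have "ennreal \<bar>h x - h y\<bar> / ennreal (d x y) \<le> ennreal K"
    \<comment> \<open>At distance 0 the numerator vanishes by the Lipschitz bound, and 0 / 0 = 0 in
      \<open>ennreal\<close>.\<close>
    proof (cases "d x y = 0")
      case True
      then show ?thesis using le by simp
    next
      case False
      then have pos: "0 < d x y" using d_nonneg[of x y] by simp
      then have "\<bar>h x - h y\<bar> / d x y \<le> K" using le by (simp add: field_simps)
      then show ?thesis using pos by (simp add: divide_ennreal ennreal_leI)
    qed
    then show "(case p of (x, y) \<Rightarrow> ennreal (cmod (complex_of_real (h x) - complex_of_real (h y))) / ennreal (d x y)) \<le> ennreal K"
      unfolding xy(1) by (simp flip: of_real_diff)
  qed
  ultimately have "lip_norm M T \<alpha> r \<beta> (\<lambda>x. complex_of_real (h x)) \<le> ennreal K + ennreal K"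
    unfolding lip_norm_def by (intro add_mono)
  also have "\<dots> < \<infinity>" by simp
  finally show ?thesis unfolding lip_space_def by simp
qed

text \<open>The strict inequality selects one null set from the infimum that defines the seminorm.
  Truncation at F turns the essential bound into a bound at every point without changing f almost
  everywhere.\<close>

lemma lip_space_regD:
  assumes f: "(\<lambda>x. complex_of_real (f x)) \<in> lip_space M T \<alpha> r \<beta>"
    and F: "enn2real (lip_norm M T \<alpha> r \<beta> (\<lambda>x. complex_of_real (f x))) < F"
  obtains f' where "reg f' F" "AE x in M. f' x = f x" "f \<in> borel_measurable M"
proof -
  let ?f = "\<lambda>x. complex_of_real (f x)"
  have fm: "?f \<in> borel_measurable M" and fin: "lip_norm M T \<alpha> r \<beta> ?f < \<infinity>"
    using f unfolding lip_space_def by auto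
  have "(\<lambda>x. Re (?f x)) \<in> borel_measurable M" using fm by measurable
  then have fm': "f \<in> borel_measurable M" by simp
  have F0: "0 < F" using F enn2real_nonneg by (rule le_less_trans[rotated])
  have less: "lip_norm M T \<alpha> r \<beta> ?f < ennreal F"
  proof -
    have "lip_norm M T \<alpha> r \<beta> ?f = ennreal (enn2real (lip_norm M T \<alpha> r \<beta> ?f))" using fin by simp
    also have "\<dots> < ennreal F" using F by (simp add: ennreal_less_iff)
    finally show ?thesis .
  qed
  have fF: "AE x in M. \<bar>f x\<bar> \<le> F"
    using esssup_AE[where f = "\<lambda>x. ennreal (cmod (?f x))"]
  proof eventually_elim
    fix x assume "ennreal (cmod (?f x)) \<le> esssup M (\<lambda>x. ennreal (cmod (?f x)))"
    also have "\<dots> \<le> lip_norm M T \<alpha> r \<beta> ?f" unfolding lip_norm_def by simp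
    also have "\<dots> \<le> ennreal F" using less by simp
    finally show "\<bar>f x\<bar> \<le> F" using F0 by simp
  qed
  have "lip_seminorm M T \<alpha> r \<beta> ?f \<le> lip_norm M T \<alpha> r \<beta> ?f" unfolding lip_norm_def by simp
  then have "lip_seminorm M T \<alpha> r \<beta> ?f < ennreal F" using less by (rule le_less_trans)
  then obtain N where N: "N \<in> null_sets M"
    and sup: "(SUP b\<in>\<beta>. SUP (x, y)\<in>{(x, y). x \<in> b - N \<and> y \<in> b - N \<and> x \<noteq> y}. ennreal (cmod (?f x - ?f y)) / ennreal (d x y)) < ennreal F"
    unfolding lip_seminorm_def INF_less_iff by blast
  have est: "\<bar>f x - f y\<bar> \<le> F * d x y" if b: "b \<in> \<beta>" "x \<in> b - N" "y \<in> b - N" for b x y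
  proof (cases "x = y")
    case False
    have "ennreal (cmod (?f x - ?f y)) / ennreal (d x y)
        \<le> (SUP (x, y)\<in>{(x, y). x \<in> b - N \<and> y \<in> b - N \<and> x \<noteq> y}. ennreal (cmod (?f x - ?f y)) / ennreal (d x y))"
      by (rule SUP_upper2[of "(x, y)"]) (use b False in auto)
    also have "\<dots> \<le> (SUP b\<in>\<beta>. SUP (x, y)\<in>{(x, y). x \<in> b - N \<and> y \<in> b - N \<and> x \<noteq> y}. ennreal (cmod (?f x - ?f y)) / ennreal (d x y))"
      using b(1) by (rule SUP_upper)
    also have "\<dots> < ennreal F" by (rule sup)
    finally have *: "ennreal \<bar>f x - f y\<bar> / ennreal (d x y) < ennreal F" by (simp flip: of_real_diff)
    show ?thesis
    proof (cases "d x y = 0")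
      case True
      then show ?thesis using * by (simp split: if_splits)
    next
      case False
      then have pos: "0 < d x y" using d_nonneg[of x y] by simp
      then have "\<bar>f x - f y\<bar> / d x y < F" using * by (simp add: divide_ennreal ennreal_less_iff)
      then show ?thesis using pos by (simp add: field_simps)
    qed
  qed (use F0 d_nonneg in simp)
  define f' where "f' x = (if \<bar>f x\<bar> \<le> F then f x else 0)" for x
  have eq: "AE x in M. f' x = f x" using fF by eventually_elim (simp add: f'_def)
  obtain N' where N': "N' \<in> null_sets M" "\<And>x. x \<in> space M - N' \<Longrightarrow> f' x = f x" using AE_null_set[OF eq] by metis
  have f'F: "\<bar>f' x\<bar> \<le> F" for x unfolding f'_def using F0 by simp
  have "bdd_meas M f'"
  proof (rule bdd_measI[OF _ f'F])
    note [measurable] = fm'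
    show "f' \<in> borel_measurable M" unfolding f'_def by measurable
  qed
  moreover have "Lip f' F"
  proof (rule LipI[of "N \<union> N'"])
    fix b x y assume *: "b \<in> \<beta>" "x \<in> b - (N \<union> N')" "y \<in> b - (N \<union> N')"
    then have "f' x = f x" "f' y = f y" using N'(2) \<beta>_space by blast+
    then show "\<bar>f' x - f' y\<bar> \<le> F * d x y" using est[of b x y] * by simp
  qed (use N N' in auto)
  ultimately have "reg f' F" unfolding reg_def using f'F by simp
  then show ?thesis using that eq fm' by blast
qed

abbreviation L_norm :: "('a \<Rightarrow> real) \<Rightarrow> real" where
  "L_norm f \<equiv> enn2real (lip_norm M T \<alpha> r \<beta> (\<lambda>x. complex_of_real (f x)))"

definition admissible :: "('a \<Rightarrow> real) \<Rightarrow> bool" where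
  "admissible f \<longleftrightarrow> (\<lambda>x. complex_of_real (f x)) \<in> lip_space M T \<alpha> r \<beta> \<and> (\<integral>x. f x \<partial>M) = 0 \<and>
     \<not> (\<exists>\<phi>\<in>lip_space M T \<alpha> r \<beta>. AE x in M. complex_of_real (f x) = \<phi> (T x) - \<phi> x)"

lemma admissible_not_coboundary:
  assumes "admissible f" "reg h K"
  shows "\<not> (AE x in M. f x = h (T x) - h x)"
proof
  assume "AE x in M. f x = h (T x) - h x"
  then have "AE x in M. complex_of_real (f x) = complex_of_real (h (T x)) - complex_of_real (h x)"
    by eventually_elim (simp flip: of_real_diff)
  moreover have "\<not> (AE x in M. complex_of_real (f x) = \<phi> (T x) - \<phi> x)"
    if "\<phi> \<in> lip_space M T \<alpha> r \<beta>" for \<phi>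
    using assms(1) that unfolding admissible_def by blast
  from this[OF lip_space_regI[OF assms(2)]]
  have "\<not> (AE x in M. complex_of_real (f x) = complex_of_real (h (T x)) - complex_of_real (h x))" .
  ultimately show False by contradiction
qed

text \<open>Twice the norm leaves room for the strict inequality above, provided the norm is
  positive; a function of norm 0 vanishes almost everywhere and would be the coboundary of
  0.\<close>

lemma admissible_martingale_approx:
  obtains C where "\<And>f. admissible f \<Longrightarrow> \<exists>m h H K. reg h K \<and> martingale_approx M T f m h H (C * L_norm f)"
proof -
  obtain C where dec: "\<And>f F. reg f F \<Longrightarrow> 0 < F \<Longrightarrow> (\<integral>x. f x \<partial>M) = 0 \<Longrightarrow>
      \<exists>m h H. reg h (C * F) \<and> martingale_approx M T f m h H (C * F)"
    by (rule martingale_decomposition, rule that)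
  have "\<exists>m h H K. reg h K \<and> martingale_approx M T f m h H (2 * C * L_norm f)" if adm: "admissible f" for f
  proof -
    have f: "(\<lambda>x. complex_of_real (f x)) \<in> lip_space M T \<alpha> r \<beta>" and If: "(\<integral>x. f x \<partial>M) = 0"
      using adm unfolding admissible_def by auto
    have npos: "0 < L_norm f"
    proof (rule ccontr)
      assume "\<not> 0 < L_norm f"
      then have "L_norm f = 0" using enn2real_nonneg[of "lip_norm M T \<alpha> r \<beta> (\<lambda>x. complex_of_real (f x))"] by linarith
      then have z: "lip_norm M T \<alpha> r \<beta> (\<lambda>x. complex_of_real (f x)) = 0"
        using f unfolding lip_space_def by (auto simp: enn2real_eq_0_iff)
      have "AE x in M. f x = 0 - 0"
        using esssup_AE[where f = "\<lambda>x. ennreal (cmod (complex_of_real (f x)))" and M = M]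
      proof eventually_elim
        fix x assume "ennreal (cmod (complex_of_real (f x))) \<le> esssup M (\<lambda>x. ennreal (cmod (complex_of_real (f x))))"
        also have "\<dots> \<le> lip_norm M T \<alpha> r \<beta> (\<lambda>x. complex_of_real (f x))" unfolding lip_norm_def by simp
        finally show "f x = 0 - 0" using z by simp
      qed
      then show False using admissible_not_coboundary[OF adm reg_const[of 0]] by contradiction
    qed
    then obtain f' where f': "reg f' (2 * L_norm f)" and eq: "AE x in M. f' x = f x" and fm: "f \<in> borel_measurable M"
      using lip_space_regD[OF f, of "2 * L_norm f"] by auto
    have "(\<integral>x. f' x \<partial>M) = (\<integral>x. f x \<partial>M)"
      using f' eq fm unfolding reg_def by (intro integral_cong_AE) (auto dest: bdd_measD)
    moreover have "0 < 2 * L_norm f" using npos by simp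
    ultimately obtain m h H where h: "reg h (C * (2 * L_norm f))"
      and approx: "martingale_approx M T f' m h H (C * (2 * L_norm f))"
      using dec[OF f'] If by metis
    interpret a: martingale_approx M T f' m h H "C * (2 * L_norm f)" by (rule approx)
    have "AE x in M. f x = m x - h x + h (T x)" using a.f(2) eq by eventually_elim simp
    then have "martingale_approx M T f m h H (C * (2 * L_norm f))"
      using approx fm unfolding martingale_approx_def martingale_approx_axioms_def by simp
    moreover have "C * (2 * L_norm f) = 2 * C * L_norm f" by simp
    ultimately show ?thesis using h by metis
  qed
  then show ?thesis using that by blast
qed

text \<open>If the integral of m^2 vanishes, then m = 0 almost everywhere and f = h \<circ> T - h
  with h in L, which is excluded. The constant depends on the system only, not on f.\<close>

lemma char_estimate:
  obtains C where "\<And>f. admissible f \<Longrightarrow> 0 < asymptotic_variance M T f"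
    "\<And>f t k. admissible f \<Longrightarrow> 1 \<le> k \<Longrightarrow> t\<^sup>2 \<le> 2 * real k \<Longrightarrow>
      cmod ((\<integral>x. iexp (t / (sqrt (asymptotic_variance M T f) * sqrt k) * birkhoff f k x) \<partial>M) - of_real ((1 - t\<^sup>2 / (2 * real k)) ^ k))
      \<le> char_error t * ((C * L_norm f) ^ 3 / (sqrt (asymptotic_variance M T f) ^ 3 * sqrt k))"
proof -
  obtain C where approx: "\<And>f. admissible f \<Longrightarrow> \<exists>m h H K. reg h K \<and> martingale_approx M T f m h H (C * L_norm f)"
    by (rule admissible_martingale_approx, rule that)
  have var: "0 < asymptotic_variance M T f" if adm: "admissible f" for f
  proof -
    obtain m h H K where h: "reg h K" and a: "martingale_approx M T f m h H (C * L_norm f)"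
      using approx[OF adm] by blast
    interpret a: martingale_approx M T f m h H "C * L_norm f" by (rule a)
    have "a.v \<noteq> 0"
    proof
      assume "a.v = 0"
      then have "AE x in M. (m x)\<^sup>2 = 0"
        unfolding a.v_def using integrable_bdd_meas[OF bdd_meas_power2[OF a.m(1)]]
        by (subst (asm) integral_nonneg_eq_0_iff_AE) auto
      then have "AE x in M. f x = h (T x) - h x" using a.f(2) by eventually_elim simp
      then show False using admissible_not_coboundary[OF adm h] by contradiction
    qed
    then show ?thesis using a.v unfolding a.asymptotic_variance_martingale by simp
  qed
  have "cmod ((\<integral>x. iexp (t / (sqrt (asymptotic_variance M T f) * sqrt k) * birkhoff f k x) \<partial>M) - of_real ((1 - t\<^sup>2 / (2 * real k)) ^ k))
      \<le> char_error t * ((C * L_norm f) ^ 3 / (sqrt (asymptotic_variance M T f) ^ 3 * sqrt k))"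
    if adm: "admissible f" and k: "1 \<le> k" "t\<^sup>2 \<le> 2 * real k" for f t k
  proof -
    obtain m h H where a: "martingale_approx M T f m h H (C * L_norm f)" using approx[OF adm] by blast
    interpret a: martingale_approx M T f m h H "C * L_norm f" by (rule a)
    show ?thesis
      using a.char_birkhoff_normalized[OF _ k] var[OF adm] unfolding a.asymptotic_variance_martingale .
  qed
  then show ?thesis using that var by blast
qed

end

theorem theorem4p1:
  fixes M :: "'a measure" and T :: "'a \<Rightarrow> 'a" and \<alpha> \<beta> :: "'a set set" and r :: real
    and f :: "nat \<Rightarrow> 'a \<Rightarrow> real" and k :: "nat \<Rightarrow> nat" and \<sigma> :: "nat \<Rightarrow> real"
  assumes "gibbs_markov M T \<alpha> r"
    and "measure_preserving_map M T"
    and "topologically_mixing M T \<alpha>"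
    and "partition_mod M \<beta>"
    and "sigma_mod M \<beta> = sigma_mod M (images M T \<alpha>)"
    and "\<And>n. n \<ge> 1 \<Longrightarrow> (\<lambda>x. complex_of_real (f n x)) \<in> lip_space M T \<alpha> r \<beta>"
    and "\<And>n. n \<ge> 1 \<Longrightarrow> (\<integral>x. f n x \<partial>M) = 0"
    and "\<And>n. n \<ge> 1 \<Longrightarrow>
           \<not> (\<exists>\<phi>\<in>lip_space M T \<alpha> r \<beta>. AE x in M. complex_of_real (f n x) = \<phi> (T x) - \<phi> x)"
    and "\<And>n. n \<ge> 1 \<Longrightarrow> k n > 0"
    and "filterlim k at_top sequentially"
  defines "\<sigma> \<equiv> \<lambda>n. sqrt (asymptotic_variance M T (f n))"
  assumes "(\<lambda>n. enn2real (lip_norm M T \<alpha> r \<beta> (\<lambda>x. complex_of_real (f n x))) ^ 3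
                  / (sqrt (real (k n)) * \<sigma> n ^ 3)) \<longlonglongrightarrow> 0"
  shows "weak_conv_m
           (\<lambda>n. distr M borel
              (\<lambda>x. (\<Sum>m<k n. f n ((T ^^ m) x)) / sqrt (real (k n) * (\<sigma> n)\<^sup>2)))
           std_normal_distribution"
proof -
  interpret gibbs_markov_mixing M T \<alpha> \<beta> r
    using assms(1-5) by unfold_locales
  have adm: "admissible (f n)" if "1 \<le> n" for n
    unfolding admissible_def using assms(6-8)[OF that] by blast
  obtain C where var: "\<And>f. admissible f \<Longrightarrow> 0 < asymptotic_variance M T f"
    and est: "\<And>f t k. admissible f \<Longrightarrow> 1 \<le> k \<Longrightarrow> t\<^sup>2 \<le> 2 * real k \<Longrightarrow>
      cmod ((\<integral>x. iexp (t / (sqrt (asymptotic_variance M T f) * sqrt k) * birkhoff f k x) \<partial>M) - of_real ((1 - t\<^sup>2 / (2 * real k)) ^ k))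
      \<le> char_error t * ((C * L_norm f) ^ 3 / (sqrt (asymptotic_variance M T f) ^ 3 * sqrt k))"
    by (rule char_estimate, rule that)
  define X where "X n x = (\<Sum>m<k n. f n ((T ^^ m) x)) / sqrt (real (k n) * (\<sigma> n)\<^sup>2)" for n x
  have fm: "f n \<in> borel_measurable M" if "1 \<le> n" for n
  proof -
    have "(\<lambda>x. complex_of_real (f n x)) \<in> borel_measurable M"
      using assms(6)[OF that] unfolding lip_space_def by simp
    then have "(\<lambda>x. Re (complex_of_real (f n x))) \<in> borel_measurable M" by measurable
    then show ?thesis by simp
  qed
  have Xm: "X n \<in> borel_measurable M" if "1 \<le> n" for n
    unfolding X_def using fm[OF that] by measurable
  have \<sigma>: "0 < \<sigma> n" if "1 \<le> n" for n
    unfolding \<sigma>_def using var[OF adm[OF that]] by simp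
  have char_X: "char (distr M borel (X n)) t = (\<integral>x. iexp (t / (\<sigma> n * sqrt (k n)) * birkhoff (f n) (k n) x) \<partial>M)"
    if n: "1 \<le> n" for n t
  proof -
    have "t * X n x = t / (\<sigma> n * sqrt (k n)) * birkhoff (f n) (k n) x" for x
      unfolding X_def birkhoff_def using \<sigma>[OF n] by (simp add: real_sqrt_mult mult.commute)
    then show ?thesis unfolding char_def using Xm[OF n] by (subst integral_distr) (auto simp: of_real_mult[symmetric] simp del: of_real_mult)
  qed
  have lim: "(\<lambda>n. char (distr M borel (X n)) t) \<longlonglongrightarrow> char std_normal_distribution t" for t
  proof -
    let ?e = "\<lambda>n. char_error t * ((C * L_norm (f n)) ^ 3 / (\<sigma> n ^ 3 * sqrt (k n)))"
    let ?p = "\<lambda>n. (1 - t\<^sup>2 / (2 * real (k n))) ^ k n"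
    \<comment> \<open>As C is the same for all n, the error is a fixed multiple of the sequence that
      is assumed to vanish.\<close>
    have "(\<lambda>n. char_error t * C ^ 3 * (L_norm (f n) ^ 3 / (sqrt (real (k n)) * \<sigma> n ^ 3))) \<longlonglongrightarrow> 0"
      by (rule tendsto_mult_right_zero[OF assms(12)])
    then have e0: "?e \<longlonglongrightarrow> 0" by (simp add: power_mult_distrib mult_ac)
    have "\<forall>\<^sub>F n in sequentially. nat \<lceil>t\<^sup>2\<rceil> \<le> k n"
      using assms(10) unfolding filterlim_at_top by blast
    then have "\<forall>\<^sub>F n in sequentially. cmod (char (distr M borel (X n)) t - of_real (?p n)) \<le> ?e n"
      using eventually_ge_at_top[of 1]
    proof eventually_elim
      fix n :: nat assume n: "nat \<lceil>t\<^sup>2\<rceil> \<le> k n" "1 \<le> n"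
      have "t\<^sup>2 \<le> real (k n)" using n(1) by (simp add: nat_le_iff ceiling_le_iff)
      then have "t\<^sup>2 \<le> 2 * real (k n)" by simp
      moreover have "1 \<le> k n" using assms(9)[OF n(2)] by simp
      ultimately show "cmod (char (distr M borel (X n)) t - of_real (?p n)) \<le> ?e n"
        using est[OF adm[OF n(2)], of "k n" t] unfolding char_X[OF n(2)] \<sigma>_def by blast
    qed
    then have "(\<lambda>n. char (distr M borel (X n)) t - of_real (?p n)) \<longlonglongrightarrow> 0"
      using e0 by (rule Lim_null_comparison)
    moreover have "?p \<longlonglongrightarrow> exp (- (t\<^sup>2) / 2)"
    proof -
      have "(\<lambda>n. (1 + (- (t\<^sup>2) / 2) / real (k n)) ^ k n) \<longlonglongrightarrow> exp (- (t\<^sup>2) / 2)"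
        by (rule filterlim_compose[OF tendsto_exp_limit_sequentially assms(10)])
      then show ?thesis by simp
    qed
    then have "(\<lambda>n. complex_of_real (?p n)) \<longlonglongrightarrow> complex_of_real (exp (- (t\<^sup>2) / 2))" by (rule tendsto_of_real)
    ultimately have "(\<lambda>n. (char (distr M borel (X n)) t - of_real (?p n)) + of_real (?p n)) \<longlonglongrightarrow> 0 + complex_of_real (exp (- (t\<^sup>2) / 2))"
      by (rule tendsto_add)
    then show ?thesis by (simp add: char_std_normal_distribution)
  qed
  \<comment> \<open>The shift drops the index 0, for which nothing is assumed about f, while the
    continuity theorem requires each term to be a probability distribution.\<close>
  have "weak_conv_m (\<lambda>n. distr M borel (X (Suc n))) std_normal_distribution"
  proof (rule levy_continuity)
    show "real_distribution (distr M borel (X (Suc n)))" for n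
      by (rule real_distribution_distr) (use Xm in simp)
    show "real_distribution std_normal_distribution" by (rule real_dist_normal_dist)
    show "(\<lambda>n. char (distr M borel (X (Suc n))) t) \<longlonglongrightarrow> char std_normal_distribution t" for t
      using LIMSEQ_Suc[OF lim] .
  qed
  then have "weak_conv_m (\<lambda>n. distr M borel (X n)) std_normal_distribution"
    unfolding weak_conv_m_def weak_conv_def by (auto intro: LIMSEQ_imp_Suc)
  then show ?thesis unfolding X_def .
qed

end
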